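(* Let $L\colon\mathbb R^n\times\mathbb R^n\to\mathbb R_+$ and $\varphi\colon\mathbb R^n\to\mathbb R_+\cup\{+\infty\}$ satisfy the standing assumptions listed in the context, let $V$ be the value function and $H$ the Hamiltonian, and assume that $L$ is continuous. Then: (i) $V$ is (finite and) locally Lipschitz on $\mathbb R_+^\star\times\mathbb R^n$ and is a viscosity solution of $V_t+H(x,-V_x)=0$ there, i.e. $$\forall (t,x)\in\mathbb R_+^\star\times\mathbb R^n,\ \forall (p_t,p_x)\in\partial_-V(t,x):\quad p_t+H(x,-p_x)\ge0, \tag{a}$$ $$\forall (t,x)\in\mathbb R_+^\star\times\mathbb R^n,\ \forall (p_t,p_x)\in\partial_+V(t,x):\quad p_t+H(x,-p_x)\le0. \tag{b}$$ (ii) Let $W\colon\mathbb R_+^\star\times\mathbb R^n\to\mathbb R_+$ be a locally Lipschitz function which satisfies the initial condition $$\forall x\in\mathbb R^n:\quad \liminf_{h\to0+,\ y\to x}W(h,y)=\varphi(x). \tag{c}$$ If $W$ is a viscosity supersolution, i.e. $p_t+H(x,-p_x)\ge0$ for all $(t,x)\in\mathbb R_+^\star\times\mathbb R^n$ and all $(p_t,p_x)\in\partial_-W(t,x)$, then $W\ge V$ on $\mathbb R_+^\star\times\mathbb R^n$. If $W$ is a viscosity subsolution, i.e. $p_t+H(x,-p_x)\le0$ for all $(t,x)\in\mathbb R_+^\star\times\mathbb R^n$ and all $(p_t,p_x)\in\partial_+W(t,x)$, then $W\le V$ on $\mathbb R_+^\star\times\mathbb R^n$. (iii) Therefore the restriction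 of $V$ to $\mathbb R_+^\star\times\mathbb R^n$ is the unique non-negative locally Lipschitz function on $\mathbb R_+^\star\times\mathbb R^n$ which satisfies (a), (b) and the initial condition (c).
   Context: Notation: $\mathbb R_+=[0,+\infty)$, $\mathbb R_+^\star=(0,+\infty)$. Standing assumptions: $L\colon\mathbb R^n\times\mathbb R^n\to\mathbb R_+$ is lower semicontinuous and $L(x,\cdot)$ is convex for every $x$; there is a convex function $\Theta\colon\mathbb R^n\to\mathbb R_+$ with $\lim_{|u|\to\infty}\Theta(u)/|u|=+\infty$ and $L(x,u)\ge\Theta(u)$ for all $(x,u)$; $\varphi\colon\mathbb R^n\to\mathbb R_+\cup\{+\infty\}$ is lower semicontinuous and not identically $+\infty$. Value function: for $(t,x)\in\mathbb R_+\times\mathbb R^n$, $$V(t,x)=\inf\Big\{\int_0^t L(y(s),y'(s))\,ds+\varphi(y(t)) : y\in W^{1,1}(0,t;\mathbb R^n),\ y(0)=x\Big\}.$$ Hamiltonian: $H(x,p)=\sup_{u\in\mathbb R^n}\big(\langle p,u\rangle-L(x,u)\big)$. Sub- and superdifferential: for a real-valued function $W$ on $\mathbb R_+^\star\times\mathbb R^n$ and a point $z=(t,x)$, $$\partial_-W(z)=\Big\{p\in\mathbb R\times\mathbb R^n : \liminf_{z'\to z}\frac{W(z')-W(z)-\langle p,z'-z\rangle}{|z'-z|}\ge0\Big\},\qquad \partial_+W(z)=-\partial_-(-W)(z).$$ *)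

theory Defs
  imports "HOL-Analysis.Analysis"
begin

definition lsc :: "('a::topological_space \<Rightarrow> 'b::complete_lattice) \<Rightarrow> bool" where
  "lsc f \<longleftrightarrow> (\<forall>z. f z \<le> Liminf (at z) f)"

definition locally_lipschitz_on :: "'a::metric_space set \<Rightarrow> ('a \<Rightarrow> 'b::metric_space) \<Rightarrow> bool" where
  "locally_lipschitz_on D f \<longleftrightarrow> (\<forall>z\<in>D. \<exists>r>0. \<exists>K. K-lipschitz_on (ball z r \<inter> D) f)"

definition test_function :: "real \<Rightarrow> (real \<Rightarrow> real) \<Rightarrow> bool" where
  "test_function t \<psi> \<longleftrightarrow>
     (\<forall>k. (deriv ^^ k) \<psi> differentiable_on UNIV) \<and>
     compact (closure {s. \<psi> s \<noteq> 0}) \<and> closure {s. \<psi> s \<noteq> 0} \<subseteq> {0<..<t}"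

(* y belongs to the Sobolev space W^{1,1}(0,t) and v represents its weak derivative.
   An element of W^{1,1}(0,t) is represented by its unique continuous representative on [0,t]
   (whence it is automatically integrable), so that the values y 0 and y t make sense.
   For t = 0 the condition holds for every y and v. *)
definition W11_deriv :: "real \<Rightarrow> (real \<Rightarrow> 'a::euclidean_space) \<Rightarrow> (real \<Rightarrow> 'a) \<Rightarrow> bool" where
  "W11_deriv t y v \<longleftrightarrow>
     continuous_on {0..t} y \<and>
     set_integrable lborel {0..t} v \<and>
     (\<forall>\<psi>. test_function t \<psi> \<longrightarrow>
        (LINT s:{0..t}|lborel. deriv \<psi> s *\<^sub>R y s) = - (LINT s:{0..t}|lborel. \<psi> s *\<^sub>R v s))"

(* The weak derivative v is determined by y up to a null set, and the integral does not depend on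
   the choice of v; so taking the infimum over the pairs (y, v) is taking it over y. *)
definition value_function ::
    "('a::euclidean_space \<Rightarrow> 'a \<Rightarrow> real) \<Rightarrow> ('a \<Rightarrow> ennreal) \<Rightarrow> real \<Rightarrow> 'a \<Rightarrow> ennreal" where
  "value_function L \<phi> t x =
     (INF (y, v) \<in> {(y, v). W11_deriv t y v \<and> y 0 = x}.
        (\<integral>\<^sup>+ s\<in>{0..t}. ennreal (L (y s) (v s)) \<partial>lborel) + \<phi> (y t))"

definition hamiltonian :: "('a::euclidean_space \<Rightarrow> 'a \<Rightarrow> real) \<Rightarrow> 'a \<Rightarrow> 'a \<Rightarrow> ereal" where
  "hamiltonian L x p = (SUP u. ereal (p \<bullet> u - L x u))"

definition pos_times :: "(real \<times> 'a) set" where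
  "pos_times = {0<..} \<times> UNIV"

(* Functions on the open set pos_times are total functions whose values elsewhere are irrelevant:
   at a point z of pos_times only the values of W near z enter the limit inferior. *)
definition subdifferential :: "('z::euclidean_space \<Rightarrow> real) \<Rightarrow> 'z \<Rightarrow> 'z set" where
  "subdifferential W z =
     {p. Liminf (at z) (\<lambda>z'. ereal ((W z' - W z - p \<bullet> (z' - z)) / norm (z' - z))) \<ge> 0}"

definition superdifferential :: "('z::euclidean_space \<Rightarrow> real) \<Rightarrow> 'z \<Rightarrow> 'z set" where
  "superdifferential W z = uminus ` subdifferential (\<lambda>z'. - W z') z"

definition viscosity_supersolution ::
    "('a::euclidean_space \<Rightarrow> 'a \<Rightarrow> real) \<Rightarrow> (real \<times> 'a \<Rightarrow> real) \<Rightarrow> bool" where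
  "viscosity_supersolution L W \<longleftrightarrow>
     (\<forall>(t, x)\<in>pos_times. \<forall>(p\<^sub>t, p\<^sub>x)\<in>subdifferential W (t, x).
        ereal p\<^sub>t + hamiltonian L x (- p\<^sub>x) \<ge> 0)"

definition viscosity_subsolution ::
    "('a::euclidean_space \<Rightarrow> 'a \<Rightarrow> real) \<Rightarrow> (real \<times> 'a \<Rightarrow> real) \<Rightarrow> bool" where
  "viscosity_subsolution L W \<longleftrightarrow>
     (\<forall>(t, x)\<in>pos_times. \<forall>(p\<^sub>t, p\<^sub>x)\<in>superdifferential W (t, x).
        ereal p\<^sub>t + hamiltonian L x (- p\<^sub>x) \<le> 0)"

definition initial_condition ::
    "('a::euclidean_space \<Rightarrow> ennreal) \<Rightarrow> (real \<times> 'a \<Rightarrow> real) \<Rightarrow> bool" where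
  "initial_condition \<phi> W \<longleftrightarrow>
     (\<forall>x. Liminf (at_right 0 \<times>\<^sub>F nhds x) (\<lambda>z. ereal (W z)) = enn2ereal (\<phi> x))"

end

(* A curve of class W^{1,1} is the integral of its weak derivative, so V is an infimum of c + phi(z)
   over the relation "z is reached from x in time t at cost c", which is stable under concatenation
   and splitting. Since L >= 0, one of the n blocks of equal duration of a curve of cost c has cost at
   most c/n and hence bounded mean speed; running straight through it in less time saves time h at an
   extra cost O(h). So the end points and the duration of a curve can be perturbed at a cost
   proportional to the perturbation, and V is locally Lipschitz although no bound on L from above is
   uniform in the velocity. (a) and (b) then follow from dynamic programming.

   For a subsolution W, penalised maximisation gives W(t,x) <= h M + W(t-h, x+hu) whenever
   L(.,u) < M near the segment, and the Henstock lemma, applied to the velocity and to the running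
   cost at the same time, sums this up along any curve without differentiating it. For a
   supersolution W, an Euler scheme whose velocities are nearly optimal for subgradients of an
   inf-convolution of W produces polygons with cost + W(delta, end point) <= W(t,x) + e. In both
   comparisons the limit in the initial condition is absorbed by perturbing the end point. *)

theory Submission
  imports Defs "HOL-Computational_Algebra.Polynomial"
begin

subsection \<open>Curves, reachability and cost\<close>

text \<open>No optimal curve is ever used: the value function is handled through curves that are
  optimal up to an error, which in the proof of (a) must be small compared with the elapsed time.
  Superlinear growth always enters in the form \<open>K * norm u - C \<le> L x u\<close>, with
  \<open>K\<close> chosen to beat a slope already known: slope 1 bounds displacements, the norm of a
  subgradient plus 1 excludes large velocities, a Lipschitz constant plus 1 shows that nearly
  optimal curves move by O(h) in time h.

  Two obstacles shape the rest. L is merely continuous, so adding even a small perturbation to a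
  curve of unbounded velocity may change its cost beyond control; a curve is therefore altered only
  by replacing a block of controlled mean speed by a segment, or by attaching a segment at one end.
  And \<phi> is merely lower semicontinuous and may be infinite, so nothing extends continuously to
  time 0; comparison takes place on times bounded away from 0, and a curve is then redirected to a
  point where the initial condition can be read off.\<close>

definition trajectory :: "real \<Rightarrow> (real \<Rightarrow> 'a::euclidean_space) \<Rightarrow> (real \<Rightarrow> 'a) \<Rightarrow> bool" where
  "trajectory t y v \<longleftrightarrow>
     set_integrable lborel {0..t} v \<and> (\<forall>s\<in>{0..t}. (v has_integral (y s - y 0)) {0..s})"

text \<open>
  Henstock-Kurzweil integrals can be split and concatenated without measurability conditions; for the
  nonnegative integrand they agree with Lebesgue integrals.
\<close>

definition reaches ::
    "('a::euclidean_space \<Rightarrow> 'a \<Rightarrow> real) \<Rightarrow> real \<Rightarrow> 'a \<Rightarrow> 'a \<Rightarrow> real \<Rightarrow> bool" where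
  "reaches L t x z c \<longleftrightarrow> 0 \<le> t \<and>
     (\<exists>y v. trajectory t y v \<and> y 0 = x \<and> y t = z \<and> ((\<lambda>s. L (y s) (v s)) has_integral c) {0..t})"

lemma trajectory_has_integral:
  assumes "trajectory t y v" "0 \<le> a" "a \<le> b" "b \<le> t"
  shows "(v has_integral (y b - y a)) {a..b}"
proof -
  have b: "(v has_integral (y b - y 0)) {0..b}" and a: "(v has_integral (y a - y 0)) {0..a}"
    using assms by (auto simp: trajectory_def)
  have "v integrable_on {a..b}"
    by (rule integrable_subinterval_real[of _ 0 b]) (use b assms in auto)
  then have ab: "(v has_integral integral {a..b} v) {a..b}" by blast
  have "(v has_integral (y a - y 0) + integral {a..b} v) {0..b}"
    by (rule has_integral_combine[OF _ _ a ab]) (use assms in auto)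
  from has_integral_unique[OF this b] have "integral {a..b} v = y b - y a"
    by (simp add: algebra_simps)
  with ab show ?thesis by simp
qed

lemma trajectory_continuous_on:
  assumes "trajectory t y v"
  shows "continuous_on {0..t} y"
proof (cases "0 \<le> t")
  case True
  have "v integrable_on {0..t}"
    using trajectory_has_integral[OF assms, of 0 t] True by auto
  then have "continuous_on {0..t} (\<lambda>s. y 0 + integral {0..s} v)"
    by (intro continuous_intros indefinite_integral_continuous_1)
  moreover have "y 0 + integral {0..s} v = y s" if "s \<in> {0..t}" for s
    using trajectory_has_integral[OF assms, of 0 s] that by (auto dest!: integral_unique)
  ultimately show ?thesis
    by (metis (no_types, lifting) continuous_on_cong)
qed auto

lemma trajectory_take:
  assumes "trajectory t y v" "s \<le> t"
  shows "trajectory s y v"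
  using assms unfolding trajectory_def
  by (auto intro: set_integrable_subset[where A = "{0..t}"])

lemma set_integrable_shift:
  fixes f :: "real \<Rightarrow> 'a::{banach, second_countable_topology}"
  shows "set_integrable lborel {a..b} (\<lambda>r. f (s + r)) \<longleftrightarrow> set_integrable lborel {a + s..b + s} f"
proof -
  have "(\<lambda>r. indicator {a..b} r *\<^sub>R f (s + r)) =
        (\<lambda>r. (\<lambda>r. indicator {a + s..b + s} r *\<^sub>R f r) (s + 1 * r))"
    by (auto simp: indicator_def)
  then show ?thesis
    unfolding set_integrable_def by (subst lborel_integrable_real_affine_iff[symmetric, of 1 _ s]) simp_all
qed

lemma trajectory_drop:
  assumes "trajectory t y v" "0 \<le> s" "s \<le> t"
  shows "trajectory (t - s) (\<lambda>r. y (s + r)) (\<lambda>r. v (s + r))"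
  unfolding trajectory_def
proof (intro conjI ballI)
  have "set_integrable lborel {s..t} v"
    using assms by (auto simp: trajectory_def intro: set_integrable_subset[where A = "{0..t}"])
  then show "set_integrable lborel {0..t - s} (\<lambda>r. v (s + r))"
    by (simp add: set_integrable_shift)
next
  fix r assume "r \<in> {0..t - s}"
  then have "(v has_integral (y (s + r) - y s)) {s..s + r}"
    by (intro trajectory_has_integral[OF assms(1)]) (use assms in auto)
  then show "((\<lambda>r. v (s + r)) has_integral y (s + r) - y (s + 0)) {0..r}"
    using has_integral_shift_real_ivl[of v _ s "s + r" s] by (simp add: add.commute)
qed

lemma has_integral_append:
  fixes f g :: "real \<Rightarrow> 'a::banach"
  assumes "(f has_integral i) {0..s}" "(g has_integral j) {0..r}" "0 \<le> s" "0 \<le> r"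
  shows "((\<lambda>q. if q \<le> s then f q else g (q - s)) has_integral (i + j)) {0..s + r}"
proof (rule has_integral_combine)
  show "((\<lambda>q. if q \<le> s then f q else g (q - s)) has_integral i) {0..s}"
    by (rule has_integral_eq[OF _ assms(1)]) simp
  have "((\<lambda>q. g (q - s)) has_integral j) {s..s + r}"
    using has_integral_shift_real_ivl[OF assms(2), of "- s"] by (simp add: add.commute)
  \<comment> \<open>At the junction \<open>q = s\<close> the integrand takes its first branch; a
    single point does not affect the integral.\<close>
  then show "((\<lambda>q. if q \<le> s then f q else g (q - s)) has_integral j) {s..s + r}"
    by (rule has_integral_spike_finite[where S = "{s}", rotated -1]) auto
qed (use assms in auto)

lemma trajectory_append:
  assumes 1: "trajectory s y v" and 2: "trajectory r y' v'" and s: "0 \<le> s" and r: "0 \<le> r"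
    and eq: "y s = y' 0"
  shows "trajectory (s + r) (\<lambda>q. if q \<le> s then y q else y' (q - s))
           (\<lambda>q. if q \<le> s then v q else v' (q - s))" (is "trajectory _ ?y ?v")
  unfolding trajectory_def
proof (intro conjI ballI)
  have "set_integrable lborel {0..s} ?v"
    using 1 unfolding trajectory_def
    by (subst set_integrable_cong[OF refl refl, of _ _ v]) auto
  \<comment> \<open>The half-open interval makes the two pieces disjoint and leaves the junction to
    the first branch.\<close>
  moreover have "set_integrable lborel {s<..s + r} ?v"
  proof (rule set_integrable_cong[THEN iffD2, OF refl refl, of _ _ "\<lambda>q. v' (-s + q)"])
    have "set_integrable lborel {s..s + r} (\<lambda>q. v' (-s + q))"
      using 2 unfolding trajectory_def by (subst set_integrable_shift) simp
    then show "set_integrable lborel {s<..s + r} (\<lambda>q. v' (-s + q))"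
      by (rule set_integrable_subset) auto
  qed auto
  ultimately have "set_integrable lborel ({0..s} \<union> {s<..s + r}) ?v"
    by (rule set_integrable_Un) auto
  moreover have "{0..s} \<union> {s<..s + r} = {0..s + r}" using s r by auto
  ultimately show "set_integrable lborel {0..s + r} ?v" by simp
next
  fix q assume q: "q \<in> {0..s + r}"
  show "(?v has_integral (?y q - ?y 0)) {0..q}"
  proof (cases "q \<le> s")
    case True
    have "(v has_integral (y q - y 0)) {0..q}"
      by (rule trajectory_has_integral[OF 1]) (use q True in auto)
    then show ?thesis using True s
      by (auto intro: has_integral_eq[of _ v, rotated])
  next
    case False
    have "(?v has_integral ((y s - y 0) + (y' (q - s) - y' 0))) {0..s + (q - s)}"
      by (rule has_integral_append; (rule trajectory_has_integral[OF 1] trajectory_has_integral[OF 2])?)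
        (use q False s in auto)
    then show ?thesis using False s eq by simp
  qed
qed

lemma trajectory_line: "trajectory t (\<lambda>s. x + s *\<^sub>R u) (\<lambda>s. u)"
proof -
  have "((\<lambda>s. u) has_integral (s *\<^sub>R u)) {0..s}" if "0 \<le> s" for s
    using has_integral_const_real[of u 0 s] that by simp
  then show ?thesis
    by (auto simp: trajectory_def intro: borel_integrable_atLeastAtMost')
qed

lemma reaches_append:
  assumes "reaches L s x y c" "reaches L r y z d"
  shows "reaches L (s + r) x z (c + d)"
proof -
  from assms obtain y1 v1 y2 v2 where
    1: "trajectory s y1 v1" "y1 0 = x" "y1 s = y" "((\<lambda>q. L (y1 q) (v1 q)) has_integral c) {0..s}" and
    2: "trajectory r y2 v2" "y2 0 = y" "y2 r = z" "((\<lambda>q. L (y2 q) (v2 q)) has_integral d) {0..r}"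
    and "0 \<le> s" "0 \<le> r"
    by (auto simp: reaches_def)
  let ?y = "\<lambda>q. if q \<le> s then y1 q else y2 (q - s)"
  let ?v = "\<lambda>q. if q \<le> s then v1 q else v2 (q - s)"
  have "trajectory (s + r) ?y ?v"
    using 1 2 \<open>0 \<le> s\<close> \<open>0 \<le> r\<close> by (intro trajectory_append) auto
  moreover have "((\<lambda>q. L (?y q) (?v q)) has_integral (c + d)) {0..s + r}"
    using has_integral_append[OF 1(4) 2(4) \<open>0 \<le> s\<close> \<open>0 \<le> r\<close>]
    by (rule has_integral_eq[rotated]) simp
  moreover have "?y 0 = x" "?y (s + r) = z"
    using 1 2 \<open>0 \<le> s\<close> \<open>0 \<le> r\<close> by (auto simp: order_antisym)
  ultimately show ?thesis
    unfolding reaches_def using \<open>0 \<le> s\<close> \<open>0 \<le> r\<close>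
    by (intro conjI exI[of _ ?y] exI[of _ ?v]) auto
qed

lemma reaches_split:
  assumes "reaches L t x z c" "0 \<le> s" "s \<le> t"
  obtains y c1 c2 where "reaches L s x y c1" "reaches L (t - s) y z c2" "c = c1 + c2"
proof -
  from assms obtain y v where
    *: "trajectory t y v" "y 0 = x" "y t = z" "((\<lambda>q. L (y q) (v q)) has_integral c) {0..t}"
    by (auto simp: reaches_def)
  let ?f = "\<lambda>q. L (y q) (v q)"
  have 1: "(?f has_integral (integral {0..s} ?f)) {0..s}"
    by (rule integrable_integral, rule integrable_subinterval_real[of _ 0 t]) (use *(4) assms in auto)
  have 2: "(?f has_integral (integral {s..t} ?f)) {s..t}"
    by (rule integrable_integral, rule integrable_subinterval_real[of _ 0 t]) (use *(4) assms in auto)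
  have "c = integral {0..s} ?f + integral {s..t} ?f"
    using has_integral_combine[OF assms(2,3) 1 2] *(4) has_integral_unique by blast
  moreover have "reaches L s x (y s) (integral {0..s} ?f)"
    unfolding reaches_def using trajectory_take[OF *(1)] 1 * assms by auto
  moreover have "reaches L (t - s) (y s) z (integral {s..t} ?f)"
    unfolding reaches_def
  proof (intro conjI exI)
    show "trajectory (t - s) (\<lambda>r. y (s + r)) (\<lambda>r. v (s + r))"
      by (rule trajectory_drop) (use * assms in auto)
    show "((\<lambda>r. L (y (s + r)) (v (s + r))) has_integral (integral {s..t} ?f)) {0..t - s}"
      using has_integral_shift_real_ivl[OF 2, of s] by (simp add: add.commute)
  qed (use * assms in auto)
  ultimately show thesis using that by blast
qed

lemma reaches_refl: "reaches L 0 x x 0"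
  unfolding reaches_def
  using trajectory_line[of 0 x 0] has_integral_refl(2)[of "\<lambda>s. L x 0" 0]
  by (intro conjI exI[of _ "\<lambda>s. x"] exI[of _ "\<lambda>s. 0"]) simp_all

subsection \<open>Weak derivatives\<close>

definition smooth :: "(real \<Rightarrow> real) \<Rightarrow> bool" where
  "smooth f \<longleftrightarrow> (\<forall>k. (deriv ^^ k) f differentiable_on UNIV)"

lemma deriv_funpow_eq:
  fixes F :: "nat \<Rightarrow> real \<Rightarrow> real"
  assumes "\<And>k x. (F k has_real_derivative F (Suc k) x) (at x)"
  shows "(deriv ^^ k) (F 0) = F k"
proof (induction k)
  case (Suc k)
  then show ?case using assms[of k] by (auto intro!: DERIV_imp_deriv)
qed auto

text \<open>A tower of successive derivatives is easier to exhibit than iterates of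
  \<open>deriv\<close>: closure properties become explicit formulas for \<open>F k\<close>, and
  uniqueness of derivatives recovers the iterates.\<close>

lemma smooth_iff:
  "smooth f \<longleftrightarrow> (\<exists>F. F 0 = f \<and> (\<forall>k x. (F k has_real_derivative F (Suc k) x) (at x)))"
proof
  assume "smooth f"
  then have "((deriv ^^ k) f has_real_derivative (deriv ^^ Suc k) f x) (at x)" for k x
    unfolding smooth_def differentiable_on_def real_differentiable_def funpow.simps o_def
    by (metis DERIV_imp_deriv UNIV_I)
  then show "\<exists>F. F 0 = f \<and> (\<forall>k x. (F k has_real_derivative F (Suc k) x) (at x))"
    by (intro exI[of _ "\<lambda>k. (deriv ^^ k) f"]) auto
next
  assume "\<exists>F. F 0 = f \<and> (\<forall>k x. (F k has_real_derivative F (Suc k) x) (at x))"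
  then obtain F where "F 0 = f" and F: "\<And>k x. (F k has_real_derivative F (Suc k) x) (at x)"
    by auto
  then have "(deriv ^^ k) f = F k" for k using deriv_funpow_eq[of F] by auto
  then show "smooth f"
    using F by (auto simp: smooth_def differentiable_on_def real_differentiable_def)
qed

lemma smooth_affine:
  assumes "smooth f"
  shows "smooth (\<lambda>x. f ((x - a) / e))"
proof -
  obtain F where "F 0 = f" and F: "\<And>k x. (F k has_real_derivative F (Suc k) x) (at x)"
    using assms unfolding smooth_iff by auto
  \<comment> \<open>For \<open>e = 0\<close> the convention on division makes the function constant
    and the claimed derivative 0, so no case split is needed.\<close>
  have "((\<lambda>x. F k ((x - a) / e) / e ^ k) has_real_derivative F (Suc k) ((x - a) / e) / e ^ Suc k) (at x)"
    for k x
  proof -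
    have "((\<lambda>x. (x - a) / e) has_real_derivative 1 / e) (at x)"
      by (rule DERIV_cdivide) (auto intro!: derivative_eq_intros)
    from DERIV_cdivide[OF DERIV_chain2[OF F this], of k "e ^ k"] show ?thesis by simp
  qed
  then show ?thesis
    unfolding smooth_iff using \<open>F 0 = f\<close>
    by (intro exI[of _ "\<lambda>k x. F k ((x - a) / e) / e ^ k"]) auto
qed

lemma smooth_diff:
  assumes "smooth f" "smooth g"
  shows "smooth (\<lambda>x. f x - g x)"
proof -
  obtain F G where "F 0 = f" "G 0 = g"
    and "\<And>k x. (F k has_real_derivative F (Suc k) x) (at x)"
    and "\<And>k x. (G k has_real_derivative G (Suc k) x) (at x)"
    using assms unfolding smooth_iff by metis
  then show ?thesis
    unfolding smooth_iff
    by (intro exI[of _ "\<lambda>k x. F k x - G k x"]) (auto intro: derivative_intros)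
qed

lemma smooth_antiderivative:
  assumes "smooth f" "\<And>x. (g has_real_derivative f x) (at x)"
  shows "smooth g"
proof -
  obtain F where "F 0 = f" and F: "\<And>k x. (F k has_real_derivative F (Suc k) x) (at x)"
    using assms unfolding smooth_iff by auto
  then have "((case k of 0 \<Rightarrow> g | Suc j \<Rightarrow> F j) has_real_derivative (case Suc k of 0 \<Rightarrow> g | Suc j \<Rightarrow> F j) x) (at x)"
    for k x using assms(2) by (cases k) auto
  then show ?thesis
    unfolding smooth_iff by (intro exI[of _ "\<lambda>k. case k of 0 \<Rightarrow> g | Suc j \<Rightarrow> F j"]) auto
qed

text \<open>Serves at the gluing points of a piecewise definition: no formula for \<open>f\<close>
  is needed there, only a bound that is flat at \<open>a\<close>.\<close>

lemma has_real_derivative_zero_squeeze: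
  fixes f h :: "real \<Rightarrow> real"
  assumes "\<And>x. \<bar>f x\<bar> \<le> h x" "(h has_real_derivative 0) (at a)" "h a = 0"
  shows "(f has_real_derivative 0) (at a)"
proof -
  have f0: "f a = 0" using assms(1)[of a] assms(3) by simp
  have "((\<lambda>x. (h x - h a) / (x - a)) \<longlongrightarrow> 0) (at a)"
    using assms(2) by (simp add: has_field_derivative_iff)
  then have "((\<lambda>x. (f x - f a) / (x - a)) \<longlongrightarrow> 0) (at a)"
    by (rule Lim_null_comparison[rotated, OF tendsto_rabs_zero])
      (auto intro!: always_eventually divide_right_mono order_trans[OF assms(1)] simp: f0 assms(3))
  then show ?thesis by (simp add: has_field_derivative_iff)
qed

text \<open>
  These functions are closed under differentiation up to a change of \<open>p\<close> and \<open>n\<close>; for \<open>q = x (1 - x)\<close>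
  they give a smooth function supported in \<open>[0, 1]\<close>. At the zeros of \<open>q\<close> they vanish to second order,
  whatever \<open>n\<close> is.
\<close>

definition bump_term :: "real poly \<Rightarrow> real poly \<Rightarrow> nat \<Rightarrow> real \<Rightarrow> real" where
  "bump_term q p n x = (if 0 < poly q x then poly p x / poly q x ^ n * exp (- (1 / poly q x)) else 0)"

text \<open>With \<open>N = n + 2\<close>, the inequality between the power \<open>N\<close> of
  \<open>1 + (1 / r) / N\<close> and \<open>exp (1 / r)\<close> gives
  \<open>exp (- (1 / r)) \<le> (r * N) ^ N\<close>. The two surplus powers of \<open>r\<close>
  survive the division by \<open>r ^ n\<close> and give the double zero.\<close>

lemma bump_term_le: "\<bar>bump_term q p n x\<bar> \<le> (1 + (poly p x)\<^sup>2) * (real (n + 2) ^ (n + 2) * (poly q x)\<^sup>2)"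
proof (cases "0 < poly q x")
  case True
  define r N where "r = poly q x" and "N = n + 2"
  have r: "0 < r" using True by (simp add: r_def)
  have "(1 / (r * real N)) ^ N \<le> (1 + (1 / r) / real N) ^ N"
    using r by (intro power_mono) (auto simp: N_def)
  also have "\<dots> \<le> exp (1 / r)"
    by (rule exp_ge_one_plus_x_over_n_power_n) (use r in \<open>auto simp: N_def intro: order_trans[of _ 0]\<close>)
  finally have exp_le: "exp (- (1 / r)) \<le> (r * real N) ^ N"
    using r by (simp add: exp_minus power_one_over N_def inverse_eq_divide pos_divide_le_eq
        mult.commute del: power_Suc)
  have "r ^ N = r ^ n * r\<^sup>2" by (simp add: N_def power_add power2_eq_square)
  then have "(r * real N) ^ N = real N ^ N * r\<^sup>2 * r ^ n" by (simp add: power_mult_distrib)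
  with exp_le have "exp (- (1 / r)) / r ^ n \<le> real N ^ N * r\<^sup>2"
    using r by (simp add: pos_divide_le_eq)
  \<comment> \<open>Trading the absolute value for a square makes the final bound a polynomial in
    \<open>x\<close>, hence differentiable.\<close>
  moreover have "\<bar>poly p x\<bar> \<le> 1 + (poly p x)\<^sup>2"
  proof -
    have "0 \<le> (\<bar>poly p x\<bar> - 1)\<^sup>2" by simp
    then show ?thesis by (simp add: power2_diff)
  qed
  ultimately have "\<bar>poly p x\<bar> * (exp (- (1 / r)) / r ^ n) \<le> (1 + (poly p x)\<^sup>2) * (real N ^ N * r\<^sup>2)"
    using r by (intro mult_mono) auto
  then show ?thesis using r by (simp add: bump_term_def r_def N_def abs_mult)
qed (simp add: bump_term_def)

text \<open>Where q is positive this is calculus, where q is negative the function vanishes locally.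
  At a zero of q the quadratic bound forces the derivative 0, which is also what the default branch
  of \<open>bump_term\<close> returns.\<close>

lemma bump_term_deriv:
  "(bump_term q p n has_real_derivative
     bump_term q (pderiv p * q\<^sup>2 - of_nat n * p * pderiv q * q + p * pderiv q) (n + 2) x) (at x)"
    (is "(_ has_real_derivative bump_term q ?p (n + 2) x) _")
proof -
  consider "0 < poly q x" | "poly q x < 0" | "poly q x = 0" by linarith
  then show ?thesis
  proof cases
    case 1
    have "open {x. 0 < poly q x}" by (intro open_Collect_less continuous_intros)
    moreover have "((\<lambda>x. poly p x / poly q x ^ n * exp (- (1 / poly q x))) has_real_derivative
        bump_term q ?p (n + 2) x) (at x)"
    proof -
      define r where "r = poly q x"
      have r: "r \<noteq> 0" using 1 by (simp add: r_def)
      have n: "r ^ n = r * r ^ (n - Suc 0)" if "n \<noteq> 0" using that by (cases n) auto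
      have "((\<lambda>x. poly p x / poly q x ^ n * exp (- (1 / poly q x))) has_real_derivative
         ((poly (pderiv p) x * r ^ n - poly p x * (real n * r ^ (n - Suc 0) * poly (pderiv q) x)) / (r ^ n * r ^ n))
          * exp (- (1 / r)) + (poly (pderiv q) x / (r * r)) * exp (- (1 / r)) * (poly p x / r ^ n)) (at x)"
        using 1 unfolding r_def
        by (auto intro!: derivative_eq_intros simp: power2_eq_square) (simp add: field_simps)
      also have "(poly (pderiv p) x * r ^ n - poly p x * (real n * r ^ (n - Suc 0) * poly (pderiv q) x)) / (r ^ n * r ^ n)
          * exp (- (1 / r)) + (poly (pderiv q) x / (r * r)) * exp (- (1 / r)) * (poly p x / r ^ n)
        = (poly (pderiv p) x * r\<^sup>2 - real n * poly p x * poly (pderiv q) x * r + poly p x * poly (pderiv q) x)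
          / r ^ (n + 2) * exp (- (1 / r))"
        using r n by (cases "n = 0") (simp_all add: field_simps power2_eq_square power_add)
      also have "\<dots> = bump_term q ?p (n + 2) x"
        using 1 by (simp add: bump_term_def r_def[symmetric] poly_power)
      finally show ?thesis .
    qed
    ultimately show ?thesis
      using has_field_derivative_transform_within_open[of _ _ x "{x. 0 < poly q x}" "bump_term q p n"] 1
      by (auto simp: bump_term_def)
  next
    case 2
    have "open {x. poly q x < 0}" by (intro open_Collect_less continuous_intros)
    moreover have "((\<lambda>x. 0) has_real_derivative 0) (at x)" by simp
    ultimately have "(bump_term q p n has_real_derivative 0) (at x)"
      using has_field_derivative_transform_within_open[of "\<lambda>_. 0" 0 x "{x. poly q x < 0}" "bump_term q p n"] 2
      by (auto simp: bump_term_def)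
    then show ?thesis using 2 by (simp add: bump_term_def)
  next
    case 3
    have "(bump_term q p n has_real_derivative 0) (at x)"
    proof (rule has_real_derivative_zero_squeeze[OF bump_term_le])
      show "((\<lambda>x. (1 + (poly p x)\<^sup>2) * (real (n + 2) ^ (n + 2) * (poly q x)\<^sup>2)) has_real_derivative 0) (at x)"
        using 3 by (auto intro!: derivative_eq_intros)
    qed (simp add: 3)
    then show ?thesis using 3 by (simp add: bump_term_def)
  qed
qed

lemma smooth_bump_term: "smooth (bump_term q p n)"
proof -
  \<comment> \<open>\<open>N\<close> is the update of numerator and exponent under one
    differentiation; its iterates index the tower of derivatives.\<close>
  define N where "N = (\<lambda>(p, n). (pderiv p * q\<^sup>2 - of_nat n * p * pderiv q * q + p * pderiv q, n + 2))"
  define F where "F = (\<lambda>k. case_prod (bump_term q) ((N ^^ k) (p, n)))"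
  have "(F k has_real_derivative F (Suc k) x) (at x)" for k x
    using bump_term_deriv[of q "fst ((N ^^ k) (p, n))" "snd ((N ^^ k) (p, n))" x]
    by (simp add: F_def case_prod_unfold) (simp add: N_def case_prod_unfold)
  moreover have "F 0 = bump_term q p n" by (simp add: F_def)
  ultimately show ?thesis unfolding smooth_iff by blast
qed

text \<open>
  \<open>B\<close> is the antiderivative of the bump: differences of its translates are the test functions for
  the lemma of du Bois-Reymond.
\<close>

lemma smooth_step:
  obtains h B :: "real \<Rightarrow> real" and m where "smooth B" "\<And>x. (B has_real_derivative h x) (at x)"
    "\<And>x. 0 \<le> h x" "\<And>x. x \<notin> {0..1} \<Longrightarrow> h x = 0"
    "\<And>x. x \<le> 0 \<Longrightarrow> B x = 0" "\<And>x. 1 \<le> x \<Longrightarrow> B x = m" "0 < m"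
proof -
  define h where "h = bump_term [:0, 1, -1:] 1 0"
  have pos_iff: "0 < x * (1 - x) \<longleftrightarrow> 0 < x \<and> x < 1" for x :: real
    by (auto simp: zero_less_mult_iff)
  have h: "h x = (if 0 < x \<and> x < 1 then exp (- (1 / (x * (1 - x)))) else 0)" for x
    using pos_iff[of x] by (simp add: h_def bump_term_def algebra_simps)
  have smooth: "smooth h" unfolding h_def by (rule smooth_bump_term)
  then have cont: "continuous_on S h" for S
    by (metis DERIV_continuous_on smooth_iff has_field_derivative_at_within)
  \<comment> \<open>The lower limit -1 puts every \<open>x \<ge> 0\<close> in the interior of
    \<open>{-1..x + 1}\<close>, where the derivative within the interval is the full
    derivative.\<close>
  define B where "B = (\<lambda>x. integral {-1..x} h)"
  have B0: "B x = 0" if "x \<le> 0" for x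
  proof -
    have "integral {-1..x} h = integral {-1..x} (\<lambda>_. 0)"
      by (rule integral_cong) (use that in \<open>auto simp: h\<close>)
    then show ?thesis by (simp add: B_def)
  qed
  have deriv: "(B has_real_derivative h x) (at x)" for x
  proof (cases "x < 0")
    case True
    have "(B has_real_derivative 0) (at x)"
      by (rule has_field_derivative_transform_within_open[of "\<lambda>_. 0" _ _ "{..<0}"])
        (use True B0 in auto)
    then show ?thesis using True by (simp add: h)
  next
    case False
    have "(B has_real_derivative h x) (at x within {-1..x + 1})"
      unfolding B_def by (rule integral_has_real_derivative[OF cont]) (use False in auto)
    moreover have "at x within {-1..x + 1} = at x"
      using False by (intro at_within_interior) auto
    ultimately show ?thesis by simp
  qed
  have B1: "B x = B 1" if "1 \<le> x" for x
  proof (cases "x = 1")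
    case False
    with that have "1 < x" by simp
    then obtain z where "1 < z" "B x - B 1 = (x - 1) * h z"
      using MVT2[of 1 x B h] deriv by auto
    then show ?thesis by (simp add: h)
  qed auto
  obtain z where "0 < z" "z < 1" "B 1 - B 0 = (1 - 0) * h z"
    using MVT2[of 0 1 B h] deriv by auto
  then have "0 < B 1" using B0[of 0] by (simp add: h)
  then show thesis
    by (intro that[of B h "B 1"] smooth_antiderivative[OF smooth] deriv B0 B1) (auto simp: h)
qed

section \<open>Integration by parts and functions with vanishing weak derivative\<close>

lemma smooth_test_function: "test_function t \<psi> \<Longrightarrow> smooth \<psi>"
  by (auto simp: test_function_def smooth_def)

lemma test_function_deriv:
  assumes "test_function t \<psi>"
  shows "(\<psi> has_real_derivative deriv \<psi> s) (at s)" "continuous_on S (deriv \<psi>)" "continuous_on S \<psi>"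
    "s \<le> 0 \<or> t \<le> s \<Longrightarrow> \<psi> s = 0"
proof -
  obtain F where F0: "F 0 = \<psi>" and F: "\<And>k x. (F k has_real_derivative F (Suc k) x) (at x)"
    using smooth_test_function[OF assms] unfolding smooth_iff by auto
  have F1: "deriv \<psi> = F 1" using deriv_funpow_eq[of F 1, OF F] F0 by simp
  show "(\<psi> has_real_derivative deriv \<psi> s) (at s)" using F[of 0] F0 F1 by simp
  show "continuous_on S (deriv \<psi>)" "continuous_on S \<psi>"
    using F[of 1] F[of 0] F0 F1 by (metis DERIV_continuous_on has_field_derivative_at_within One_nat_def)+
  show "\<psi> s = 0" if "s \<le> 0 \<or> t \<le> s"
    using assms that closure_subset[of "{s. \<psi> s \<noteq> 0}"] by (force simp: test_function_def)
qed

text \<open>Fubini on the triangle \<open>r \<le> s\<close> for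
  \<open>deriv \<psi> s *\<^sub>R v r\<close>: integrating in \<open>r\<close> first gives
  \<open>y s - y 0\<close>, integrating in \<open>s\<close> first gives \<open>- \<psi> r\<close>,
  because \<psi> vanishes at \<open>t\<close>. No differentiability of \<open>y\<close> is
  involved.\<close>

lemma trajectory_integration_by_parts:
  assumes tr: "trajectory t y v" and t: "0 \<le> t" and \<psi>: "test_function t \<psi>"
  shows "(LINT s:{0..t}|lborel. deriv \<psi> s *\<^sub>R y s) = - (LINT s:{0..t}|lborel. \<psi> s *\<^sub>R v s)"
proof -
  define d where "d = (\<lambda>s. indicator {0..t} s *\<^sub>R deriv \<psi> s)"
  define w where "w = (\<lambda>r. indicator {0..t} r *\<^sub>R v r)"
  define k where "k = (\<lambda>s r. (indicator {..s} r * d s) *\<^sub>R w r)"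
  have sd: "set_integrable lborel {0..t} (deriv \<psi>)"
    by (rule borel_integrable_atLeastAtMost') (rule test_function_deriv[OF \<psi>])
  then have d: "integrable lborel d" by (simp add: set_integrable_def d_def)
  have w: "integrable lborel w"
    using tr by (simp add: trajectory_def set_integrable_def w_def)
  note [measurable] = borel_measurable_integrable[OF d] borel_measurable_integrable[OF w]
  have [measurable]: "case_prod (\<lambda>(s :: real) r. indicator {..s} r :: real) \<in> borel_measurable (lborel \<Otimes>\<^sub>M lborel)"
  proof -
    have eq: "case_prod (\<lambda>s r. indicator {..s} r :: real) = indicator {p :: real \<times> real. snd p \<le> fst p}"
      by (auto simp: indicator_def)
    have "{p :: real \<times> real. snd p \<le> fst p} \<in> sets (lborel \<Otimes>\<^sub>M lborel)"
      unfolding sets_pair_measure_cong[OF sets_lborel sets_lborel] borel_prod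
      by (intro borel_closed closed_Collect_le continuous_intros)
    then show ?thesis unfolding eq by (rule borel_measurable_indicator)
  qed
  have kint: "integrable (lborel \<Otimes>\<^sub>M lborel) (case_prod k)"
  proof (rule Bochner_Integration.integrable_bound)
    \<comment> \<open>The kernel is dominated by the product of \<open>d\<close> and
      \<open>w\<close>, whose iterated integral factors.\<close>
    show "integrable (lborel \<Otimes>\<^sub>M lborel) (\<lambda>(s, r). d s *\<^sub>R w r)"
    proof (rule lborel_pair.Fubini_integrable)
      have "integrable lborel (\<lambda>s. \<bar>d s\<bar> * (\<integral>r. norm (w r) \<partial>lborel))"
        using d by (intro integrable_mult_left integrable_abs)
      then show "integrable lborel (\<lambda>x. \<integral>y. norm (case (x, y) of (s, r) \<Rightarrow> d s *\<^sub>R w r) \<partial>lborel)"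
        by simp
    qed (use w in auto)
    show "case_prod k \<in> borel_measurable (lborel \<Otimes>\<^sub>M lborel)"
      unfolding k_def by measurable
  qed (auto simp: k_def indicator_def)
  have inner1: "(\<integral>r. k s r \<partial>lborel) = indicator {0..t} s *\<^sub>R (deriv \<psi> s *\<^sub>R (y s - y 0))" for s
  proof (cases "s \<in> {0..t}")
    case True
    have "set_integrable lborel {0..s} v"
      using trajectory_take[OF tr] True by (auto simp: trajectory_def)
    from set_borel_integral_eq_integral(2)[OF this]
    have "(LINT r:{0..s}|lborel. v r) = y s - y 0"
      using trajectory_has_integral[OF tr, of 0 s] True by (auto dest: integral_unique)
    moreover have "k s = (\<lambda>r. deriv \<psi> s *\<^sub>R (indicator {0..s} r *\<^sub>R v r))"
      using True by (auto simp: k_def d_def w_def indicator_def)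
    ultimately show ?thesis
      using True by (simp add: set_lebesgue_integral_def del: scaleR_scaleR)
  qed (simp add: k_def d_def)
  have inner2: "(\<integral>s. k s r \<partial>lborel) = indicator {0..t} r *\<^sub>R (- (\<psi> r *\<^sub>R v r))" for r
  proof (cases "r \<in> {0..t}")
    case True
    have "set_integrable lborel {r..t} (deriv \<psi>)"
      using sd by (rule set_integrable_subset) (use True in auto)
    from set_borel_integral_eq_integral(2)[OF this]
    have "(LINT s:{r..t}|lborel. deriv \<psi> s) = integral {r..t} (deriv \<psi>)" .
    also have "\<dots> = \<psi> t - \<psi> r"
      by (rule integral_unique, rule fundamental_theorem_of_calculus)
        (use True test_function_deriv(1)[OF \<psi>] in
          \<open>auto simp: has_real_derivative_iff_has_vector_derivative[symmetric] intro: has_field_derivative_at_within\<close>)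
    also have "\<dots> = - \<psi> r" using test_function_deriv(4)[OF \<psi>, of t] by simp
    finally have "(LINT s:{r..t}|lborel. deriv \<psi> s) = - \<psi> r" .
    moreover have "(\<lambda>s. k s r) = (\<lambda>s. (indicator {r..t} s *\<^sub>R deriv \<psi> s) *\<^sub>R v r)"
      using True by (auto simp: k_def d_def w_def indicator_def)
    moreover have "integrable lborel (\<lambda>s. indicator {r..t} s *\<^sub>R deriv \<psi> s)"
      using \<open>set_integrable lborel {r..t} (deriv \<psi>)\<close> by (simp add: set_integrable_def)
    ultimately show ?thesis using True by (simp add: set_lebesgue_integral_def)
  qed (simp add: k_def w_def)
  have "(LINT s:{0..t}|lborel. deriv \<psi> s *\<^sub>R (y s - y 0)) = (\<integral>s. (\<integral>r. k s r \<partial>lborel) \<partial>lborel)"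
    by (simp add: inner1 set_lebesgue_integral_def)
  also have "\<dots> = (\<integral>r. (\<integral>s. k s r \<partial>lborel) \<partial>lborel)"
    by (rule lborel_pair.Fubini_integral[OF kint, symmetric])
  also have "\<dots> = - (LINT r:{0..t}|lborel. \<psi> r *\<^sub>R v r)"
    by (simp add: inner2 set_lebesgue_integral_def)
  finally have "(LINT s:{0..t}|lborel. deriv \<psi> s *\<^sub>R (y s - y 0)) = - (LINT r:{0..t}|lborel. \<psi> r *\<^sub>R v r)" .
  moreover have "(LINT s:{0..t}|lborel. deriv \<psi> s *\<^sub>R (y s - y 0)) =
      (LINT s:{0..t}|lborel. deriv \<psi> s *\<^sub>R y s) - (LINT s:{0..t}|lborel. deriv \<psi> s *\<^sub>R y 0)"
    unfolding scaleR_diff_right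
    by (rule set_integral_diff(2); rule borel_integrable_atLeastAtMost';
        intro continuous_on_scaleR continuous_on_const trajectory_continuous_on[OF tr]
          test_function_deriv(2)[OF \<psi>])
  \<comment> \<open>The constant \<open>y 0\<close> drops out because \<psi> vanishes at both
    ends.\<close>
  moreover have "(LINT s:{0..t}|lborel. deriv \<psi> s *\<^sub>R y 0) = 0"
  proof -
    have "(LINT s:{0..t}|lborel. deriv \<psi> s) = integral {0..t} (deriv \<psi>)"
      by (rule set_borel_integral_eq_integral(2)[OF sd])
    also have "\<dots> = \<psi> t - \<psi> 0"
      by (rule integral_unique, rule fundamental_theorem_of_calculus)
        (use t test_function_deriv(1)[OF \<psi>] in
          \<open>auto simp: has_real_derivative_iff_has_vector_derivative[symmetric] intro: has_field_derivative_at_within\<close>)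
    finally have "integral\<^sup>L lborel d = 0"
      using test_function_deriv(4)[OF \<psi>, of t] test_function_deriv(4)[OF \<psi>, of 0]
      by (simp add: set_lebesgue_integral_def d_def)
    moreover have "(LINT s:{0..t}|lborel. deriv \<psi> s *\<^sub>R y 0) = (\<integral>s. d s *\<^sub>R y 0 \<partial>lborel)"
      by (simp add: set_lebesgue_integral_def d_def)
    ultimately show ?thesis using d by simp
  qed
  ultimately show ?thesis by simp
qed


text \<open>The difference of two translates of the rescaled step \<open>B\<close> is a test
  function, and its derivative is the difference of two bumps of equal mass just to the right of
  \<open>a\<close> and of \<open>b\<close>. Hence the local averages of \<open>g\<close> there
  agree, and shrinking the bumps gives the values.\<close>

lemma du_Bois_Reymond:
  assumes cont: "continuous_on {0..t} g" and a: "0 < a" and ab: "a < b" and b: "b < t"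
    and weak: "\<And>\<psi>. test_function t \<psi> \<Longrightarrow> integral {0..t} (\<lambda>s. deriv \<psi> s *\<^sub>R g s) = 0"
  shows "g a = (g b :: 'a::euclidean_space)"
proof -
  obtain h B :: "real \<Rightarrow> real" and m where B: "smooth B" "\<And>x. (B has_real_derivative h x) (at x)"
    "\<And>x. 0 \<le> h x" "\<And>x. x \<notin> {0..1} \<Longrightarrow> h x = 0"
    "\<And>x. x \<le> 0 \<Longrightarrow> B x = 0" "\<And>x. 1 \<le> x \<Longrightarrow> B x = m" "0 < m"
    by (rule smooth_step) (rule that)
  have deriv_B: "((\<lambda>s. B ((s - c) / e)) has_real_derivative h ((s - c) / e) / e) (at s)" for c e s
  proof -
    have "((\<lambda>x. (x - c) / e) has_real_derivative 1 / e) (at s)"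
      by (rule DERIV_cdivide) (auto intro!: derivative_eq_intros)
    from DERIV_chain2[OF B(2) this] show ?thesis by simp
  qed
  have cont_h: "continuous_on S h" for S
  proof -
    have "deriv B = h" using B(2) by (intro ext DERIV_imp_deriv)
    moreover have "deriv B differentiable_on UNIV"
      using B(1) unfolding smooth_def by (metis funpow_0 funpow.simps(2) o_apply)
    ultimately show ?thesis using differentiable_imp_continuous_on continuous_on_subset by blast
  qed
  \<comment> \<open>\<open>A e c\<close> is an average of \<open>g\<close> over
    \<open>[c, c + e]\<close>, up to the factor \<open>m\<close>, the mass of the bump.\<close>
  define A where "A = (\<lambda>e c. integral {0..t} (\<lambda>s. (h ((s - c) / e) / e) *\<^sub>R g s))"
  have integrable: "(\<lambda>s. (h ((s - c) / e) / e) *\<^sub>R g s) integrable_on {0..t}" if "0 < e" for c e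
    by (intro integrable_continuous_real continuous_intros cont continuous_on_compose2[OF cont_h])
      (use that in auto)
  have same: "A e a = A e b" if e: "0 < e" "b + e < t" for e
  proof -
    define \<psi> where "\<psi> = (\<lambda>s. B ((s - a) / e) - B ((s - b) / e))"
    have zero: "\<psi> s = 0" if "s \<notin> {a..b + e}" for s
    proof (cases "s < a")
      case True
      then have "(s - a) / e \<le> 0" "(s - b) / e \<le> 0" using e ab by (auto simp: divide_le_0_iff)
      then show ?thesis by (simp add: \<psi>_def B(5))
    next
      case False
      with that have "b + e < s" by auto
      then have "1 \<le> (s - a) / e" "1 \<le> (s - b) / e" using e ab by (auto simp: pos_le_divide_eq)
      then show ?thesis by (simp add: \<psi>_def B(6))
    qed
    have sub: "{s. \<psi> s \<noteq> 0} \<subseteq> {a..b + e}" using zero by blast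
    have "closure {s. \<psi> s \<noteq> 0} \<subseteq> {a..b + e}"
      by (rule closure_minimal[OF sub]) auto
    moreover have "bounded {s. \<psi> s \<noteq> 0}"
      by (rule bounded_subset[OF _ sub]) auto
    moreover have "smooth \<psi>"
      unfolding \<psi>_def by (intro smooth_diff smooth_affine B(1))
    ultimately have "test_function t \<psi>"
      using a e by (auto simp: test_function_def smooth_def compact_closure)
    moreover have "deriv \<psi> s = h ((s - a) / e) / e - h ((s - b) / e) / e" for s
      unfolding \<psi>_def by (intro DERIV_imp_deriv derivative_intros deriv_B)
    ultimately have "integral {0..t} (\<lambda>s. (h ((s - a) / e) / e - h ((s - b) / e) / e) *\<^sub>R g s) = 0"
      using weak[of \<psi>] by simp
    then show ?thesis
      unfolding A_def scaleR_diff_left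
      using integral_diff[OF integrable[OF e(1), of a] integrable[OF e(1), of b]] by simp
  qed
  have close: "norm (A e c - m *\<^sub>R g c) \<le> m * \<eta>"
    if e: "0 < e" "0 \<le> c" "c + e \<le> t" and \<eta>: "\<And>s. c \<le> s \<Longrightarrow> s \<le> c + e \<Longrightarrow> norm (g s - g c) \<le> \<eta>" for e c \<eta>
  proof -
    have mass: "((\<lambda>s. h ((s - c) / e) / e) has_integral m) {0..t}"
    proof -
      have "((\<lambda>s. h ((s - c) / e) / e) has_integral (B ((t - c) / e) - B ((0 - c) / e))) {0..t}"
        by (rule fundamental_theorem_of_calculus)
          (use e in \<open>auto simp: has_real_derivative_iff_has_vector_derivative[symmetric]
            intro: has_field_derivative_at_within deriv_B\<close>)
      moreover have "B ((t - c) / e) = m" by (rule B(6)) (use e in \<open>auto simp: field_simps\<close>)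
      moreover have "B ((0 - c) / e) = 0" by (rule B(5)) (use e in \<open>auto simp: field_simps\<close>)
      ultimately show ?thesis by simp
    qed
    have "((\<lambda>s. (h ((s - c) / e) / e) *\<^sub>R g c) has_integral (m *\<^sub>R g c)) {0..t}"
      by (rule has_integral_scaleR_left[OF mass])
    from has_integral_diff[OF integrable_integral[OF integrable[OF e(1), of c]] this]
    have 1: "((\<lambda>s. (h ((s - c) / e) / e) *\<^sub>R (g s - g c)) has_integral (A e c - m *\<^sub>R g c)) {0..t}"
      by (simp add: A_def scaleR_diff_right)
    have 2: "((\<lambda>s. (h ((s - c) / e) / e) * \<eta>) has_integral (m * \<eta>)) {0..t}"
      by (rule has_integral_mult_left[OF mass])
    have 3: "norm ((h ((s - c) / e) / e) *\<^sub>R (g s - g c)) \<le> (h ((s - c) / e) / e) * \<eta>" for s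
    proof (cases "c \<le> s \<and> s \<le> c + e")
      case True
      have "0 \<le> h ((s - c) / e) / e" using B(3) e by simp
      from mult_left_mono[OF \<eta>[of s] this] True e B(3) show ?thesis by simp
    next
      case False
      then have "h ((s - c) / e) = 0" using e by (intro B(4)) (auto simp: field_simps)
      then show ?thesis by simp
    qed
    show ?thesis
      using integral_norm_bound_integral[OF has_integral_integrable[OF 1] has_integral_integrable[OF 2] 3]
      unfolding integral_unique[OF 1] integral_unique[OF 2] .
  qed
  have "norm (g a - g b) \<le> 2 * \<eta>" if "0 < \<eta>" for \<eta>
  proof -
    have near: "\<exists>d>0. \<forall>s. c \<le> s \<and> s \<le> c + d \<longrightarrow> norm (g s - g c) \<le> \<eta>" if c: "0 \<le> c" "c < t" for c
    proof -
      obtain d where "0 < d" and d: "\<forall>s\<in>{0..t}. dist s c < d \<longrightarrow> dist (g s) (g c) < \<eta>"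
        using cont[unfolded continuous_on_iff, rule_format, of c \<eta>] c \<open>0 < \<eta>\<close> by auto
      show ?thesis
      proof (intro exI[of _ "min (d / 2) (t - c)"] conjI allI impI)
        fix s assume "c \<le> s \<and> s \<le> c + min (d / 2) (t - c)"
        then have "s \<in> {0..t}" "dist s c < d" using c \<open>0 < d\<close> by (auto simp: dist_real_def)
        with d have "dist (g s) (g c) < \<eta>" by blast
        then show "norm (g s - g c) \<le> \<eta>" by (simp add: dist_norm)
      qed (use c \<open>0 < d\<close> in auto)
    qed
    obtain d1 where d1: "0 < d1" "\<forall>s. a \<le> s \<and> s \<le> a + d1 \<longrightarrow> norm (g s - g a) \<le> \<eta>"
      using near[of a] a ab b by auto
    obtain d2 where d2: "0 < d2" "\<forall>s. b \<le> s \<and> s \<le> b + d2 \<longrightarrow> norm (g s - g b) \<le> \<eta>"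
      using near[of b] a ab b by auto
    define e where "e = min (min d1 d2) ((t - b) / 2)"
    have e: "0 < e" "e \<le> d1" "e \<le> d2" using d1 d2 b by (auto simp: e_def)
    have "e \<le> (t - b) / 2" unfolding e_def by (rule min.cobounded2)
    then have bt: "b + e < t" using b by (simp add: field_simps)
    have 1: "norm (A e a - m *\<^sub>R g a) \<le> m * \<eta>"
      by (rule close) (use e a ab bt d1 in auto)
    have 2: "norm (A e b - m *\<^sub>R g b) \<le> m * \<eta>"
      by (rule close) (use e a ab bt d2 in auto)
    have eq: "m *\<^sub>R (g a - g b) = (A e b - m *\<^sub>R g b) - (A e a - m *\<^sub>R g a)"
      using same[OF e(1) bt] by (simp add: scaleR_diff_right)
    have "norm (m *\<^sub>R (g a - g b)) \<le> m * \<eta> + m * \<eta>"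
      unfolding eq
      using 1 2 norm_triangle_ineq4[of "A e b - m *\<^sub>R g b" "A e a - m *\<^sub>R g a"] by linarith
    also have "m * \<eta> + m * \<eta> = m * (2 * \<eta>)" by simp
    finally have "m * norm (g a - g b) \<le> m * (2 * \<eta>)"
      unfolding norm_scaleR using B(7) by (simp only: abs_of_pos)
    then show ?thesis using B(7) by simp
  qed
  \<comment> \<open>With this \<eta> the bound reads that a norm is at most half of itself.\<close>
  from this[of "norm (g a - g b) / 4"] show ?thesis by (cases "g a = g b") auto
qed

text \<open>From weak to integral form: \<open>y\<close> minus the primitive of \<open>v\<close> has
  weak derivative 0. Absolute integrability of \<open>v\<close> is part of both sides, since the
  gauge integral alone would not provide it.\<close>

lemma W11_deriv_iff_trajectory:
  assumes t: "0 < t"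
  shows "W11_deriv t y v \<longleftrightarrow> trajectory t y v"
proof
  assume tr: "trajectory t y v"
  show "W11_deriv t y v"
    unfolding W11_deriv_def
    using trajectory_continuous_on[OF tr] trajectory_integration_by_parts[OF tr] tr t
    by (auto simp: trajectory_def)
next
  assume W: "W11_deriv t y v"
  then have cont: "continuous_on {0..t} y" and v: "set_integrable lborel {0..t} v"
    and weak: "\<And>\<psi>. test_function t \<psi> \<Longrightarrow>
      (LINT s:{0..t}|lborel. deriv \<psi> s *\<^sub>R y s) = - (LINT s:{0..t}|lborel. \<psi> s *\<^sub>R v s)"
    by (auto simp: W11_deriv_def)
  have v_int: "v integrable_on {0..t}" by (rule set_borel_integral_eq_integral(1)[OF v])
  define Y where "Y = (\<lambda>s. integral {0..s} v)"
  have Y: "trajectory t Y v"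
    unfolding trajectory_def
  proof (intro conjI ballI v)
    fix s assume "s \<in> {0..t}"
    then have "v integrable_on {0..s}"
      by (intro integrable_subinterval_real[OF v_int]) auto
    then show "(v has_integral Y s - Y 0) {0..s}" by (simp add: Y_def integrable_integral)
  qed
  have contY: "continuous_on {0..t} Y" by (rule trajectory_continuous_on[OF Y])
  define g where "g = (\<lambda>s. y s - Y s)"
  have contg: "continuous_on {0..t} g" unfolding g_def by (intro continuous_intros cont contY)
  have weak0: "integral {0..t} (\<lambda>s. deriv \<psi> s *\<^sub>R g s) = 0" if \<psi>: "test_function t \<psi>" for \<psi>
  proof -
    have 1: "set_integrable lborel {0..t} (\<lambda>s. deriv \<psi> s *\<^sub>R y s)"
      by (rule borel_integrable_atLeastAtMost')
        (intro continuous_on_scaleR cont test_function_deriv(2)[OF \<psi>])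
    have 2: "set_integrable lborel {0..t} (\<lambda>s. deriv \<psi> s *\<^sub>R Y s)"
      by (rule borel_integrable_atLeastAtMost')
        (intro continuous_on_scaleR contY test_function_deriv(2)[OF \<psi>])
    have "integral {0..t} (\<lambda>s. deriv \<psi> s *\<^sub>R y s) = integral {0..t} (\<lambda>s. deriv \<psi> s *\<^sub>R Y s)"
      using weak[OF \<psi>] trajectory_integration_by_parts[OF Y _ \<psi>] t
        set_borel_integral_eq_integral(2)[OF 1] set_borel_integral_eq_integral(2)[OF 2] by simp
    then show ?thesis
      using integral_diff[OF set_borel_integral_eq_integral(1)[OF 1] set_borel_integral_eq_integral(1)[OF 2]]
      by (simp add: g_def scaleR_diff_right)
  qed
  have const: "g s = g (t / 2)" if "0 < s" "s < t" for s
  proof (cases s "t / 2" rule: linorder_cases)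
    case less
    show ?thesis
      by (rule du_Bois_Reymond[OF contg that(1) less _ weak0]) (use t in auto)
  next
    case greater
    show ?thesis
      by (rule du_Bois_Reymond[OF contg _ greater that(2) weak0, symmetric]) (use t in auto)
  qed (simp only:)
  \<comment> \<open>The lemma of du Bois-Reymond reaches only interior points; continuity supplies
    the end points, where the curve is anchored.\<close>
  have "g s = g (t / 2)" if s: "s \<in> {0..t}" for s
  proof (rule continuous_constant_on_closure[of "{0<..<t}"])
    show "continuous_on (closure {0<..<t}) g" using contg t by simp
    show "g r = g (t / 2)" if "r \<in> {0<..<t}" for r
      using that by (intro const) auto
  qed (use s t in auto)
  then have "g s = g 0" if "s \<in> {0..t}" for s
    using that t by (metis atLeastAtMost_iff less_imp_le order_refl)
  moreover have "g 0 = y 0" by (simp add: g_def Y_def)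
  ultimately have "y s - y 0 = Y s - Y 0" if "s \<in> {0..t}" for s
    using that unfolding g_def Y_def by (metis diff_eq_eq add.commute diff_zero integral_refl diff_add_cancel)
  then show "trajectory t y v"
    using Y unfolding trajectory_def by simp
qed

subsection \<open>Perturbation of curves\<close>

text \<open>The assumption \<open>superlinear\<close> is what the bound by \<Theta> provides: every
  slope \<open>K\<close> is available, with a constant that does not depend on
  \<open>x\<close>.\<close>

locale lagrangian =
  fixes L :: "'a::euclidean_space \<Rightarrow> 'a \<Rightarrow> real"
  assumes nonneg: "0 \<le> L x u"
    and cont: "continuous_on UNIV (\<lambda>(x, u). L x u)"
    and superlinear: "\<exists>C. \<forall>x u. K * norm u - C \<le> L x u"
begin

lemma continuous_on_L [continuous_intros]:
  "continuous_on S f \<Longrightarrow> continuous_on S g \<Longrightarrow> continuous_on S (\<lambda>s. L (f s) (g s))"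
  using continuous_on_compose2[OF cont, of S "\<lambda>s. (f s, g s)"] by (auto intro: continuous_on_Pair)

lemma superlinearE:
  obtains C where "0 \<le> C" "\<And>x u. K * norm u - C \<le> L x u"
proof -
  obtain C where "\<forall>x u. K * norm u - C \<le> L x u" using superlinear by blast
  then have "\<And>x u. K * norm u - max 0 C \<le> L x u"
    by (smt (verit, best))
  then show thesis using that[of "max 0 C"] by simp
qed

lemma bounded_on_cball:
  obtains M where "0 \<le> M" "\<And>x u. norm x \<le> B \<Longrightarrow> norm u \<le> R \<Longrightarrow> L x u \<le> M"
proof -
  have "compact ((\<lambda>(x, u). L x u) ` (cball 0 B \<times> cball 0 R))"
    by (intro compact_continuous_image continuous_on_subset[OF cont] compact_Times) auto
  then obtain M where "\<forall>r\<in>(\<lambda>(x, u). L x u) ` (cball 0 B \<times> cball 0 R). norm r \<le> M"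
    using compact_imp_bounded bounded_iff by blast
  then have M: "L x u \<le> M" if "norm x \<le> B" "norm u \<le> R" for x u
    using that by force
  show thesis
    by (rule that[of "max 0 M"]) (use M in \<open>auto simp: le_max_iff_disj\<close>)
qed

lemma reaches_nonneg: "reaches L t x z c \<Longrightarrow> 0 \<le> c" "reaches L t x z c \<Longrightarrow> 0 \<le> t"
  by (auto simp: reaches_def intro: has_integral_nonneg nonneg)

lemma reaches_line:
  assumes "0 \<le> h" "\<And>s. 0 \<le> s \<Longrightarrow> s \<le> h \<Longrightarrow> L (x + s *\<^sub>R u) u \<le> M"
  obtains c where "c \<le> h * M" "reaches L h x (x + h *\<^sub>R u) c"
proof -
  have "continuous_on {0..h} (\<lambda>s. L (x + s *\<^sub>R u) u)"
    by (intro continuous_intros)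
  then have *: "((\<lambda>s. L (x + s *\<^sub>R u) u) has_integral integral {0..h} (\<lambda>s. L (x + s *\<^sub>R u) u)) {0..h}"
    using integrable_continuous_real by blast
  have "integral {0..h} (\<lambda>s. L (x + s *\<^sub>R u) u) \<le> h * M"
    using has_integral_le[OF * has_integral_const_real[of M 0 h]] assms by auto
  moreover have "reaches L h x (x + h *\<^sub>R u) (integral {0..h} (\<lambda>s. L (x + s *\<^sub>R u) u))"
    unfolding reaches_def
    using * trajectory_line[of h x u] assms(1)
    by (intro conjI exI[of _ "\<lambda>s. x + s *\<^sub>R u"] exI[of _ "\<lambda>s. u"]) auto
  ultimately show thesis using that by blast
qed

text \<open>An affine function of the velocity integrates to an expression in the duration and the
  end points alone, whatever the velocity does in between.\<close>

lemma affine_minorant: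
  assumes "trajectory t y v" "((\<lambda>s. L (y s) (v s)) has_integral c) {0..t}" "0 \<le> t"
    and "\<And>s. 0 \<le> s \<Longrightarrow> s \<le> t \<Longrightarrow> \<alpha> + q \<bullet> v s \<le> L (y s) (v s)"
  shows "\<alpha> * t + q \<bullet> (y t - y 0) \<le> c"
proof -
  have v: "(v has_integral (y t - y 0)) {0..t}"
    using trajectory_has_integral[OF assms(1)] assms(3) by simp
  have "((\<lambda>s. q \<bullet> v s) has_integral (q \<bullet> (y t - y 0))) {0..t}"
    using has_integral_linear[OF v bounded_linear_inner_right[of q]] by (simp add: o_def)
  from has_integral_add[OF has_integral_const_real[of \<alpha> 0 t] this]
  have "((\<lambda>s. \<alpha> + q \<bullet> v s) has_integral (\<alpha> * t + q \<bullet> (y t - y 0))) {0..t}"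
    using assms(3) by (simp add: mult.commute)
  from has_integral_le[OF this assms(2)] show ?thesis using assms(4) by auto
qed

text \<open>The norm of the displacement is its inner product with its own direction, so the
  minorant with slope \<open>K\<close> times that direction applies. If the curve returns to its
  start, \<open>sgn\<close> is 0 and the estimate persists.\<close>

lemma displacement_trajectory:
  assumes "trajectory t y v" "((\<lambda>s. L (y s) (v s)) has_integral c) {0..t}" "0 \<le> t" "0 \<le> K"
    and "\<And>x u. K * norm u - C \<le> L x u"
  shows "K * norm (y t - y 0) \<le> c + C * t"
proof -
  have "- C + (K *\<^sub>R sgn (y t - y 0)) \<bullet> v s \<le> L (y s) (v s)" for s
  proof -
    have "sgn (y t - y 0) \<bullet> v s \<le> norm (sgn (y t - y 0)) * norm (v s)"
      by (rule norm_cauchy_schwarz)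
    also have "\<dots> \<le> 1 * norm (v s)"
      by (intro mult_right_mono) (auto simp: norm_sgn)
    finally have "K * (sgn (y t - y 0) \<bullet> v s) \<le> K * norm (v s)"
      using assms(4) by (simp add: mult_left_mono)
    then show ?thesis using assms(5)[of "v s" "y s"] by simp
  qed
  from affine_minorant[OF assms(1-3) this]
  have "- C * t + (K *\<^sub>R sgn (y t - y 0)) \<bullet> (y t - y 0) \<le> c" .
  moreover have "sgn (y t - y 0) \<bullet> (y t - y 0) = norm (y t - y 0)"
    by (cases "y t = y 0")
      (simp_all add: sgn_div_norm power2_norm_eq_inner[symmetric] power2_eq_square)
  ultimately show ?thesis by simp
qed

lemma displacement:
  assumes "reaches L t x z c" "0 \<le> K" "\<And>x u. K * norm u - C \<le> L x u"
  shows "K * norm (z - x) \<le> c + C * t"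
  using assms displacement_trajectory unfolding reaches_def by blast

text \<open>A short curve of bounded cost cannot leave the ball of radius \<open>r\<close>, so a
  minorant valid only on that ball can be integrated along it. The admissible duration
  \<open>d\<close> depends neither on the starting point nor on the minorant.\<close>

lemma local_affine_minorant:
  assumes "0 < r"
  obtains d where "0 < d"
    "\<And>h x y c \<alpha> q. \<lbrakk>reaches L h x y c; h \<le> d; c \<le> M; \<And>\<xi> u. norm (\<xi> - x) \<le> r \<Longrightarrow> \<alpha> + q \<bullet> u \<le> L \<xi> u\<rbrakk>
       \<Longrightarrow> norm (y - x) \<le> r \<and> \<alpha> * h + q \<bullet> (y - x) \<le> c"
proof -
  \<comment> \<open>Chosen so that \<open>K * r\<close> exceeds the cost bound \<open>M\<close> plus
    the correction \<open>C * d\<close>, which the choice of \<open>d\<close> keeps below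
    \<open>\<bar>M\<bar> + 1\<close>.\<close>
  define K where "K = 2 * (\<bar>M\<bar> + 1) / r"
  have K: "0 < K" using assms by (simp add: K_def)
  obtain C where C: "0 \<le> C" "\<And>x u. K * norm u - C \<le> L x u"
    using superlinearE by blast
  define d where "d = (\<bar>M\<bar> + 1) / (C + 1)"
  have "C * (\<bar>M\<bar> + 1) \<le> (\<bar>M\<bar> + 1) * (C + 1)" by (simp add: algebra_simps)
  then have d: "0 < d" "C * d \<le> \<bar>M\<bar> + 1"
    using C(1) by (auto simp: d_def divide_simps)
  show thesis
  proof (rule that[OF d(1)])
    fix h x y c \<alpha> q
    assume *: "reaches L h x y c" "h \<le> d" "c \<le> M"
      and minorant: "\<And>\<xi> u. norm (\<xi> - x) \<le> r \<Longrightarrow> \<alpha> + q \<bullet> u \<le> L \<xi> u"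
    from * obtain Y v where Y: "trajectory h Y v" "Y 0 = x" "Y h = y"
      "((\<lambda>s. L (Y s) (v s)) has_integral c) {0..h}" and h: "0 \<le> h"
      by (auto simp: reaches_def)
    have near: "norm (Y s - x) \<le> r" if s: "0 \<le> s" "s \<le> h" for s
    proof -
      have int: "(\<lambda>s. L (Y s) (v s)) integrable_on {0..s}"
        by (rule integrable_subinterval_real[of _ 0 h]) (use Y s in auto)
      have "integral {0..s} (\<lambda>s. L (Y s) (v s)) \<le> integral {0..h} (\<lambda>s. L (Y s) (v s))"
        by (rule integral_subset_le) (use Y s int nonneg in auto)
      also have "\<dots> \<le> M" using Y(4) *(3) by (simp add: integral_unique)
      finally have "integral {0..s} (\<lambda>s. L (Y s) (v s)) \<le> M" .
      moreover have "K * norm (Y s - x) \<le> integral {0..s} (\<lambda>s. L (Y s) (v s)) + C * s"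
        unfolding Y(2)[symmetric] by (rule displacement_trajectory[of s Y v])
          (use trajectory_take[OF Y(1)] s int K C in auto)
      moreover have "C * s \<le> C * d" using C(1) s *(2) by (intro mult_left_mono) auto
      ultimately have "K * norm (Y s - x) \<le> M + C * d" by linarith
      also have "\<dots> \<le> 2 * (\<bar>M\<bar> + 1)" using d(2) by (simp add: distrib_left)
      also have "\<dots> = K * r" using assms by (simp add: K_def)
      finally show ?thesis using K by simp
    qed
    moreover have "\<alpha> * h + q \<bullet> (Y h - Y 0) \<le> c"
      by (rule affine_minorant[OF Y(1,4) h]) (use near minorant in blast)
    ultimately show "norm (y - x) \<le> r \<and> \<alpha> * h + q \<bullet> (y - x) \<le> c"
      using Y h by auto
  qed
qed

text \<open>Pigeonhole by induction: if the first block costs more than the average, the remaining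
  blocks have an average below the overall one.\<close>

lemma cheap_block:
  assumes "reaches L (real (Suc n) * \<tau>) x z c" "0 \<le> \<tau>"
  shows "\<exists>s a b r c1 c2 c3. reaches L s x a c1 \<and> reaches L \<tau> a b c2 \<and> reaches L r b z c3 \<and>
    s + \<tau> + r = real (Suc n) * \<tau> \<and> c1 + c2 + c3 = c \<and> c2 \<le> c / real (Suc n)"
  using assms(1)
proof (induction n arbitrary: x c)
  case 0
  then have "reaches L \<tau> x z c" by simp
  moreover have "reaches L 0 x x 0" "reaches L 0 z z 0" by (rule reaches_refl)+
  ultimately show ?case
    by (intro exI[of _ 0] exI[of _ x] exI[of _ z] exI[of _ c]) auto
next
  case (Suc n)
  obtain y d1 d2 where d: "reaches L \<tau> x y d1" "reaches L (real (Suc (Suc n)) * \<tau> - \<tau>) y z d2"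
    and c: "c = d1 + d2"
    using reaches_split[OF Suc.prems, of \<tau>] assms(2) by (auto simp: algebra_simps)
  have eq: "real (Suc (Suc n)) * \<tau> - \<tau> = real (Suc n) * \<tau>" by (simp add: algebra_simps)
  show ?case
  proof (cases "d1 \<le> c / real (Suc (Suc n))")
    case True
    show ?thesis
      by (rule exI[of _ 0], rule exI[of _ x], rule exI[of _ y], rule exI[of _ "real (Suc n) * \<tau>"],
          rule exI[of _ 0], rule exI[of _ d1], rule exI[of _ d2])
        (use True d c reaches_refl eq in \<open>auto simp: algebra_simps\<close>)
  next
    case False
    from Suc.IH[OF d(2)[unfolded eq]] obtain s a b r c1 c2 c3 where
      *: "reaches L s y a c1" "reaches L \<tau> a b c2" "reaches L r b z c3"
      "s + \<tau> + r = real (Suc n) * \<tau>" "c1 + c2 + c3 = d2" "c2 \<le> d2 / real (Suc n)"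
      by blast
    have "c2 \<le> c / real (Suc (Suc n))"
    proof -
      have "c2 * real (Suc n) \<le> d2" using *(6) by (simp add: field_simps)
      moreover have "c < d1 * real (Suc (Suc n))" using False by (simp add: field_simps)
      ultimately have "d2 * real (Suc (Suc n)) \<le> c * real (Suc n)"
        using c by (simp add: algebra_simps)
      then have "d2 / real (Suc n) \<le> c / real (Suc (Suc n))"
        by (simp only: pos_divide_le_eq pos_le_divide_eq of_nat_0_less_iff zero_less_Suc
            times_divide_eq_left)
      with *(6) show ?thesis by linarith
    qed
    moreover note reaches_append[OF d(1) *(1)]
    ultimately have "reaches L (\<tau> + s) x a (d1 + c1) \<and> reaches L \<tau> a b c2 \<and> reaches L r b z c3 \<and>
        \<tau> + s + \<tau> + r = real (Suc (Suc n)) * \<tau> \<and> d1 + c1 + c2 + c3 = c \<and>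
        c2 \<le> c / real (Suc (Suc n))"
      using * c eq by simp
    then show ?thesis by blast
  qed
qed

text \<open>
  A block of duration between \<open>2 h\<close> and \<open>4 h\<close> and small cost is replaced by a segment that takes
  \<open>h\<close> less; nonnegativity of \<open>L\<close> allows the cost of the block to be discarded.
\<close>

lemma speedup:
  assumes "0 < t0"
  obtains C d where "0 \<le> C" "0 < d"
    "\<And>t x z c h. \<lbrakk>reaches L t x z c; t0 \<le> t; t \<le> t1; norm x \<le> B; c \<le> B; 0 \<le> h; h \<le> d\<rbrakk>
       \<Longrightarrow> \<exists>c'\<le>c + C * h. reaches L (t - h) x z c'"
proof -
  obtain C1 where C1: "0 \<le> C1" "\<And>x u. 1 * norm u - C1 \<le> L x u"
    using superlinearE by blast
  \<comment> \<open>The block has mean speed at most \<open>B / t0 + C1\<close>; the factor 2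
    accounts for shortening its duration from \<tau> to \<open>\<tau> - h\<close>, which is at least
    half of \<tau>.\<close>
  define R where "R = 2 * (B / t0 + C1)"
  \<comment> \<open>Both the way from \<open>x\<close> to the block and the block itself displace by
    at most \<open>B + C1 * t1\<close>.\<close>
  define \<rho> where "\<rho> = B + 2 * (B + C1 * t1)"
  obtain M where M: "0 \<le> M" "\<And>x u. norm x \<le> \<rho> \<Longrightarrow> norm u \<le> R \<Longrightarrow> L x u \<le> M"
    using bounded_on_cball by blast
  show thesis
  \<comment> \<open>The new segment lasts \<open>\<tau> - h \<le> 3 * h\<close>. The bound on
    \<open>h\<close> ensures that at least one block of duration \<open>2 * h\<close> fits into the
    curve.\<close>
  proof (rule that[of "3 * M" "t0 / 2"])
    fix t x z c h
    assume *: "reaches L t x z c" "t0 \<le> t" "t \<le> t1" "norm x \<le> B" "c \<le> B" "0 \<le> h" "h \<le> t0 / 2"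
    show "\<exists>c'\<le>c + 3 * M * h. reaches L (t - h) x z c'"
    proof (cases "h = 0")
      case True
      then show ?thesis using * by auto
    next
      case False
      with * have h: "0 < h" by simp
      \<comment> \<open>Dividing \<open>t\<close> by this number of blocks yields a duration \<tau>
        between \<open>2 * h\<close> and \<open>4 * h\<close>.\<close>
      define m where "m = nat \<lfloor>t / (2 * h)\<rfloor>"
      have "1 \<le> t / (2 * h)" using h * by (simp add: field_simps)
      then have m: "1 \<le> m" "real m \<le> t / (2 * h)" "t / (2 * h) < real m + 1"
        unfolding m_def by linarith+
      define n where "n = m - 1"
      have n: "m = Suc n" using m(1) by (simp add: n_def)
      define \<tau> where "\<tau> = t / real m"
      have t: "0 < t" using assms * by linarith
      have t_eq: "t = real (Suc n) * \<tau>" using n by (simp add: \<tau>_def)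
      have \<tau>1: "2 * h \<le> \<tau>" using m h t by (simp add: \<tau>_def field_simps)
      have \<tau>2: "\<tau> \<le> 4 * h"
      proof -
        have "t / (2 * h) \<le> 2 * real m" using m by linarith
        then show ?thesis using m h t by (simp add: \<tau>_def field_simps)
      qed
      have \<tau>3: "\<tau> \<le> t" using m t by (simp add: \<tau>_def field_simps mult_le_cancel_left1)
      obtain s a b r c1 c2 c3 where **: "reaches L s x a c1" "reaches L \<tau> a b c2" "reaches L r b z c3"
        "s + \<tau> + r = t" "c1 + c2 + c3 = c" "c2 \<le> c / real m"
        using cheap_block[of n \<tau> x z c] * \<tau>1 h t_eq n by auto
      note nn = reaches_nonneg[OF **(1)] reaches_nonneg[OF **(2)] reaches_nonneg[OF **(3)]
        reaches_nonneg[OF *(1)]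
      have c2: "c2 \<le> B / t0 * \<tau>"
      proof -
        have "c / real m = c / t * \<tau>" using t m by (simp add: \<tau>_def)
        also have "\<dots> \<le> B / t0 * \<tau>"
          using * assms \<tau>1 h t nn by (intro mult_right_mono frac_le) auto
        finally show ?thesis using **(6) by linarith
      qed
      have a: "norm (a - x) \<le> B + C1 * t1"
      proof -
        have "1 * norm (a - x) \<le> c1 + C1 * s" by (rule displacement[OF **(1) _ C1(2)]) simp
        moreover have "C1 * s \<le> C1 * t1" using C1(1) ** nn * by (intro mult_left_mono) auto
        ultimately show ?thesis using ** nn * by linarith
      qed
      have ba: "norm (b - a) \<le> c2 + C1 * \<tau>"
        using displacement[OF **(2) _ C1(2)] by simp
      moreover have "C1 * \<tau> \<le> C1 * t1" using C1(1) \<tau>3 * by (intro mult_left_mono) auto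
      ultimately have ba': "norm (b - a) \<le> B + C1 * t1" using ** nn * by linarith
      define u where "u = (b - a) /\<^sub>R (\<tau> - h)"
      have pos: "0 < \<tau> - h" using \<tau>1 h by simp
      have u: "norm u \<le> R"
      proof -
        have "norm (b - a) \<le> (B / t0 + C1) * \<tau>" using ba c2 by (simp add: algebra_simps)
        also have "\<dots> \<le> (B / t0 + C1) * (2 * (\<tau> - h))"
          using \<tau>1 C1 assms nn * by (intro mult_left_mono add_nonneg_nonneg divide_nonneg_pos) auto
        also have "\<dots> = R * (\<tau> - h)" by (simp only: R_def mult_ac)
        finally have "norm (b - a) \<le> R * (\<tau> - h)" .
        moreover have "norm u = norm (b - a) / (\<tau> - h)"
          using pos by (simp add: u_def divide_inverse mult.commute)
        ultimately show ?thesis using pos by (simp add: pos_divide_le_eq)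
      qed
      have "L (a + s *\<^sub>R u) u \<le> M" if s: "0 \<le> s" "s \<le> \<tau> - h" for s
      proof (rule M(2)[OF _ u])
        have "norm (s *\<^sub>R u) = s / (\<tau> - h) * norm (b - a)"
          using s pos by (simp add: u_def divide_inverse mult.commute mult.left_commute)
        also have "\<dots> \<le> 1 * norm (b - a)" using s pos by (intro mult_right_mono) auto
        finally have "norm (s *\<^sub>R u) \<le> B + C1 * t1" using ba' by simp
        moreover have "norm (a + s *\<^sub>R u) \<le> norm a + norm (s *\<^sub>R u)"
          by (rule norm_triangle_ineq)
        moreover have "norm a \<le> norm x + norm (a - x)" by (rule norm_triangle_sub)
        ultimately show "norm (a + s *\<^sub>R u) \<le> \<rho>" using a * unfolding \<rho>_def distrib_left by linarith
      qed
      then obtain c' where c': "c' \<le> (\<tau> - h) * M" "reaches L (\<tau> - h) a (a + (\<tau> - h) *\<^sub>R u) c'"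
        using reaches_line[of "\<tau> - h" a u M] pos by auto
      have "a + (\<tau> - h) *\<^sub>R u = b" using pos by (simp add: u_def)
      with c' have "reaches L (\<tau> - h) a b c'" by simp
      from reaches_append[OF reaches_append[OF **(1) this] **(3)]
      have "reaches L (t - h) x z (c1 + c' + c3)" using **(4) by (simp add: algebra_simps)
      moreover have "(\<tau> - h) * M \<le> 3 * h * M" using \<tau>2 M(1) by (intro mult_right_mono) auto
      ultimately show ?thesis using c'(1) ** nn by (intro exI[of _ "c1 + c' + c3"]) (auto simp: algebra_simps)
    qed
  qed (use M assms in auto)
qed

text \<open>The time available is at least the distance, so the speed is at most 1 and one bound of
  L on a compact set serves all segments.\<close>

lemma unit_speed_segment:
  obtains C where "0 \<le> C"
    "\<And>x x' h. \<lbrakk>norm x \<le> B; norm x' \<le> B; norm (x' - x) \<le> h\<rbrakk> \<Longrightarrow> \<exists>c\<le>C * h. reaches L h x x' c"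
proof -
  \<comment> \<open>Radius \<open>3 * B\<close>: the start contributes \<open>B\<close>, the segment
    at most \<open>2 * B\<close>.\<close>
  obtain M where M: "0 \<le> M" "\<And>x u. norm x \<le> 3 * B \<Longrightarrow> norm u \<le> 1 \<Longrightarrow> L x u \<le> M"
    using bounded_on_cball by blast
  show thesis
  proof (rule that[OF M(1)])
    fix x x' :: 'a and h
    assume *: "norm x \<le> B" "norm x' \<le> B" "norm (x' - x) \<le> h"
    show "\<exists>c\<le>M * h. reaches L h x x' c"
    proof (cases "h = 0")
      case True
      then show ?thesis using * reaches_refl by auto
    next
      case False
      then have h: "0 < h" using * norm_ge_zero[of "x' - x"] by linarith
      define u where "u = (x' - x) /\<^sub>R h"
      have "norm u = norm (x' - x) / h" using h by (simp add: u_def divide_inverse mult.commute)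
      then have u: "norm u \<le> 1" using * h by simp
      have "L (x + s *\<^sub>R u) u \<le> M" if s: "0 \<le> s" "s \<le> h" for s
      proof (rule M(2)[OF _ u])
        have "norm (s *\<^sub>R u) = s / h * norm (x' - x)"
          using s h by (simp add: u_def divide_inverse mult.commute mult.left_commute)
        also have "\<dots> \<le> 1 * norm (x' - x)" using s h by (intro mult_right_mono) auto
        finally have "norm (s *\<^sub>R u) \<le> norm x' + norm x" using norm_triangle_ineq4[of x' x] by simp
        then show "norm (x + s *\<^sub>R u) \<le> 3 * B" using * norm_triangle_ineq[of x "s *\<^sub>R u"] by linarith
      qed
      then obtain c where "c \<le> h * M" "reaches L h x (x + h *\<^sub>R u) c"
        using reaches_line[of h x u M] h by auto
      then show ?thesis using h by (auto simp: u_def mult.commute)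
    qed
  qed
qed

text \<open>With \<open>h = \<bar>t' - t\<bar> + norm (z' - z)\<close>, the curve is first made
  faster by \<open>h\<close>. This leaves time \<open>t' - t + h \<ge> norm (z' - z)\<close> for a
  segment to the new end point, whatever the sign of \<open>t' - t\<close>.\<close>

lemma perturb_end:
  assumes "0 < t0"
  obtains C d where "0 \<le> C" "0 < d"
    "\<And>t x z c t' z'. \<lbrakk>reaches L t x z c; t0 \<le> t; t \<le> t1; norm x \<le> B; c \<le> B;
        \<bar>t' - t\<bar> + norm (z' - z) \<le> d\<rbrakk>
       \<Longrightarrow> \<exists>c'\<le>c + C * (\<bar>t' - t\<bar> + norm (z' - z)). reaches L t' x z' c'"
proof -
  obtain C d where C: "0 \<le> C" "0 < d"
    "\<And>t x z c h. \<lbrakk>reaches L t x z c; t0 \<le> t; t \<le> t1; norm x \<le> B; c \<le> B; 0 \<le> h; h \<le> d\<rbrakk>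
       \<Longrightarrow> \<exists>c'\<le>c + C * h. reaches L (t - h) x z c'"
    using speedup[OF assms, of t1 B] by blast
  obtain C1 where C1: "0 \<le> C1" "\<And>x u. 1 * norm u - C1 \<le> L x u"
    using superlinearE by blast
  obtain D where D: "0 \<le> D" "\<And>x x' h. \<lbrakk>norm x \<le> 2 * B + C1 * t1 + d; norm x' \<le> 2 * B + C1 * t1 + d;
      norm (x' - x) \<le> h\<rbrakk> \<Longrightarrow> \<exists>c\<le>D * h. reaches L h x x' c"
    using unit_speed_segment by blast
  show thesis
  \<comment> \<open>\<open>C\<close> pays for the gain of time \<open>h\<close>, and
    \<open>2 * D\<close> for a final segment lasting at most \<open>2 * h\<close>.\<close>
  proof (rule that[of "C + 2 * D", OF _ C(2)])
    fix t x z c t' z'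
    assume *: "reaches L t x z c" "t0 \<le> t" "t \<le> t1" "norm x \<le> B" "c \<le> B" "\<bar>t' - t\<bar> + norm (z' - z) \<le> d"
    define h where "h = \<bar>t' - t\<bar> + norm (z' - z)"
    obtain c' where c': "c' \<le> c + C * h" "reaches L (t - h) x z c'"
      using C(3)[OF *(1-5), of h] * by (auto simp: h_def)
    have "1 * norm (z - x) \<le> c + C1 * t" by (rule displacement[OF *(1) _ C1(2)]) simp
    moreover have "C1 * t \<le> C1 * t1" using C1 * by (intro mult_left_mono) auto
    ultimately have z: "norm z \<le> 2 * B + C1 * t1"
      using * norm_triangle_sub[of z x] by linarith
    then have z': "norm z' \<le> 2 * B + C1 * t1 + d"
      using * norm_triangle_sub[of z' z] by linarith
    obtain e where e: "e \<le> D * (t' - t + h)" "reaches L (t' - t + h) z z' e"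
    proof -
      have "norm (z' - z) \<le> t' - t + h" by (simp add: h_def)
      then show thesis using that D(2)[of z z' "t' - t + h"] z z' C(2) by auto
    qed
    have "t' - t + h \<le> 2 * h"
      unfolding h_def by (smt (verit) norm_ge_zero)
    then have "D * (t' - t + h) \<le> D * (2 * h)"
      using D(1) by (intro mult_left_mono)
    moreover have "reaches L t' x z' (c' + e)"
      using reaches_append[OF c'(2) e(2)] by simp
    ultimately show "\<exists>c'\<le>c + (C + 2 * D) * (\<bar>t' - t\<bar> + norm (z' - z)). reaches L t' x z' c'"
      using c' e by (intro exI[of _ "c' + e"]) (auto simp: h_def[symmetric] algebra_simps)
  qed (use C D in auto)
qed

text \<open>Mirror image of \<open>perturb_end\<close>: the time saved is spent on a segment from
  the new starting point to the old one.\<close>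

lemma perturb_start:
  assumes "0 < t0"
  obtains C d where "0 \<le> C" "0 < d"
    "\<And>t x z c t' x'. \<lbrakk>reaches L t x z c; t0 \<le> t; t \<le> t1; norm x \<le> B; c \<le> B;
        \<bar>t' - t\<bar> + norm (x' - x) \<le> d\<rbrakk>
       \<Longrightarrow> \<exists>c'\<le>c + C * (\<bar>t' - t\<bar> + norm (x' - x)). reaches L t' x' z c'"
proof -
  obtain C d where C: "0 \<le> C" "0 < d"
    "\<And>t x z c h. \<lbrakk>reaches L t x z c; t0 \<le> t; t \<le> t1; norm x \<le> B; c \<le> B; 0 \<le> h; h \<le> d\<rbrakk>
       \<Longrightarrow> \<exists>c'\<le>c + C * h. reaches L (t - h) x z c'"
    using speedup[OF assms, of t1 B] by blast
  obtain D where D: "0 \<le> D" "\<And>x x' h. \<lbrakk>norm x \<le> B + d; norm x' \<le> B + d;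
      norm (x' - x) \<le> h\<rbrakk> \<Longrightarrow> \<exists>c\<le>D * h. reaches L h x x' c"
    using unit_speed_segment by blast
  show thesis
  proof (rule that[of "C + 2 * D", OF _ C(2)])
    fix t x z c t' x'
    assume *: "reaches L t x z c" "t0 \<le> t" "t \<le> t1" "norm x \<le> B" "c \<le> B" "\<bar>t' - t\<bar> + norm (x' - x) \<le> d"
    define h where "h = \<bar>t' - t\<bar> + norm (x' - x)"
    obtain c' where c': "c' \<le> c + C * h" "reaches L (t - h) x z c'"
      using C(3)[OF *(1-5), of h] * by (auto simp: h_def)
    have x': "norm x' \<le> B + d"
      using * norm_triangle_sub[of x' x] by linarith
    obtain e where e: "e \<le> D * (t' - t + h)" "reaches L (t' - t + h) x' x e"
    proof -
      have "norm (x - x') \<le> t' - t + h" by (simp add: h_def norm_minus_commute)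
      then show thesis using that D(2)[of x' x "t' - t + h"] x' C(2) * by auto
    qed
    have "t' - t + h \<le> 2 * h"
      unfolding h_def by (smt (verit) norm_ge_zero)
    then have "D * (t' - t + h) \<le> D * (2 * h)"
      using D(1) by (intro mult_left_mono)
    moreover have "reaches L t' x' z (e + c')"
      using reaches_append[OF e(2) c'(2)] by simp
    ultimately show "\<exists>c'\<le>c + (C + 2 * D) * (\<bar>t' - t\<bar> + norm (x' - x)). reaches L t' x' z c'"
      using c' e by (intro exI[of _ "e + c'"]) (auto simp: h_def[symmetric] algebra_simps)
  qed (use C D in auto)
qed

end

subsection \<open>Reformulation of the viscosity and initial conditions\<close>

text \<open>Multiplying out the quotient admits \<open>z' = z\<close>, where the inequality is
  trivial, and replaces the limit inferior by a real inequality with an \<epsilon>.\<close>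

lemma subdifferential_iff:
  "p \<in> subdifferential W z \<longleftrightarrow>
   (\<forall>\<epsilon>>0. \<exists>d>0. \<forall>z'. dist z' z < d \<longrightarrow> W z + p \<bullet> (z' - z) - \<epsilon> * norm (z' - z) \<le> W z')"
proof -
  let ?q = "\<lambda>z'. (W z' - W z - p \<bullet> (z' - z)) / norm (z' - z)"
  have q: "- \<epsilon> \<le> ?q z' \<longleftrightarrow> W z + p \<bullet> (z' - z) - \<epsilon> * norm (z' - z) \<le> W z'" if "z' \<noteq> z" for z' \<epsilon>
    using that by (simp add: pos_le_divide_eq) (auto simp: algebra_simps)
  have "p \<in> subdifferential W z \<longleftrightarrow> (\<forall>y<0. \<forall>\<^sub>F z' in at z. y < ereal (?q z'))"
    by (simp add: subdifferential_def le_Liminf_iff)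
  also have "\<dots> \<longleftrightarrow> (\<forall>\<epsilon>>0. \<forall>\<^sub>F z' in at z. - \<epsilon> \<le> ?q z')"
  proof (intro iffI allI impI)
    fix \<epsilon> :: real assume "\<forall>y<0. \<forall>\<^sub>F z' in at z. y < ereal (?q z')" "0 < \<epsilon>"
    then have "\<forall>\<^sub>F z' in at z. ereal (- \<epsilon>) < ereal (?q z')" 
      by (simp del: less_ereal.simps)
    then show "\<forall>\<^sub>F z' in at z. - \<epsilon> \<le> ?q z'" by (rule eventually_mono) auto
  next
    fix y :: ereal assume *: "\<forall>\<epsilon>>0. \<forall>\<^sub>F z' in at z. - \<epsilon> \<le> ?q z'" "y < 0"
    then obtain r where r: "y < ereal r" "ereal r < 0" using ereal_dense2 by blast
    then have "\<forall>\<^sub>F z' in at z. r \<le> ?q z'" using *(1)[rule_format, of "- r"] by simp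
    then show "\<forall>\<^sub>F z' in at z. y < ereal (?q z')"
      by (rule eventually_mono) (use r in \<open>auto intro: less_le_trans\<close>)
  qed
  also have "\<dots> \<longleftrightarrow> (\<forall>\<epsilon>>0. \<exists>d>0. \<forall>z'. dist z' z < d \<longrightarrow> W z + p \<bullet> (z' - z) - \<epsilon> * norm (z' - z) \<le> W z')"
  proof -
    have "(\<forall>\<^sub>F z' in at z. - \<epsilon> \<le> ?q z') \<longleftrightarrow>
        (\<exists>d>0. \<forall>z'. dist z' z < d \<longrightarrow> W z + p \<bullet> (z' - z) - \<epsilon> * norm (z' - z) \<le> W z')" for \<epsilon>
    proof -
      have "(z' \<noteq> z \<and> dist z' z < d \<longrightarrow> - \<epsilon> \<le> ?q z') \<longleftrightarrow>
          (dist z' z < d \<longrightarrow> W z + p \<bullet> (z' - z) - \<epsilon> * norm (z' - z) \<le> W z')" for z' d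
      proof (cases "z' = z")
        case False
        from q[OF this, of \<epsilon>] show ?thesis using False by simp
      qed simp
      then show ?thesis unfolding eventually_at by simp
    qed
    then show ?thesis by simp
  qed
  finally show ?thesis .
qed

lemma superdifferential_iff:
  "p \<in> superdifferential W z \<longleftrightarrow>
   (\<forall>\<epsilon>>0. \<exists>d>0. \<forall>z'. dist z' z < d \<longrightarrow> W z' \<le> W z + p \<bullet> (z' - z) + \<epsilon> * norm (z' - z))"
proof -
  have "p \<in> superdifferential W z \<longleftrightarrow> - p \<in> subdifferential (\<lambda>z. - W z) z"
    unfolding superdifferential_def by (auto intro: image_eqI[of _ _ "- p"])
  moreover have "- W z + - p \<bullet> (z' - z) - \<epsilon> * norm (z' - z) \<le> - W z' \<longleftrightarrow>
      W z' \<le> W z + p \<bullet> (z' - z) + \<epsilon> * norm (z' - z)" for z' \<epsilon>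
    by auto
  ultimately show ?thesis unfolding subdifferential_iff by simp
qed

lemma viscosity_subsolution_iff:
  "viscosity_subsolution L W \<longleftrightarrow>
   (\<forall>t>0. \<forall>x p\<^sub>t p\<^sub>x u. (p\<^sub>t, p\<^sub>x) \<in> superdifferential W (t, x) \<longrightarrow> p\<^sub>t - p\<^sub>x \<bullet> u \<le> L x u)"
proof -
  have "ereal p + hamiltonian L x (- q) \<le> 0 \<longleftrightarrow> (\<forall>u. p - q \<bullet> u \<le> L x u)" for p x q
  proof -
    have "ereal p + hamiltonian L x (- q) \<le> 0 \<longleftrightarrow> hamiltonian L x (- q) \<le> ereal (- p)"
      by (cases "hamiltonian L x (- q)") auto
    also have "\<dots> \<longleftrightarrow> (\<forall>u. p - q \<bullet> u \<le> L x u)"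
      unfolding hamiltonian_def SUP_le_iff by (auto simp: algebra_simps)
    finally show ?thesis .
  qed
  then show ?thesis
    by (auto simp: viscosity_subsolution_def pos_times_def Ball_def)
qed

text \<open>A lower bound on a supremum only yields velocities optimal up to \<epsilon>; this is the
  form from which the velocities of the Euler scheme are drawn.\<close>

lemma viscosity_supersolution_iff:
  "viscosity_supersolution L W \<longleftrightarrow>
   (\<forall>t>0. \<forall>x p\<^sub>t p\<^sub>x \<epsilon>. (p\<^sub>t, p\<^sub>x) \<in> subdifferential W (t, x) \<longrightarrow> 0 < \<epsilon> \<longrightarrow>
      (\<exists>u. L x u + p\<^sub>x \<bullet> u < p\<^sub>t + \<epsilon>))"
proof -
  have "0 \<le> ereal p + hamiltonian L x (- q) \<longleftrightarrow> (\<forall>\<epsilon>>0. \<exists>u. L x u + q \<bullet> u < p + \<epsilon>)" for p x q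
  proof -
    have "0 \<le> ereal p + hamiltonian L x (- q) \<longleftrightarrow> ereal (- p) \<le> hamiltonian L x (- q)"
      by (cases "hamiltonian L x (- q)") auto
    also have "\<dots> \<longleftrightarrow> (\<forall>y<ereal (- p). \<exists>u. y < ereal (- q \<bullet> u - L x u))"
      unfolding hamiltonian_def le_SUP_iff by auto
    also have "\<dots> \<longleftrightarrow> (\<forall>\<epsilon>>0. \<exists>u. L x u + q \<bullet> u < p + \<epsilon>)"
    proof (intro iffI allI impI)
      fix \<epsilon> :: real
      assume *: "\<forall>y<ereal (- p). \<exists>u. y < ereal (- q \<bullet> u - L x u)" "0 < \<epsilon>"
      then have "\<exists>u. ereal (- p - \<epsilon>) < ereal (- q \<bullet> u - L x u)"
        using *(1)[rule_format, of "ereal (- p - \<epsilon>)"] by simp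
      then show "\<exists>u. L x u + q \<bullet> u < p + \<epsilon>" by (auto simp: algebra_simps)
    next
      fix y assume *: "\<forall>\<epsilon>>0. \<exists>u. L x u + q \<bullet> u < p + \<epsilon>" "y < ereal (- p)"
      then obtain r where r: "y < ereal r" "r < - p" using ereal_dense2 by force
      with * obtain u where "L x u + q \<bullet> u < p + (- p - r)"
        by (metis diff_gt_0_iff_gt)
      then have "ereal r < ereal (- q \<bullet> u - L x u)" by simp
      then show "\<exists>u. y < ereal (- q \<bullet> u - L x u)" using r by (meson less_trans)
    qed
    finally show ?thesis .
  qed
  then show ?thesis
    by (auto simp: viscosity_supersolution_def pos_times_def Ball_def)
qed

lemma eventually_at_right_0_prod_nhds:
  "(\<forall>\<^sub>F (h, y) in at_right 0 \<times>\<^sub>F nhds x. P h y) \<longleftrightarrow>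
   (\<exists>d>0. \<forall>h y. 0 < h \<longrightarrow> h < d \<longrightarrow> dist y x < d \<longrightarrow> P (h :: real) (y :: 'a::metric_space))"
proof
  assume "\<forall>\<^sub>F (h, y) in at_right 0 \<times>\<^sub>F nhds x. P h y"
  then obtain P1 P2 where P: "eventually P1 (at_right 0)" "eventually P2 (nhds x)"
    "\<And>h y. P1 h \<Longrightarrow> P2 y \<Longrightarrow> P h y"
    by (auto simp: eventually_prod_filter)
  from P(1) obtain a where "0 < a" "\<And>h. 0 < h \<Longrightarrow> h < a \<Longrightarrow> P1 h"
    by (auto simp: eventually_at_right_field)
  moreover from P(2) obtain b where "0 < b" "\<And>y. dist y x < b \<Longrightarrow> P2 y"
    by (auto simp: eventually_nhds_metric)
  ultimately show "\<exists>d>0. \<forall>h y. 0 < h \<longrightarrow> h < d \<longrightarrow> dist y x < d \<longrightarrow> P h y"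
    using P(3) by (intro exI[of _ "min a b"]) auto
next
  assume "\<exists>d>0. \<forall>h y. 0 < h \<longrightarrow> h < d \<longrightarrow> dist y x < d \<longrightarrow> P h y"
  then obtain d where d: "0 < d" "\<And>h y. 0 < h \<Longrightarrow> h < d \<Longrightarrow> dist y x < d \<Longrightarrow> P h y" by auto
  have "eventually (\<lambda>h. 0 < h \<and> h < d) (at_right 0)"
    using d(1) by (auto simp: eventually_at_right_field)
  moreover have "eventually (\<lambda>y. dist y x < d) (nhds x)"
    using d(1) by (auto simp: eventually_nhds_metric)
  ultimately show "\<forall>\<^sub>F (h, y) in at_right 0 \<times>\<^sub>F nhds x. P h y"
    unfolding eventually_prod_filter using d(2)
    by (intro exI[of _ "\<lambda>h. 0 < h \<and> h < d"] conjI exI[of _ "\<lambda>y. dist y x < d"]) auto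
qed

text \<open>Separates the two halves used in the comparisons: lower bounds hold on a whole
  neighbourhood, upper bounds only at some points arbitrarily near. Real thresholds suffice by
  density, also where \<phi> is infinite.\<close>

lemma initial_condition_iff:
  "initial_condition \<phi> W \<longleftrightarrow>
   (\<forall>x m. (ereal m < enn2ereal (\<phi> x) \<longrightarrow>
            (\<exists>d>0. \<forall>h y. 0 < h \<longrightarrow> h < d \<longrightarrow> dist y x < d \<longrightarrow> m < W (h, y))) \<and>
          (enn2ereal (\<phi> x) < ereal m \<longrightarrow>
            (\<forall>d>0. \<exists>h y. 0 < h \<and> h < d \<and> dist y x < d \<and> W (h, y) < m)))"
proof -
  have ev: "(\<forall>\<^sub>F z in at_right 0 \<times>\<^sub>F nhds x. P z) \<longleftrightarrow>
     (\<exists>d>0. \<forall>h y. 0 < h \<longrightarrow> h < d \<longrightarrow> dist y x < d \<longrightarrow> P (h, y))" for P x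
    using eventually_at_right_0_prod_nhds[of "\<lambda>h y. P (h, y)" x] by (simp add: case_prod_unfold)
  have "Liminf (at_right 0 \<times>\<^sub>F nhds x) (\<lambda>z. ereal (W z)) = enn2ereal (\<phi> x) \<longleftrightarrow>
    (\<forall>m. (ereal m < enn2ereal (\<phi> x) \<longrightarrow>
            (\<exists>d>0. \<forall>h y. 0 < h \<longrightarrow> h < d \<longrightarrow> dist y x < d \<longrightarrow> m < W (h, y))) \<and>
          (enn2ereal (\<phi> x) < ereal m \<longrightarrow>
            (\<forall>d>0. \<exists>h y. 0 < h \<and> h < d \<and> dist y x < d \<and> W (h, y) < m)))"
    (is "?l = ?c \<longleftrightarrow> (\<forall>m. (_ \<longrightarrow> ?P m) \<and> (_ \<longrightarrow> ?Q m))") for x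
  proof
    assume l: "?l = ?c"
    show "\<forall>m. (ereal m < ?c \<longrightarrow> ?P m) \<and> (?c < ereal m \<longrightarrow> ?Q m)"
    proof (intro allI conjI impI)
      fix m assume "ereal m < ?c"
      then have "\<forall>\<^sub>F z in at_right 0 \<times>\<^sub>F nhds x. ereal m < ereal (W z)"
        using l less_LiminfD by metis
      then show "?P m" unfolding ev by simp
    next
      fix m d :: real assume "?c < ereal m" "0 < d"
      show "\<exists>h y. 0 < h \<and> h < d \<and> dist y x < d \<and> W (h, y) < m"
      proof (rule ccontr)
        assume "\<not> ?thesis"
        then have "\<forall>h y. 0 < h \<longrightarrow> h < d \<longrightarrow> dist y x < d \<longrightarrow> m \<le> W (h, y)" by (meson not_less)
        then have "\<forall>\<^sub>F z in at_right 0 \<times>\<^sub>F nhds x. ereal m \<le> ereal (W z)"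
          unfolding ev using \<open>0 < d\<close> by (intro exI[of _ d]) simp
        from Liminf_bounded[OF this] l \<open>?c < ereal m\<close> show False by simp
      qed
    qed
  next
    assume *: "\<forall>m. (ereal m < ?c \<longrightarrow> ?P m) \<and> (?c < ereal m \<longrightarrow> ?Q m)"
    show "?l = ?c"
    proof (rule antisym)
      show "?l \<le> ?c"
      proof (rule ccontr)
        assume "\<not> ?l \<le> ?c"
        then obtain m where m: "?c < ereal m" "ereal m < ?l"
          using ereal_dense2[of ?c ?l] by (auto simp: not_le)
        from less_LiminfD[OF m(2)] obtain d where d: "0 < d"
          "\<forall>h y. 0 < h \<longrightarrow> h < d \<longrightarrow> dist y x < d \<longrightarrow> m < W (h, y)" unfolding ev by auto
        obtain h y where "0 < h" "h < d" "dist y x < d" "W (h, y) < m"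
          using *[THEN spec, THEN conjunct2, THEN mp, OF m(1)] d(1) by auto
        with d(2) show False by (meson less_asym)
      qed
      show "?c \<le> ?l"
        unfolding le_Liminf_iff
      proof (intro allI impI)
        fix b assume "b < ?c"
        then obtain m where m: "b < ereal m" "ereal m < ?c" using ereal_dense2[of b ?c] by auto
        from *[THEN spec, THEN conjunct1, THEN mp, OF m(2)]
        have "\<forall>\<^sub>F z in at_right 0 \<times>\<^sub>F nhds x. ereal m < ereal (W z)" unfolding ev by simp
        then show "\<forall>\<^sub>F z in at_right 0 \<times>\<^sub>F nhds x. b < ereal (W z)"
          by (rule eventually_mono) (rule less_trans[OF m(1)])
      qed
    qed
  qed
  then show ?thesis unfolding initial_condition_def by blast
qed

text \<open>Negative thresholds are treated apart because \<open>ennreal\<close> truncates them to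
  0. The limit inferior in \<open>lsc\<close> ignores the point itself, so its value is added at the
  end.\<close>

lemma lsc_ennreal_nbhd:
  fixes \<phi> :: "'a::metric_space \<Rightarrow> ennreal"
  assumes "lsc \<phi>" "ereal m < enn2ereal (\<phi> x)"
  obtains d where "0 < d" "\<And>y. dist y x < d \<Longrightarrow> ereal m < enn2ereal (\<phi> y)"
proof (cases "m < 0")
  case True
  then have "ereal m < enn2ereal (\<phi> y)" for y
    by (intro less_le_trans[OF _ enn2ereal_nonneg]) auto
  then show thesis using that[of 1] by simp
next
  case False
  have eq: "ereal m < enn2ereal a \<longleftrightarrow> ennreal m < a" for a
    using False by (simp add: less_ennreal.rep_eq enn2ereal_ennreal)
  have "ennreal m < Liminf (at x) \<phi>"
    using assms eq unfolding lsc_def by (meson less_le_trans)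
  from less_LiminfD[OF this] obtain d where "0 < d" "\<And>y. y \<noteq> x \<Longrightarrow> dist y x < d \<Longrightarrow> ennreal m < \<phi> y"
    by (auto simp: eventually_at)
  then show thesis using that assms(2) eq by metis
qed

section \<open>The value function in terms of reachable points and real costs\<close>

context lagrangian
begin

lemma value_function_le:
  assumes "0 < t" "reaches L t x z c"
  shows "value_function L \<phi> t x \<le> ennreal c + \<phi> z"
proof -
  from assms obtain y v where *: "trajectory t y v" "y 0 = x" "y t = z"
    "((\<lambda>s. L (y s) (v s)) has_integral c) {0..t}" by (auto simp: reaches_def)
  have "(\<integral>\<^sup>+ s\<in>{0..t}. ennreal (L (y s) (v s)) \<partial>lborel) = ennreal c"
    by (rule nn_integral_has_integral_lebesgue'[OF nonneg *(4)])
  moreover have "W11_deriv t y v" using *(1) assms by (simp add: W11_deriv_iff_trajectory)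
  ultimately show ?thesis
    unfolding value_function_def using * by (intro INF_lower2[of "(y, v)"]) auto
qed

lemma value_function_less:
  assumes "0 < t" "value_function L \<phi> t x < e"
  obtains z c where "reaches L t x z c" "ennreal c + \<phi> z < e"
proof -
  from assms(2) obtain y v where W: "W11_deriv t y v" "y 0 = x"
    and less: "(\<integral>\<^sup>+ s\<in>{0..t}. ennreal (L (y s) (v s)) \<partial>lborel) + \<phi> (y t) < e"
    unfolding value_function_def INF_less_iff by auto
  have tr: "trajectory t y v" using W assms by (simp add: W11_deriv_iff_trajectory)
  \<comment> \<open>\<open>y\<close> and \<open>v\<close> are measurable only on
    \<open>{0..t}\<close>; cutting both off before composing with the continuous L gives a globally
    Borel integrand without changing the integral.\<close>
  let ?f = "\<lambda>s. indicator {0..t} s * L (indicator {0..t} s *\<^sub>R y s) (indicator {0..t} s *\<^sub>R v s)"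
  have [measurable]: "(\<lambda>s. indicator {0..t} s *\<^sub>R v s) \<in> borel_measurable borel"
    using tr by (auto simp: trajectory_def set_integrable_def)
  have [measurable]: "(\<lambda>s. indicator {0..t} s *\<^sub>R y s) \<in> borel_measurable borel"
    using borel_measurable_continuous_on_indicator[OF _ trajectory_continuous_on[OF tr]] by simp
  have "(\<lambda>p. L (fst p) (snd p)) \<in> borel_measurable borel"
    using cont by (intro borel_measurable_continuous_onI) (simp add: case_prod_unfold)
  then have [measurable]: "(\<lambda>s. L (indicator {0..t} s *\<^sub>R y s) (indicator {0..t} s *\<^sub>R v s)) \<in> borel_measurable borel"
    using measurable_compose[where f = "\<lambda>s. (indicator {0..t} s *\<^sub>R y s, indicator {0..t} s *\<^sub>R v s)"
        and M = borel and N = borel and g = "\<lambda>p. L (fst p) (snd p)" and L = borel]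
      borel_measurable_Pair[of "\<lambda>s. indicator {0..t} s *\<^sub>R y s" borel "\<lambda>s. indicator {0..t} s *\<^sub>R v s"]
    by simp
  have eq: "(\<integral>\<^sup>+ s\<in>{0..t}. ennreal (L (y s) (v s)) \<partial>lborel) = (\<integral>\<^sup>+ s. ennreal (?f s) \<partial>lborel)"
    by (rule nn_integral_cong) (auto simp: indicator_def)
  have "(\<integral>\<^sup>+ s. ennreal (?f s) \<partial>lborel) \<le> (\<integral>\<^sup>+ s. ennreal (?f s) \<partial>lborel) + \<phi> (y t)" by simp
  also have "\<dots> < e" using less by (simp only: eq)
  also have "e \<le> \<infinity>" by simp
  finally have "(\<integral>\<^sup>+ s. ennreal (?f s) \<partial>lborel) < \<infinity>" .
  then obtain c where c: "(\<integral>\<^sup>+ s. ennreal (?f s) \<partial>lborel) = ennreal c" "0 \<le> c"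
    by (cases "\<integral>\<^sup>+ s. ennreal (?f s) \<partial>lborel" rule: ennreal_cases) auto
  have "(?f has_integral c) UNIV"
    by (rule nn_integral_has_integral) (use c nonneg in auto)
  then have "((\<lambda>s. if s \<in> {0..t} then L (y s) (v s) else 0) has_integral c) UNIV"
    by (rule has_integral_eq[rotated]) (auto simp: indicator_def)
  then have "((\<lambda>s. L (y s) (v s)) has_integral c) {0..t}"
    by (simp only: has_integral_restrict_UNIV)
  then have "reaches L t x (y t) c"
    unfolding reaches_def using tr W assms by auto
  then show thesis using that less c eq by auto
qed

end

subsection \<open>The value function\<close>

context lagrangian
begin

lemma uniform_continuity:
  assumes "0 < e"
  obtains r where "0 < r"
    "\<And>x \<xi> u. \<lbrakk>norm x \<le> B; norm (\<xi> - x) \<le> r; norm u \<le> R\<rbrakk> \<Longrightarrow> \<bar>L \<xi> u - L x u\<bar> \<le> e"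
proof -
  have "uniformly_continuous_on (cball 0 (B + 1) \<times> cball 0 R) (\<lambda>(x, u). L x u)"
    by (intro compact_uniformly_continuous continuous_on_subset[OF cont] compact_Times) auto
  then obtain d where d: "0 < d" "\<And>p q. \<lbrakk>p \<in> cball 0 (B + 1) \<times> cball 0 R; q \<in> cball 0 (B + 1) \<times> cball 0 R;
      dist q p < d\<rbrakk> \<Longrightarrow> dist (case q of (x, u) \<Rightarrow> L x u) (case p of (x, u) \<Rightarrow> L x u) < e"
    unfolding uniformly_continuous_on_def using assms by metis
  show thesis
  \<comment> \<open>The cap 1 keeps \<xi> in the enlarged ball of radius \<open>B + 1\<close>; half
    of \<open>d\<close> meets the strict inequality.\<close>
  proof (rule that[of "min (d / 2) 1"])
    fix x \<xi> u :: 'a assume *: "norm x \<le> B" "norm (\<xi> - x) \<le> min (d / 2) 1" "norm u \<le> R"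
    have "norm \<xi> \<le> B + 1" using * norm_triangle_sub[of \<xi> x] by auto
    then have "dist (L \<xi> u) (L x u) < e"
      using d(2)[of "(x, u)" "(\<xi>, u)"] * d(1) by (auto simp: dist_Pair_Pair dist_norm)
    then show "\<bar>L \<xi> u - L x u\<bar> \<le> e" by (simp add: dist_real_def)
  qed (use d in auto)
qed

end

locale bolza = lagrangian L for L :: "'a::euclidean_space \<Rightarrow> 'a \<Rightarrow> real" +
  fixes \<phi> :: "'a \<Rightarrow> ennreal"
  assumes lsc: "lsc \<phi>" and proper: "\<exists>x. \<phi> x \<noteq> \<infinity>"
begin

definition V :: "real \<Rightarrow> 'a \<Rightarrow> real" where
  "V t x = enn2real (value_function L \<phi> t x)"

lemma V_nonneg [simp]: "0 \<le> V t x"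
  by (simp add: V_def)

text \<open>The competitor is the segment that uses the whole time to reach a fixed point where
  \<phi> is finite; \<open>t0\<close> bounds its speed.\<close>

lemma value_function_bounded:
  assumes "0 < t0"
  obtains M where "0 \<le> M"
    "\<And>t x. \<lbrakk>t0 \<le> t; t \<le> t1; norm x \<le> B\<rbrakk> \<Longrightarrow> value_function L \<phi> t x \<le> ennreal M"
proof -
  obtain a where "\<phi> a \<noteq> \<infinity>" using proper by blast
  then obtain k where k: "\<phi> a = ennreal k" "0 \<le> k" by (cases "\<phi> a" rule: ennreal_cases) auto
  obtain M where M: "0 \<le> M"
    "\<And>x u. norm x \<le> B + (norm a + B) \<Longrightarrow> norm u \<le> (norm a + B) / t0 \<Longrightarrow> L x u \<le> M"
    using bounded_on_cball by blast
  show thesis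
  proof (rule that[of "max 0 t1 * M + k"])
    fix t and x :: 'a assume *: "t0 \<le> t" "t \<le> t1" "norm x \<le> B"
    define u where "u = (a - x) /\<^sub>R t"
    have t: "0 < t" using * assms by simp
    have ax: "norm (a - x) \<le> norm a + B" using * norm_triangle_ineq4[of a x] by linarith
    have u: "norm u \<le> (norm a + B) / t0"
    proof -
      have "norm u = norm (a - x) / t" using t by (simp add: u_def divide_inverse mult.commute)
      also have "\<dots> \<le> (norm a + B) / t0"
        using * assms ax norm_ge_zero[of "a - x"] by (intro frac_le) linarith+
      finally show ?thesis .
    qed
    have "L (x + s *\<^sub>R u) u \<le> M" if s: "0 \<le> s" "s \<le> t" for s
    proof (rule M(2)[OF _ u])
      have "norm (s *\<^sub>R u) = s / t * norm (a - x)"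
        using s t by (simp add: u_def divide_inverse mult.commute mult.left_commute)
      also have "\<dots> \<le> 1 * norm (a - x)" using s t by (intro mult_right_mono) auto
      finally show "norm (x + s *\<^sub>R u) \<le> B + (norm a + B)"
        using * ax norm_triangle_ineq[of x "s *\<^sub>R u"] by linarith
    qed
    then obtain c where c: "c \<le> t * M" "reaches L t x (x + t *\<^sub>R u) c"
      using reaches_line[of t x u M] t by auto
    have "x + t *\<^sub>R u = a" using t by (simp add: u_def)
    with c have c2: "reaches L t x a c" by simp
    have "value_function L \<phi> t x \<le> ennreal c + \<phi> a" by (rule value_function_le[OF t c2])
    also have "\<dots> = ennreal (c + k)" using k reaches_nonneg[OF c2] by simp
    also have "\<dots> \<le> ennreal (max 0 t1 * M + k)"
    proof (rule ennreal_leI)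
      have "t * M \<le> max 0 t1 * M" using * M by (intro mult_right_mono) auto
      then show "c + k \<le> max 0 t1 * M + k" using c by linarith
    qed
    finally show "value_function L \<phi> t x \<le> ennreal (max 0 t1 * M + k)" .
  qed (use M k in auto)
qed

lemma value_function_finite: "0 < t \<Longrightarrow> value_function L \<phi> t x < \<infinity>"
  using value_function_bounded[of t t "norm x"]
  by (metis ennreal_less_top infinity_ennreal_def le_less_trans order_refl)

lemma ennreal_V: "0 < t \<Longrightarrow> ennreal (V t x) = value_function L \<phi> t x"
  unfolding V_def by (rule ennreal_enn2real) (use value_function_finite in auto)

lemma V_le:
  assumes "0 < t" "reaches L t x z c" "\<phi> z \<le> ennreal k" "0 \<le> k"
  shows "V t x \<le> c + k"
proof -
  have "ennreal (V t x) \<le> ennreal c + \<phi> z"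
    using value_function_le[OF assms(1,2)] assms(1) by (simp add: ennreal_V)
  also have "\<dots> \<le> ennreal c + ennreal k" using assms(3) by (rule add_left_mono)
  also have "\<dots> = ennreal (c + k)" using assms reaches_nonneg[OF assms(2)] by simp
  finally show ?thesis using assms reaches_nonneg[OF assms(2)] by (subst (asm) ennreal_le_iff) auto
qed

lemma V_less:
  assumes "0 < t" "V t x < m"
  obtains z c k where "reaches L t x z c" "\<phi> z = ennreal k" "0 \<le> k" "c + k < m"
proof -
  have "value_function L \<phi> t x < ennreal m"
    using assms by (simp add: ennreal_V[symmetric] ennreal_lessI le_less_trans[OF V_nonneg])
  then obtain z c where zc: "reaches L t x z c" "ennreal c + \<phi> z < ennreal m"
    by (rule value_function_less[OF assms(1)])
  then have "\<phi> z \<noteq> \<infinity>" by auto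
  then obtain k where k: "\<phi> z = ennreal k" "0 \<le> k" by (cases "\<phi> z" rule: ennreal_cases) auto
  with zc reaches_nonneg[OF zc(1)] have "ennreal (c + k) < ennreal m" by simp
  then have "c + k < m" using k reaches_nonneg[OF zc(1)] by (subst (asm) ennreal_less_iff) auto
  with zc k that show thesis by blast
qed

lemma V_dynamic_programming_le:
  assumes "reaches L h x y c" "h < t"
  shows "V t x \<le> c + V (t - h) y"
proof (rule field_le_epsilon)
  fix e :: real assume "0 < e"
  then obtain z d k where *: "reaches L (t - h) y z d" "\<phi> z = ennreal k" "0 \<le> k" "d + k < V (t - h) y + e"
    using V_less[of "t - h" y "V (t - h) y + e"] assms by auto
  have "reaches L t x z (c + d)" using reaches_append[OF assms(1) *(1)] by simp
  then have "V t x \<le> c + d + k"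
    using * assms reaches_nonneg[OF assms(1)] by (intro V_le) auto
  then show "V t x \<le> c + V (t - h) y + e" using * by linarith
qed

lemma V_dynamic_programming_less:
  assumes "V t x < m" "0 \<le> h" "h < t"
  obtains y c where "reaches L h x y c" "c + V (t - h) y < m"
proof -
  obtain z d k where *: "reaches L t x z d" "\<phi> z = ennreal k" "0 \<le> k" "d + k < m"
    using V_less[of t x m] assms by auto
  obtain y c1 c2 where **: "reaches L h x y c1" "reaches L (t - h) y z c2" "d = c1 + c2"
    using reaches_split[OF *(1), of h] assms by auto
  have "V (t - h) y \<le> c2 + k" using * ** assms by (intro V_le) auto
  then show thesis using that ** * by force
qed

text \<open>One inequality suffices, since the roles of the two points can be exchanged afterwards.
  The final point of a nearly optimal curve is kept, so \<phi> is evaluated at the same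
  place.\<close>

lemma V_perturb:
  assumes "0 < t0"
  obtains C d where "0 \<le> C" "0 < d"
    "\<And>t x t' x'. \<lbrakk>t0 \<le> t; t \<le> t1; norm x \<le> B; 0 < t'; \<bar>t' - t\<bar> + norm (x' - x) \<le> d\<rbrakk>
       \<Longrightarrow> V t' x' \<le> V t x + C * (\<bar>t' - t\<bar> + norm (x' - x))"
proof -
  obtain M where M: "0 \<le> M"
    "\<And>t x. \<lbrakk>t0 \<le> t; t \<le> t1; norm x \<le> B\<rbrakk> \<Longrightarrow> value_function L \<phi> t x \<le> ennreal M"
    using value_function_bounded[OF assms] by blast
  \<comment> \<open>Curves optimal up to an error of at most 1 cost at most \<open>M + 1\<close>, so
    one pair of constants covers all of them.\<close>
  obtain C d where C: "0 \<le> C" "0 < d"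
    "\<And>t x z c t' x'. \<lbrakk>reaches L t x z c; t0 \<le> t; t \<le> t1; norm x \<le> max B (M + 1); c \<le> max B (M + 1);
        \<bar>t' - t\<bar> + norm (x' - x) \<le> d\<rbrakk>
       \<Longrightarrow> \<exists>c'\<le>c + C * (\<bar>t' - t\<bar> + norm (x' - x)). reaches L t' x' z c'"
    using perturb_start[OF assms, of t1 "max B (M + 1)"] by blast
  show thesis
  proof (rule that[OF C(1,2)])
    fix t t' and x x' :: 'a
    assume *: "t0 \<le> t" "t \<le> t1" "norm x \<le> B" "0 < t'" "\<bar>t' - t\<bar> + norm (x' - x) \<le> d"
    show "V t' x' \<le> V t x + C * (\<bar>t' - t\<bar> + norm (x' - x))"
    proof (rule field_le_epsilon)
      fix e :: real assume "0 < e"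
      have VM: "V t x \<le> M"
        using M(2)[OF *(1-3)] M(1) * assms by (simp add: ennreal_V[symmetric])
      obtain z c k where z: "reaches L t x z c" "\<phi> z = ennreal k" "0 \<le> k" "c + k < V t x + min e 1"
        using V_less[of t x "V t x + min e 1"] * assms \<open>0 < e\<close> by auto
      have "c \<le> M + 1" using z VM by linarith
      then obtain c' where c': "c' \<le> c + C * (\<bar>t' - t\<bar> + norm (x' - x))" "reaches L t' x' z c'"
        using C(3)[OF z(1), of t' x'] * by (auto simp: le_max_iff_disj)
      have "V t' x' \<le> c' + k" using c' z * by (intro V_le) auto
      then show "V t' x' \<le> V t x + C * (\<bar>t' - t\<bar> + norm (x' - x)) + e" using c' z by linarith
    qed
  qed
qed

lemma V_locally_lipschitz: "locally_lipschitz_on pos_times (\<lambda>(t, x). V t x)"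
  unfolding locally_lipschitz_on_def
proof
  fix z :: "real \<times> 'a" assume "z \<in> pos_times"
  then obtain t x where z: "z = (t, x)" and t: "0 < t" by (auto simp: pos_times_def)
  obtain C d where C: "0 \<le> C" "0 < d"
    "\<And>s y s' y'. \<lbrakk>t / 2 \<le> s; s \<le> 2 * t; norm y \<le> norm x + 1; 0 < s'; \<bar>s' - s\<bar> + norm (y' - y) \<le> d\<rbrakk>
       \<Longrightarrow> V s' y' \<le> V s y + C * (\<bar>s' - s\<bar> + norm (y' - y))"
    using V_perturb[of "t / 2" "2 * t" "norm x + 1"] t by auto
  \<comment> \<open>\<open>t / 2\<close> keeps times in \<open>[t / 2, 2 * t]\<close>. Two points of
    the ball are less than \<open>2 * r\<close> apart, and the sum of the two component distances is
    at most twice the distance, whence \<open>d / 4\<close>.\<close>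
  define r where "r = min (min (t / 2) 1) (d / 4)"
  have r: "0 < r" "r \<le> t / 2" "r \<le> 1" "r \<le> d / 4" using t C by (auto simp: r_def)
  have le: "V s' y' \<le> V s y + 2 * C * dist (s', y') (s, y)"
    if in_ball: "(s, y) \<in> ball z r" "(s', y') \<in> ball z r" for s y s' y'
  proof -
    have "dist t s < r" "dist x y < r" "dist t s' < r"
      using in_ball dist_fst_le[of z "(s, y)"] dist_snd_le[of z "(s, y)"] dist_fst_le[of z "(s', y')"]
      by (auto simp: z)
    then have near: "\<bar>s - t\<bar> < r" "norm (y - x) < r" "\<bar>s' - t\<bar> < r"
      by (auto simp: dist_real_def dist_norm norm_minus_commute)
    have sum: "\<bar>s' - s\<bar> + norm (y' - y) \<le> 2 * dist (s', y') (s, y)"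
      using dist_fst_le[of "(s', y')" "(s, y)"] dist_snd_le[of "(s', y')" "(s, y)"]
      by (simp add: dist_norm)
    have "dist (s', y') (s, y) \<le> dist z (s', y') + dist z (s, y)"
      by (rule dist_triangle3)
    also have "\<dots> < r + r" using in_ball by (intro add_strict_mono) auto
    finally have "\<bar>s' - s\<bar> + norm (y' - y) \<le> d" using sum r by linarith
    moreover have "norm y \<le> norm x + 1" using near r norm_triangle_sub[of y x] by linarith
    moreover have "t / 2 \<le> s" "s \<le> 2 * t" "0 < s'" using near r t by linarith+
    ultimately have "V s' y' \<le> V s y + C * (\<bar>s' - s\<bar> + norm (y' - y))" by (intro C(3))
    also have "C * (\<bar>s' - s\<bar> + norm (y' - y)) \<le> C * (2 * dist (s', y') (s, y))"
      using sum C(1) by (rule mult_left_mono)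
    finally show ?thesis by simp
  qed
  have "(2 * C)-lipschitz_on (ball z r \<inter> pos_times) (\<lambda>(t, x). V t x)"
  proof (rule lipschitz_onI)
    fix p q assume "p \<in> ball z r \<inter> pos_times" "q \<in> ball z r \<inter> pos_times"
    then show "dist (case p of (t, x) \<Rightarrow> V t x) (case q of (t, x) \<Rightarrow> V t x) \<le> 2 * C * dist p q"
      using le[of "fst p" "snd p" "fst q" "snd q"] le[of "fst q" "snd q" "fst p" "snd p"]
      by (auto simp: case_prod_unfold dist_real_def dist_commute abs_le_iff)
  qed (use C in simp)
  then show "\<exists>r>0. \<exists>K. K-lipschitz_on (ball z r \<inter> pos_times) (\<lambda>(t, x). V t x)"
    using r by blast
qed

text \<open>Moving with constant velocity \<open>u\<close> for a short time is admissible in dynamic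
  programming; the supergradient bounds V at the point reached from above, and division by
  \<open>h\<close> gives the inequality.\<close>

lemma V_subsolution: "viscosity_subsolution L (\<lambda>(t, x). V t x)"
  unfolding viscosity_subsolution_iff
proof (intro allI impI)
  fix t p and x q u :: 'a
  assume t: "0 < t" and p: "(p, q) \<in> superdifferential (\<lambda>(t, x). V t x) (t, x)"
  define N where "N = norm (- 1 :: real, u)"
  show "p - q \<bullet> u \<le> L x u"
  proof (rule field_le_epsilon)
    fix e' :: real assume "0 < e'"
    \<comment> \<open>One \<open>e\<close> is lost to the variation of L along the segment, and
      \<open>e * N\<close> to the supergradient.\<close>
    define e where "e = e' / (1 + N)"
    have N: "0 \<le> N" by (simp add: N_def)
    have e: "0 < e" "e * (1 + N) = e'" using \<open>0 < e'\<close> N by (auto simp: e_def)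
    obtain r where r: "0 < r"
      "\<And>y \<xi> v. \<lbrakk>norm y \<le> norm x; norm (\<xi> - y) \<le> r; norm v \<le> norm u\<rbrakk> \<Longrightarrow> \<bar>L \<xi> v - L y v\<bar> \<le> e"
      using uniform_continuity[OF e(1)] by blast
    obtain d where d: "0 < d" "\<And>z. dist z (t, x) < d \<Longrightarrow>
        (case z of (t, x) \<Rightarrow> V t x) \<le> V t x + (p, q) \<bullet> (z - (t, x)) + e * norm (z - (t, x))"
      using p[unfolded superdifferential_iff] e by auto
    define h where "h = min (t / 2) (min (r / (1 + norm u)) (d / (2 * (1 + N))))"
    have h: "0 < h" "h < t" using t r d N by (auto simp: h_def add_pos_nonneg)
    have hr: "h * norm u \<le> r"
    proof -
      have "h * norm u \<le> r / (1 + norm u) * norm u" by (intro mult_right_mono) (auto simp: h_def)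
      also have "\<dots> \<le> r" using r by (simp add: divide_simps add_pos_nonneg)
      finally show ?thesis .
    qed
    have hd: "h * N < d"
    proof -
      have "h * N \<le> d / (2 * (1 + N)) * N" using N by (intro mult_right_mono) (auto simp: h_def)
      also have "\<dots> < d" using d N by (simp add: divide_simps add_pos_nonneg)
      finally show ?thesis .
    qed
    have "L (x + s *\<^sub>R u) u \<le> L x u + e" if s: "0 \<le> s" "s \<le> h" for s
    proof -
      have "norm (s *\<^sub>R u) \<le> h * norm u" using s by (simp add: mult_right_mono)
      then show ?thesis using r(2)[of x "x + s *\<^sub>R u" u] hr by auto
    qed
    then obtain c where c: "c \<le> h * (L x u + e)" "reaches L h x (x + h *\<^sub>R u) c"
      using reaches_line[of h x u "L x u + e"] h by auto
    have diff: "(t - h, x + h *\<^sub>R u) - (t, x) = h *\<^sub>R (- 1, u)" by simp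
    have "V t x \<le> c + V (t - h) (x + h *\<^sub>R u)" by (rule V_dynamic_programming_le[OF c(2) h(2)])
    also have "V (t - h) (x + h *\<^sub>R u) \<le> V t x + (p, q) \<bullet> (h *\<^sub>R (- 1, u)) + e * norm (h *\<^sub>R (- 1 :: real, u))"
      using d(2)[of "(t - h, x + h *\<^sub>R u)"] hd h unfolding dist_norm diff
      by (simp add: N_def[symmetric] del: scaleR_Pair)
    finally have "V t x \<le> c + (V t x + (p, q) \<bullet> (h *\<^sub>R (- 1, u)) + e * norm (h *\<^sub>R (- 1 :: real, u)))"
      by simp
    also have "(p, q) \<bullet> (h *\<^sub>R (- 1, u)) = h * (q \<bullet> u - p)" by (simp add: algebra_simps)
    also have "e * norm (h *\<^sub>R (- 1 :: real, u)) = h * (e * N)"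
      using h by (simp add: N_def[symmetric] del: scaleR_Pair)
    finally have "0 \<le> h * (L x u + e) + h * (q \<bullet> u - p) + h * (e * N)" using c(1) by linarith
    also have "\<dots> = h * (L x u + e + (q \<bullet> u - p) + e * N)" by (simp add: algebra_simps)
    finally have "0 \<le> L x u + e + (q \<bullet> u - p) + e * N" using h by (simp add: zero_le_mult_iff)
    then show "p - q \<bullet> u \<le> L x u + e'" using e(2) by (simp add: distrib_left)
  qed
qed

text \<open>If the inequality fails by \<open>e\<close>, it fails by \<open>e / 2\<close> at all
  points near \<open>x\<close>: bounded velocities are covered by uniform continuity, large ones by
  growth. This is an affine minorant of L, and integrating it along a nearly optimal curve
  contradicts the subgradient inequality, provided the curve moves by O(h). That speed bound comes
  from the Lipschitz continuity of V.\<close>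

lemma V_supersolution: "viscosity_supersolution L (\<lambda>(t, x). V t x)"
  unfolding viscosity_supersolution_iff
proof (intro allI impI)
  fix t p e :: real and x q :: 'a
  assume t: "0 < t" and sub: "(p, q) \<in> subdifferential (\<lambda>(t, x). V t x) (t, x)" and e: "0 < e"
  show "\<exists>u. L x u + q \<bullet> u < p + e"
  proof (rule ccontr)
    assume "\<nexists>u. L x u + q \<bullet> u < p + e"
    then have lower: "p + e \<le> L x u + q \<bullet> u" for u by (meson not_less)
    obtain C where C: "0 \<le> C" "\<And>\<xi> u. (norm q + 1) * norm u - C \<le> L \<xi> u"
      using superlinearE by blast
    \<comment> \<open>Beyond this speed the surplus slope 1 alone covers
      \<open>\<bar>p\<bar> + e\<close>.\<close>
    define R where "R = C + \<bar>p\<bar> + e"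
    obtain r where r: "0 < r"
      "\<And>y \<xi> u. \<lbrakk>norm y \<le> norm x; norm (\<xi> - y) \<le> r; norm u \<le> R\<rbrakk> \<Longrightarrow> \<bar>L \<xi> u - L y u\<bar> \<le> e / 2"
      using uniform_continuity[of "e / 2"] e by auto
    have minorant: "p + e / 2 + (- q) \<bullet> u \<le> L \<xi> u" if "norm (\<xi> - x) \<le> r" for \<xi> u
    proof (cases "norm u \<le> R")
      case True
      then have "\<bar>L \<xi> u - L x u\<bar> \<le> e / 2" using r(2)[of x \<xi> u] that by simp
      then show ?thesis using lower[of u] unfolding inner_minus_left abs_le_iff by linarith
    next
      case False
      have "(- q) \<bullet> u \<le> norm q * norm u" using norm_cauchy_schwarz[of "- q" u] by simp
      moreover have "norm q * norm u + norm u - C \<le> L \<xi> u" using C(2)[of u \<xi>] by (simp add: algebra_simps)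
      ultimately show ?thesis using False e unfolding R_def by linarith
    qed
    obtain r2 K where r2: "0 < r2" and K: "K-lipschitz_on (ball (t, x) r2 \<inter> pos_times) (\<lambda>(t, x). V t x)"
      using V_locally_lipschitz t unfolding locally_lipschitz_on_def pos_times_def by fastforce
    have K0: "0 \<le> K" using K by (rule lipschitz_on_nonneg)
    obtain C2 where C2: "0 \<le> C2" "\<And>\<xi> u. (K + 1) * norm u - C2 \<le> L \<xi> u"
      using superlinearE by blast
    \<comment> \<open>Keeps the end point where the minorant holds and, together with
      \<open>h \<le> r2 / 4\<close>, within the Lipschitz ball of V.\<close>
    define r' where "r' = min r (r2 / 4)"
    have r': "0 < r'" "r' \<le> r" "r' \<le> r2 / 4" using r r2 by (auto simp: r'_def)
    obtain d1 where d1: "0 < d1"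
      "\<And>h y c. \<lbrakk>reaches L h x y c; h \<le> d1; c \<le> V t x + 1\<rbrakk>
         \<Longrightarrow> norm (y - x) \<le> r' \<and> (p + e / 2) * h + (- q) \<bullet> (y - x) \<le> c"
    proof (rule local_affine_minorant[OF r'(1), of "V t x + 1"])
      fix d assume d: "0 < d" "\<And>h x0 y c \<alpha> q. \<lbrakk>reaches L h x0 y c; h \<le> d; c \<le> V t x + 1;
          \<And>\<xi> u. norm (\<xi> - x0) \<le> r' \<Longrightarrow> \<alpha> + q \<bullet> u \<le> L \<xi> u\<rbrakk>
         \<Longrightarrow> norm (y - x0) \<le> r' \<and> \<alpha> * h + q \<bullet> (y - x0) \<le> c"
      show thesis
      proof (rule that[OF d(1)])
        fix h y c assume *: "reaches L h x y c" "h \<le> d" "c \<le> V t x + 1"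
        have "p + e / 2 + (- q) \<bullet> u \<le> L \<xi> u" if "norm (\<xi> - x) \<le> r'" for \<xi> u
          using minorant that r'(2) by (meson order_trans)
        then show "norm (y - x) \<le> r' \<and> (p + e / 2) * h + (- q) \<bullet> (y - x) \<le> c"
          by (rule d(2)[OF *])
      qed
    qed
    \<comment> \<open>Lipschitz continuity gives
      \<open>c \<le> h * h + K * h + K * norm (y - x)\<close>, growth gives
      \<open>(K + 1) * norm (y - x) \<le> c + C2 * h\<close>; subtraction leaves
      \<open>norm (y - x) \<le> C' * h\<close>.\<close>
    define C' where "C' = 1 + K + C2"
    have C': "0 < 1 + C'" using K0 C2 by (simp add: C'_def)
    \<comment> \<open>The subgradient error then takes \<open>e / 4 * h\<close> of the gain
      \<open>e / 2 * h\<close>. The other \<open>e / 4 * h\<close> has to absorb the optimality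
      error \<open>h * h\<close>, which is why \<open>h \<le> e / 4\<close>.\<close>
    define \<epsilon> where "\<epsilon> = e / (4 * (1 + C'))"
    have \<epsilon>: "0 < \<epsilon>" "\<epsilon> * (1 + C') = e / 4" using C' e by (auto simp: \<epsilon>_def field_simps)
    obtain d2 where d2: "0 < d2" "\<And>z. dist z (t, x) < d2 \<Longrightarrow>
        V t x + (p, q) \<bullet> (z - (t, x)) - \<epsilon> * norm (z - (t, x)) \<le> (case z of (t, x) \<Rightarrow> V t x)"
      using sub[unfolded subdifferential_iff] \<epsilon> by auto
    define h where "h = min (min (min d1 (t / 2)) (min 1 (r2 / 4))) (min (d2 / (2 * (1 + C'))) (e / 4))"
    have h: "0 < h" "h \<le> d1" "h \<le> t / 2" "h \<le> 1" "h \<le> r2 / 4" "h \<le> d2 / (2 * (1 + C'))" "h \<le> e / 4"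
    proof -
      show "0 < h" using d1 t r2 d2 C' e by (auto simp: h_def)
    qed (simp_all only: h_def min_le_iff_disj order_refl simp_thms)
    have hh: "h * h \<le> h" using h by (simp add: mult_left_le)
    have hC: "(1 + C') * h < d2"
    proof -
      have "(1 + C') * h \<le> (1 + C') * (d2 / (2 * (1 + C')))" using h C' by (intro mult_left_mono) auto
      also have "\<dots> = d2 / 2" using C' by (simp add: field_simps)
      finally show ?thesis using d2 by simp
    qed
    obtain y c where y: "reaches L h x y c" "c + V (t - h) y < V t x + h * h"
      using V_dynamic_programming_less[of t x "V t x + h * h" h] h t by auto
    have c: "c \<le> V t x + 1" using y(2) hh h V_nonneg[of "t - h" y] by linarith
    have *: "norm (y - x) \<le> r'" "(p + e / 2) * h + (- q) \<bullet> (y - x) \<le> c"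
      using d1(2)[OF y(1) h(2) c] by auto
    have dist_le: "dist (t - h, y) (t, x) \<le> h + norm (y - x)"
      unfolding dist_norm using norm_Pair_le[of "- h" "y - x"] h by simp
    have "dist (t - h, y) (t, x) < r2" using dist_le * r' h r2 by linarith
    then have "dist (V (t - h) y) (V t x) \<le> K * dist (t - h, y) (t, x)"
      using lipschitz_onD[OF K, of "(t - h, y)" "(t, x)"] t h r2
      by (auto simp: pos_times_def dist_commute)
    also have "\<dots> \<le> K * (h + norm (y - x))" using dist_le K0 by (rule mult_left_mono)
    finally have "c \<le> h * h + K * h + K * norm (y - x)"
      using y(2) by (auto simp: dist_real_def algebra_simps)
    moreover have "(K + 1) * norm (y - x) \<le> c + C2 * h"
      using displacement[OF y(1) _ C2(2)] K0 by simp
    ultimately have "norm (y - x) \<le> C' * h" using hh by (simp add: C'_def algebra_simps)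
    then have le: "h + norm (y - x) \<le> (1 + C') * h" by (simp add: algebra_simps)
    then have "dist (t - h, y) (t, x) < d2" using dist_le hC by linarith
    from d2(2)[OF this]
    have "V t x + (p, q) \<bullet> (- h, y - x) - \<epsilon> * norm ((t - h, y) - (t, x)) \<le> V (t - h) y" by simp
    moreover have "\<epsilon> * norm ((t - h, y) - (t, x)) \<le> \<epsilon> * ((1 + C') * h)"
      using dist_le le \<epsilon> unfolding dist_norm by (intro mult_left_mono) linarith+
    moreover have "\<epsilon> * ((1 + C') * h) = e / 4 * h" by (simp only: mult.assoc[symmetric] \<epsilon>(2))
    moreover have "(p, q) \<bullet> (- h, y - x) = - (p * h) + q \<bullet> (y - x)" by simp
    moreover have "(p + e / 2) * h = p * h + e / 2 * h" by (simp add: distrib_right)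
    moreover have "(- q) \<bullet> (y - x) = - (q \<bullet> (y - x))" by simp
    ultimately have "e / 2 * h - e / 4 * h < h * h" using y(2) *(2) by linarith
    moreover have "h * h \<le> e / 4 * h" using h by (intro mult_right_mono) auto
    ultimately show False by simp
  qed
qed

text \<open>Lower half: a short curve either costs more than the threshold or ends close to
  \<open>x\<close>, where \<phi> is above the threshold. Upper half: resting at
  \<open>x\<close>.\<close>

lemma V_initial_condition: "initial_condition \<phi> (\<lambda>(t, x). V t x)"
  unfolding initial_condition_iff
proof (intro allI conjI impI)
  fix x :: 'a and m assume "ereal m < enn2ereal (\<phi> x)"
  \<comment> \<open>The gap between \<open>m\<close> and \<open>m'\<close> turns
    \<open>V h y \<le> m\<close> into the strict inequality that produces a curve.\<close>
  then obtain m' where m': "ereal m < ereal m'" "ereal m' < enn2ereal (\<phi> x)"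
    using ereal_dense2[of "ereal m" "enn2ereal (\<phi> x)"] by auto
  from m'(2) obtain d where d: "0 < d" "\<And>y. dist y x < d \<Longrightarrow> ereal m' < enn2ereal (\<phi> y)"
    using lsc_ennreal_nbhd[OF lsc] by metis
  obtain d1 where d1: "0 < d1" "\<And>h y z c. \<lbrakk>reaches L h y z c; h \<le> d1; c \<le> m'\<rbrakk> \<Longrightarrow> norm (z - y) \<le> d / 2"
  proof (rule local_affine_minorant[of "d / 2" m'])
    fix b assume b: "0 < b" "\<And>h x y c \<alpha> q. \<lbrakk>reaches L h x y c; h \<le> b; c \<le> m';
        \<And>\<xi> u. norm (\<xi> - x) \<le> d / 2 \<Longrightarrow> \<alpha> + q \<bullet> u \<le> L \<xi> u\<rbrakk>
       \<Longrightarrow> norm (y - x) \<le> d / 2 \<and> \<alpha> * h + q \<bullet> (y - x) \<le> c"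
    show thesis
    proof (rule that[OF b(1)])
      fix h c and y z :: 'a assume *: "reaches L h y z c" "h \<le> b" "c \<le> m'"
      \<comment> \<open>With the zero minorant only the confinement to the ball remains.\<close>
      show "norm (z - y) \<le> d / 2" using b(2)[OF *, of 0 0] nonneg by auto
    qed
  qed (use d in auto)
  have "m < V h y" if hy: "0 < h" "h < min d1 (d / 2)" "dist y x < min d1 (d / 2)" for h y
  proof (rule ccontr)
    assume V: "\<not> m < V h y"
    then obtain z c k where z: "reaches L h y z c" "\<phi> z = ennreal k" "0 \<le> k" "c + k < m'"
      using V_less[of h y m'] hy(1) m'(1) by auto
    have "norm (z - y) \<le> d / 2" using d1(2)[OF z(1)] hy z by auto
    then have "dist z x < d" using hy dist_triangle[of z x y] by (simp add: dist_norm)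
    from d(2)[OF this] have "m' < k" using z by (simp add: enn2ereal_ennreal)
    then show False using z reaches_nonneg[OF z(1)] by simp
  qed
  then show "\<exists>d>0. \<forall>h y. 0 < h \<longrightarrow> h < d \<longrightarrow> dist y x < d \<longrightarrow> m < (case (h, y) of (t, x) \<Rightarrow> V t x)"
    using d d1 by (intro exI[of _ "min d1 (d / 2)"]) auto
next
  fix x :: 'a and m d assume m: "enn2ereal (\<phi> x) < ereal m" and d: "0 < (d :: real)"
  then have "\<phi> x \<noteq> \<infinity>" by auto
  then obtain k where k: "\<phi> x = ennreal k" "0 \<le> k" by (cases "\<phi> x" rule: ennreal_cases) auto
  have "k < m" using m k by (simp add: enn2ereal_ennreal)
  define h where "h = min (d / 2) ((m - k) / (2 * (L x 0 + 1)))"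
  have L0: "0 \<le> L x 0" by (rule nonneg)
  have h: "0 < h" "h < d" using d \<open>k < m\<close> L0 by (auto simp: h_def add_nonneg_pos)
  obtain c where c: "c \<le> h * L x 0" "reaches L h x x c"
    using reaches_line[of h x 0 "L x 0"] h by auto
  have "V h x \<le> c + k" by (rule V_le[OF h(1) c(2)]) (use k in auto)
  moreover have "h * L x 0 < m - k"
  proof -
    have "h * L x 0 \<le> (m - k) / (2 * (L x 0 + 1)) * L x 0"
      using L0 by (intro mult_right_mono) (auto simp: h_def)
    also have "\<dots> < m - k"
      using L0 \<open>k < m\<close> by (simp add: pos_divide_less_eq add_nonneg_pos)
    finally show ?thesis .
  qed
  ultimately have "V h x < m" using c by linarith
  then show "\<exists>h y. 0 < h \<and> h < d \<and> dist y x < d \<and> (case (h, y) of (t, x) \<Rightarrow> V t x) < m"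
    using h d by (intro exI[of _ h] exI[of _ x]) auto
qed

end

subsection \<open>Comparison with subsolutions and supersolutions\<close>

lemma locally_lipschitz_on_compact:
  assumes "locally_lipschitz_on D f" "compact X" "X \<subseteq> D"
  obtains K where "1 \<le> K" "K-lipschitz_on X f"
proof -
  \<comment> \<open>The time parameter of \<open>local_lipschitz\<close> is a dummy, ranging over a
    singleton.\<close>
  have "local_lipschitz {0::real} X (\<lambda>_. f)"
    unfolding local_lipschitz_def
  proof (intro ballI)
    fix z and s :: real assume "z \<in> X"
    then obtain r K where r: "0 < r" "K-lipschitz_on (ball z r \<inter> D) f"
      using assms unfolding locally_lipschitz_on_def by blast
    have "K-lipschitz_on (cball z (r / 2) \<inter> X) f"
      by (rule lipschitz_on_subset[OF r(2)]) (use r assms in auto)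
    then show "\<exists>u>0. \<exists>K. \<forall>s\<in>cball s u \<inter> {0}. K-lipschitz_on (cball z u \<inter> X) f"
      using r by (intro exI[of _ "r / 2"]) auto
  qed
  then obtain K where "\<And>s. s \<in> {0::real} \<Longrightarrow> K-lipschitz_on X f"
    by (rule local_lipschitz_compact_implies_lipschitz[OF _ assms(2)]) auto
  then have K: "K-lipschitz_on X f" by blast
  have "(max 1 K)-lipschitz_on X f" by (rule lipschitz_on_le[OF K]) simp
  then show thesis using that[of "max 1 K"] by simp
qed

lemma superdifferentialI_quadratic:
  assumes "0 < d" "0 \<le> C"
    and le: "\<And>z'. dist z' z < d \<Longrightarrow> W z' \<le> W z + p \<bullet> (z' - z) + C * (norm (z' - z))\<^sup>2"
  shows "p \<in> superdifferential W z"
  unfolding superdifferential_iff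
proof (intro allI impI)
  fix e :: real assume e: "0 < e"
  define d' where "d' = min d (e / (C + 1))"
  have "0 < d'" using assms e by (auto simp: d'_def)
  moreover have "W z' \<le> W z + p \<bullet> (z' - z) + e * norm (z' - z)" if z': "dist z' z < d'" for z'
  proof -
    have "C * norm (z' - z) \<le> (C + 1) * (e / (C + 1))"
      using z' assms(2) by (intro mult_mono) (auto simp: d'_def dist_norm)
    then have "C * norm (z' - z) * norm (z' - z) \<le> e * norm (z' - z)"
      using assms(2) by (intro mult_right_mono) auto
    then show ?thesis using le[of z'] z' by (simp add: d'_def power2_eq_square mult.assoc)
  qed
  ultimately show "\<exists>d>0. \<forall>z'. dist z' z < d \<longrightarrow> W z' \<le> W z + p \<bullet> (z' - z) + e * norm (z' - z)" by blast
qed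

lemma subdifferentialI_quadratic:
  assumes "0 < d" "0 \<le> C"
    and ge: "\<And>z'. dist z' z < d \<Longrightarrow> W z + p \<bullet> (z' - z) - C * (norm (z' - z))\<^sup>2 \<le> W z'"
  shows "p \<in> subdifferential W z"
proof -
  have "- p \<in> superdifferential (\<lambda>z. - W z) z"
    by (rule superdifferentialI_quadratic[OF assms(1,2)]) (use ge in \<open>force simp: inner_minus_left\<close>)
  then show ?thesis unfolding superdifferential_def by auto
qed

lemma power2_norm_diff_add:
  fixes a b w :: "'a::real_inner"
  shows "(norm (b + w - a))\<^sup>2 = (norm (b - a))\<^sup>2 + 2 * ((b - a) \<bullet> w) + (norm w)\<^sup>2"
  by (simp add: power2_norm_eq_inner algebra_simps inner_commute)

text \<open>The quadratic penalty is paid for by a gain that is at most linear, so the distance is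
  of order \<epsilon> and the Lipschitz error vanishes with it.\<close>

lemma penalised_point_close:
  assumes K: "K-lipschitz_on D f" and "0 < \<epsilon>" "a \<in> D" "b \<in> D"
    and "f a \<le> f b - (norm (b - a))\<^sup>2 / (2 * \<epsilon>)"
  shows "norm (b - a) \<le> 2 * \<epsilon> * K"
proof -
  have "\<bar>f b - f a\<bar> \<le> K * norm (b - a)"
    using lipschitz_onD[OF K assms(4,3)] by (simp add: dist_norm)
  then have "(norm (b - a))\<^sup>2 / (2 * \<epsilon>) \<le> K * norm (b - a)" using assms(5) by linarith
  then have "norm (b - a) * norm (b - a) \<le> (2 * \<epsilon> * K) * norm (b - a)"
    using assms(2) by (simp add: pos_divide_le_eq power2_eq_square algebra_simps)
  then show ?thesis
    using lipschitz_on_nonneg[OF K] assms(2)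
    by (cases "norm (b - a) = 0") (auto simp: mult_le_cancel_right)
qed

section \<open>Sub- and supersolutions along curves at positive times\<close>

context lagrangian
begin

text \<open>The penalty ties a free point \<open>z\<close> to the moving point \<open>l s\<close>.
  At a maximum, \<open>p = (z - l s) / \<epsilon>\<close> is a supergradient, and
  \<open>M + p \<bullet> w\<close>, which is the slope of \<Psi> in \<open>s\<close>, is positive by
  the subsolution property. Hence the maximum lies at \<open>s = h\<close>, and comparison with the
  point \<open>(l 0, 0)\<close> gives the claim.\<close>

lemma subsolution_segment:
  assumes lip: "locally_lipschitz_on pos_times W" and sub: "viscosity_subsolution L W"
    and h: "0 \<le> h" "h < t" and r: "0 < r"
    and less: "\<And>\<xi>. norm (\<xi> - x0) \<le> 2 * r \<Longrightarrow> L \<xi> u < M"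
    and near: "\<And>s. 0 \<le> s \<Longrightarrow> s \<le> h \<Longrightarrow> norm (x + s *\<^sub>R u - x0) \<le> r"
  shows "W (t, x) \<le> h * M + W (t - h, x + h *\<^sub>R u)"
proof (rule field_le_epsilon)
  fix e :: real assume e: "0 < e"
  \<comment> \<open>Half of the remaining time, so that the earliest time in \<open>D\<close> is
    still positive.\<close>
  define \<rho> where "\<rho> = (t - h) / 2"
  have \<rho>: "0 < \<rho>" using h by (simp add: \<rho>_def)
  define D where "D = {t - h - \<rho>..t + \<rho>} \<times> cball x0 (2 * r)"
  have D: "compact D" by (auto simp: D_def intro!: compact_Times)
  have "D \<subseteq> pos_times" using h by (auto simp: D_def pos_times_def \<rho>_def field_simps)
  then obtain K where K: "1 \<le> K" "K-lipschitz_on D W"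
    using locally_lipschitz_on_compact[OF lip D] by blast
  define m where "m = min (min r \<rho>) e"
  have m: "0 < m" "m \<le> r" "m \<le> \<rho>" "m \<le> e" using r \<rho> e by (auto simp: m_def)
  \<comment> \<open>Puts \<open>z\<close> within \<open>m / 2\<close> of the line, so that a ball
    around it fits into \<open>D\<close>, and keeps the final Lipschitz error below
    \<open>e\<close>.\<close>
  define \<epsilon> where "\<epsilon> = m / (4 * K * K)"
  have \<epsilon>: "0 < \<epsilon>" using m K by (simp add: \<epsilon>_def)
  have \<epsilon>K: "2 * \<epsilon> * K \<le> m / 2" "K * (2 * \<epsilon> * K) \<le> e"
  proof -
    have "2 * \<epsilon> * K = m / 2 / K" using K by (simp add: \<epsilon>_def field_simps)
    also have "\<dots> \<le> m / 2 / 1" using K m by (intro divide_left_mono) auto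
    finally show "2 * \<epsilon> * K \<le> m / 2" by simp
    have "K * (2 * \<epsilon> * K) = m / 2" using K by (simp add: \<epsilon>_def field_simps)
    then show "K * (2 * \<epsilon> * K) \<le> e" using m by simp
  qed
  define w :: "real \<times> 'a" where "w = (- 1, u)"
  define l where "l = (\<lambda>s. (t, x) + s *\<^sub>R w)"
  have l_eq: "l s = (t - s, x + s *\<^sub>R u)" for s by (simp add: l_def w_def)
  have lD: "l s \<in> D" if "0 \<le> s" "s \<le> h" for s
    using near[OF that] that \<rho> r by (auto simp: l_eq D_def dist_norm norm_minus_commute)
  define \<Psi> where "\<Psi> = (\<lambda>(z, s). W z + M * s - (norm (z - l s))\<^sup>2 / (2 * \<epsilon>))"
  have cont\<Psi>: "continuous_on (D \<times> {0..h}) \<Psi>"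
    unfolding \<Psi>_def case_prod_unfold l_def using \<epsilon>
    by (intro continuous_intros continuous_on_compose2[OF lipschitz_on_continuous_on[OF K(2)]]) auto
  have ne: "D \<times> {0..h} \<noteq> {}" using lD[of 0] h by auto
  obtain zs where zs: "zs \<in> D \<times> {0..h}" "\<And>p. p \<in> D \<times> {0..h} \<Longrightarrow> \<Psi> p \<le> \<Psi> zs"
    using continuous_attains_sup[OF compact_Times[OF D compact_Icc] ne cont\<Psi>] by blast
  obtain z s where zs_eq: "zs = (z, s)" by (cases zs)
  have z: "z \<in> D" and s: "0 \<le> s" "s \<le> h" using zs by (auto simp: zs_eq)
  have max: "W z' + M * s' - (norm (z' - l s'))\<^sup>2 / (2 * \<epsilon>) \<le> W z + M * s - (norm (z - l s))\<^sup>2 / (2 * \<epsilon>)"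
    if "z' \<in> D" "0 \<le> s'" "s' \<le> h" for z' s'
    using zs(2)[of "(z', s')"] that by (simp add: \<Psi>_def zs_eq)
  have close: "norm (z - l s) \<le> 2 * \<epsilon> * K"
    by (rule penalised_point_close[OF K(2) \<epsilon> lD[OF s] z]) (use max[OF lD[OF s] s] in simp)
  define p where "p = (z - l s) /\<^sub>R \<epsilon>"
  have p_inner: "(z - l s) \<bullet> v = \<epsilon> * (p \<bullet> v)" for v using \<epsilon> by (simp add: p_def)
  have ballD: "z' \<in> D" if z': "dist z' z < m / 2" for z'
  proof -
    have "norm (z' - l s) \<le> norm (z' - z) + norm (z - l s)" by (rule norm_diff_triangle_le[OF order_refl order_refl])
    then have n: "norm (z' - l s) \<le> m" using z' close \<epsilon>K by (simp add: dist_norm)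
    have "\<bar>fst z' - (t - s)\<bar> \<le> m"
      using n norm_fst_le[of "fst (z' - l s)" "snd (z' - l s)"] by (cases z') (simp add: l_eq)
    moreover have "norm (snd z' - (x + s *\<^sub>R u)) \<le> m"
      using n norm_snd_le[of "snd (z' - l s)" "fst (z' - l s)"] by (cases z') (simp add: l_eq)
    from norm_diff_triangle_le[OF this near[OF s]]
    have "norm (snd z' - x0) \<le> 2 * r" using m by linarith
    ultimately show ?thesis
      using m s by (cases z') (auto simp: D_def dist_norm norm_minus_commute abs_le_iff)
  qed
  have p: "p \<in> superdifferential W z"
  proof (rule superdifferentialI_quadratic)
    fix z' assume "dist z' z < m / 2"
    from max[OF ballD[OF this] s]
    have "W z' \<le> W z + ((norm (z' - l s))\<^sup>2 - (norm (z - l s))\<^sup>2) / (2 * \<epsilon>)"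
      by (simp add: diff_divide_distrib)
    also have "(norm (z' - l s))\<^sup>2 - (norm (z - l s))\<^sup>2 = 2 * ((z - l s) \<bullet> (z' - z)) + (norm (z' - z))\<^sup>2"
      using power2_norm_diff_add[of z "z' - z" "l s"] by simp
    also have "W z + (2 * ((z - l s) \<bullet> (z' - z)) + (norm (z' - z))\<^sup>2) / (2 * \<epsilon>) =
        W z + p \<bullet> (z' - z) + 1 / (2 * \<epsilon>) * (norm (z' - z))\<^sup>2"
      using \<epsilon> by (simp add: p_inner add_divide_distrib)
    finally show "W z' \<le> W z + p \<bullet> (z' - z) + 1 / (2 * \<epsilon>) * (norm (z' - z))\<^sup>2" .
  qed (use m \<epsilon> in auto)
  \<comment> \<open>\<open>- (p \<bullet> w)\<close> is \<open>pt - px \<bullet> u\<close>; the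
    strict bound by \<open>M\<close> is the gap that excludes \<open>s < h\<close>.\<close>
  have pw: "- (p \<bullet> w) < M"
  proof -
    obtain \<tau> \<xi> pt px where eq: "z = (\<tau>, \<xi>)" "p = (pt, px)" by (cases z, cases p)
    have "z \<in> pos_times" using z \<open>D \<subseteq> pos_times\<close> by blast
    then have "0 < \<tau>" by (simp add: eq pos_times_def)
    then have "pt - px \<bullet> u \<le> L \<xi> u"
      using sub[unfolded viscosity_subsolution_iff] p unfolding eq by blast
    moreover have "L \<xi> u < M"
      by (rule less) (use z in \<open>auto simp: eq D_def dist_norm norm_minus_commute\<close>)
    ultimately show ?thesis by (simp add: eq w_def)
  qed
  have "s = h"
  proof (rule ccontr)
    assume "s \<noteq> h"
    with s have sh: "s < h" by simp
    define q where "q = - (p \<bullet> w)"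
    \<comment> \<open>So short a move in \<open>s\<close> that the quadratic term uses at most half
      of the gap.\<close>
    define \<sigma> where "\<sigma> = min (h - s) (\<epsilon> * (M - q) / ((norm w)\<^sup>2 + 1))"
    have \<sigma>: "0 < \<sigma>" "\<sigma> \<le> h - s" using sh pw \<epsilon> by (auto simp: \<sigma>_def q_def add_nonneg_pos)
    have "M * \<sigma> \<le> ((norm (z - l (s + \<sigma>)))\<^sup>2 - (norm (z - l s))\<^sup>2) / (2 * \<epsilon>)"
      using max[OF z, of "s + \<sigma>"] s \<sigma> by (simp add: diff_divide_distrib distrib_left)
    also have "z - l (s + \<sigma>) = z + (- \<sigma>) *\<^sub>R w - l s" by (simp add: l_def scaleR_add_left)
    also have "(norm (z + (- \<sigma>) *\<^sub>R w - l s))\<^sup>2 - (norm (z - l s))\<^sup>2 =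
        2 * ((z - l s) \<bullet> ((- \<sigma>) *\<^sub>R w)) + (norm ((- \<sigma>) *\<^sub>R w))\<^sup>2"
      using power2_norm_diff_add[of z "(- \<sigma>) *\<^sub>R w" "l s"] by simp
    also have "\<dots> / (2 * \<epsilon>) = \<sigma> * (q + \<sigma> * (norm w)\<^sup>2 / (2 * \<epsilon>))"
      using \<epsilon> by (simp add: q_def p_inner power_mult_distrib power2_eq_square) (simp add: field_simps)
    finally have "M \<le> q + \<sigma> * (norm w)\<^sup>2 / (2 * \<epsilon>)" using \<sigma> by (simp add: mult.commute)
    moreover have "\<sigma> * (norm w)\<^sup>2 / (2 * \<epsilon>) \<le> (M - q) / 2"
    proof -
      have "\<sigma> * (norm w)\<^sup>2 \<le> \<sigma> * ((norm w)\<^sup>2 + 1)" using \<sigma> by (intro mult_left_mono) auto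
      also have "\<dots> \<le> \<epsilon> * (M - q) / ((norm w)\<^sup>2 + 1) * ((norm w)\<^sup>2 + 1)"
        by (intro mult_right_mono) (auto simp: \<sigma>_def)
      also have "\<dots> = \<epsilon> * (M - q)"
      proof -
        have "(norm w)\<^sup>2 + 1 \<noteq> 0" using zero_le_power2[of "norm w"] by linarith
        then show ?thesis by simp
      qed
      finally show ?thesis using \<epsilon> by (simp add: field_simps)
    qed
    ultimately show False using pw by (simp add: q_def field_simps)
  qed
  have "W (t, x) \<le> W z + M * h - (norm (z - l h))\<^sup>2 / (2 * \<epsilon>)"
    using max[OF lD[of 0], of 0] h by (simp add: \<open>s = h\<close> l_def)
  also have "\<dots> \<le> W z + M * h" using \<epsilon> by simp
  also have "W z \<le> W (l h) + K * norm (z - l h)"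
    using lipschitz_onD[OF K(2) z lD[OF h(1)]] by (auto simp: dist_norm)
  also have "K * norm (z - l h) \<le> e"
    using mult_left_mono[OF close, of K] K(1) \<epsilon>K(2) unfolding \<open>s = h\<close> by linarith
  finally show "W (t, x) \<le> h * M + W (t - h, x + h *\<^sub>R u) + e"
    by (simp add: l_eq mult.commute)
qed

text \<open>On a tagged interval with tag \<tau> the curve is replaced by the segment with velocity
  \<open>v \<tau>\<close> from the same initial point. Its end misses the curve by the Riemann error
  of \<open>v\<close> on that interval, and the Henstock lemma makes the sum of the norms of these
  errors small.\<close>

lemma subsolution_trajectory:
  assumes lip: "locally_lipschitz_on pos_times W" and sub: "viscosity_subsolution L W"
    and reach: "reaches L h x z c" and h: "h < t"
  shows "W (t, x) \<le> c + W (t - h, z)"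
proof -
  from reach obtain y v where tr: "trajectory h y v" and y: "y 0 = x" "y h = z"
    and l: "((\<lambda>s. L (y s) (v s)) has_integral c) {0..h}" and h0: "0 \<le> h"
    by (auto simp: reaches_def)
  define f where "f = (\<lambda>s. L (y s) (v s))"
  have v_int: "v integrable_on cbox 0 h" using trajectory_has_integral[OF tr, of 0 h] h0 by auto
  have f_int: "f integrable_on cbox 0 h" using l by (auto simp: f_def)
  have cont_y: "continuous_on {0..h} y" by (rule trajectory_continuous_on[OF tr])
  have "bounded (y ` {0..h})"
    by (intro compact_imp_bounded compact_continuous_image cont_y) auto
  then obtain B where "\<forall>s\<in>{0..h}. norm (y s) \<le> B" unfolding bounded_iff by auto
  then have B: "norm (y s) \<le> B" if "0 \<le> s" "s \<le> h" for s using that by auto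
  \<comment> \<open>Radius \<open>B + 1\<close>: the segments stay within
    \<open>r \<tau> \<le> 1\<close> of the curve.\<close>
  define D where "D = {t - h..t} \<times> cball (0 :: 'a) (B + 1)"
  have "compact D" by (auto simp: D_def intro!: compact_Times)
  moreover have "D \<subseteq> pos_times" using h by (auto simp: D_def pos_times_def)
  ultimately obtain K where K: "1 \<le> K" "K-lipschitz_on D W"
    using locally_lipschitz_on_compact[OF lip] by blast
  \<comment> \<open>\<open>e\<close> from the Riemann sum of the cost, \<open>e * h\<close> from
    freezing the cost at the tags, \<open>e * K\<close> from the missed end points.\<close>
  have main: "W (t, x) \<le> c + W (t - h, z) + e * (1 + h + K)" if e: "0 < e" for e
  proof -
    obtain \<gamma>1 where \<gamma>1: "gauge \<gamma>1" "\<And>p. \<lbrakk>p tagged_partial_division_of cbox 0 h; \<gamma>1 fine p\<rbrakk> \<Longrightarrow>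
        (\<Sum>(\<tau>, I)\<in>p. norm (measure lborel I *\<^sub>R v \<tau> - integral I v)) < e"
    proof (rule Henstock_lemma[OF v_int e])
      fix \<gamma> assume "gauge \<gamma>" "\<And>p. \<lbrakk>p tagged_partial_division_of cbox 0 h; \<gamma> fine p\<rbrakk> \<Longrightarrow>
        (\<Sum>(\<tau>, I)\<in>p. norm (measure lborel I *\<^sub>R v \<tau> - integral I v)) < e"
      from that[OF this] show thesis .
    qed
    obtain \<gamma>2 where \<gamma>2: "gauge \<gamma>2" "\<And>p. \<lbrakk>p tagged_partial_division_of cbox 0 h; \<gamma>2 fine p\<rbrakk> \<Longrightarrow>
        (\<Sum>(\<tau>, I)\<in>p. norm (measure lborel I *\<^sub>R f \<tau> - integral I f)) < e"
    proof (rule Henstock_lemma[OF f_int e])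
      fix \<gamma> assume "gauge \<gamma>" "\<And>p. \<lbrakk>p tagged_partial_division_of cbox 0 h; \<gamma> fine p\<rbrakk> \<Longrightarrow>
        (\<Sum>(\<tau>, I)\<in>p. norm (measure lborel I *\<^sub>R f \<tau> - integral I f)) < e"
      from that[OF this] show thesis .
    qed
    \<comment> \<open>The admissible length depends on \<open>v \<tau>\<close>, which has no bound
      uniform in \<tau>. A gauge permits such a choice tag by tag, where a partition of uniform mesh
      would not.\<close>
    have ex: "\<exists>\<delta> r. 0 < \<delta> \<and> 0 < r \<and> r \<le> 1 \<and> 2 * \<delta> * norm (v \<tau>) \<le> r / 2 \<and>
        (\<forall>\<xi>. norm (\<xi> - y \<tau>) \<le> 2 * r \<longrightarrow> L \<xi> (v \<tau>) < f \<tau> + e) \<and>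
        (\<forall>s. 0 \<le> s \<longrightarrow> s \<le> h \<longrightarrow> \<bar>s - \<tau>\<bar> < \<delta> \<longrightarrow> norm (y s - y \<tau>) \<le> r / 2)"
      if \<tau>: "0 \<le> \<tau>" "\<tau> \<le> h" for \<tau>
    proof -
      obtain r where r: "0 < r" "\<And>x \<xi> u. \<lbrakk>norm x \<le> norm (y \<tau>); norm (\<xi> - x) \<le> r; norm u \<le> norm (v \<tau>)\<rbrakk>
          \<Longrightarrow> \<bar>L \<xi> u - L x u\<bar> \<le> e / 2"
        using uniform_continuity[of "e / 2"] e by auto
      define r' where "r' = min 1 (r / 2)"
      have r': "0 < r'" "r' \<le> 1" "2 * r' \<le> r" using r by (auto simp: r'_def)
      obtain d where d: "0 < d" "\<And>s. s \<in> {0..h} \<Longrightarrow> dist s \<tau> < d \<Longrightarrow> dist (y s) (y \<tau>) < r' / 2"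
        using cont_y[unfolded continuous_on_iff, rule_format, of \<tau> "r' / 2"] \<tau> r' by auto
      define \<delta> where "\<delta> = min d (r' / (4 * (norm (v \<tau>) + 1)))"
      have pos: "0 < 4 * (norm (v \<tau>) + 1)" by (simp add: add_nonneg_pos)
      have "0 < \<delta>" using d r' pos by (simp add: \<delta>_def)
      moreover have "2 * \<delta> * norm (v \<tau>) \<le> r' / 2"
      proof -
        have "\<delta> * norm (v \<tau>) \<le> \<delta> * (norm (v \<tau>) + 1)" using \<open>0 < \<delta>\<close> by (intro mult_left_mono) auto
        also have "\<dots> \<le> r' / (4 * (norm (v \<tau>) + 1)) * (norm (v \<tau>) + 1)"
          by (intro mult_right_mono) (auto simp: \<delta>_def)
        also have "\<dots> = r' / 4" using pos by (simp add: field_simps)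
        finally show ?thesis by (simp add: mult.assoc)
      qed
      moreover have "L \<xi> (v \<tau>) < f \<tau> + e" if "norm (\<xi> - y \<tau>) \<le> 2 * r'" for \<xi>
      proof -
        have "\<bar>L \<xi> (v \<tau>) - L (y \<tau>) (v \<tau>)\<bar> \<le> e / 2"
          using r(2)[of "y \<tau>" \<xi> "v \<tau>"] that r' by simp
        then show ?thesis using e unfolding f_def abs_le_iff by linarith
      qed
      moreover have "norm (y s - y \<tau>) \<le> r' / 2" if "0 \<le> s" "s \<le> h" "\<bar>s - \<tau>\<bar> < \<delta>" for s
        using d(2)[of s] that by (auto simp: dist_norm \<delta>_def)
      ultimately show ?thesis using r' by blast
    qed
    obtain \<delta> where "\<forall>\<tau>\<in>{0..h}. \<exists>r. 0 < \<delta> \<tau> \<and> 0 < r \<and> r \<le> 1 \<and> 2 * \<delta> \<tau> * norm (v \<tau>) \<le> r / 2 \<and>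
        (\<forall>\<xi>. norm (\<xi> - y \<tau>) \<le> 2 * r \<longrightarrow> L \<xi> (v \<tau>) < f \<tau> + e) \<and>
        (\<forall>s. 0 \<le> s \<longrightarrow> s \<le> h \<longrightarrow> \<bar>s - \<tau>\<bar> < \<delta> \<tau> \<longrightarrow> norm (y s - y \<tau>) \<le> r / 2)"
      using bchoice[of "{0..h}" "\<lambda>\<tau> \<delta>. \<exists>r. 0 < \<delta> \<and> 0 < r \<and> r \<le> 1 \<and> 2 * \<delta> * norm (v \<tau>) \<le> r / 2 \<and>
        (\<forall>\<xi>. norm (\<xi> - y \<tau>) \<le> 2 * r \<longrightarrow> L \<xi> (v \<tau>) < f \<tau> + e) \<and>
        (\<forall>s. 0 \<le> s \<longrightarrow> s \<le> h \<longrightarrow> \<bar>s - \<tau>\<bar> < \<delta> \<longrightarrow> norm (y s - y \<tau>) \<le> r / 2)"] ex by auto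
    from bchoice[OF this] obtain r where
      "\<forall>\<tau>\<in>{0..h}. 0 < \<delta> \<tau> \<and> 0 < r \<tau> \<and> r \<tau> \<le> 1 \<and> 2 * \<delta> \<tau> * norm (v \<tau>) \<le> r \<tau> / 2 \<and>
        (\<forall>\<xi>. norm (\<xi> - y \<tau>) \<le> 2 * r \<tau> \<longrightarrow> L \<xi> (v \<tau>) < f \<tau> + e) \<and>
        (\<forall>s. 0 \<le> s \<longrightarrow> s \<le> h \<longrightarrow> \<bar>s - \<tau>\<bar> < \<delta> \<tau> \<longrightarrow> norm (y s - y \<tau>) \<le> r \<tau> / 2)" by blast
    then have \<delta>: "\<And>\<tau>. 0 \<le> \<tau> \<Longrightarrow> \<tau> \<le> h \<Longrightarrow> 0 < \<delta> \<tau>"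
      and r: "\<And>\<tau>. 0 \<le> \<tau> \<Longrightarrow> \<tau> \<le> h \<Longrightarrow> 0 < r \<tau>" "\<And>\<tau>. 0 \<le> \<tau> \<Longrightarrow> \<tau> \<le> h \<Longrightarrow> r \<tau> \<le> 1"
      and \<delta>v: "\<And>\<tau>. 0 \<le> \<tau> \<Longrightarrow> \<tau> \<le> h \<Longrightarrow> 2 * \<delta> \<tau> * norm (v \<tau>) \<le> r \<tau> / 2"
      and Lr: "\<And>\<tau> \<xi>. 0 \<le> \<tau> \<Longrightarrow> \<tau> \<le> h \<Longrightarrow> norm (\<xi> - y \<tau>) \<le> 2 * r \<tau> \<Longrightarrow> L \<xi> (v \<tau>) < f \<tau> + e"
      and yr: "\<And>\<tau> s. 0 \<le> \<tau> \<Longrightarrow> \<tau> \<le> h \<Longrightarrow> 0 \<le> s \<Longrightarrow> s \<le> h \<Longrightarrow> \<bar>s - \<tau>\<bar> < \<delta> \<tau> \<Longrightarrow> norm (y s - y \<tau>) \<le> r \<tau> / 2"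
      by auto
    \<comment> \<open>The radius 1 outside \<open>{0..h}\<close> is only a default that makes this a
      gauge.\<close>
    define \<gamma>3 where "\<gamma>3 = (\<lambda>\<tau>. ball \<tau> (if 0 \<le> \<tau> \<and> \<tau> \<le> h then \<delta> \<tau> else 1))"
    have "gauge \<gamma>3" unfolding \<gamma>3_def by (rule gauge_ball_dependent) (use \<delta> in auto)
    then have "gauge (\<lambda>\<tau>. \<gamma>1 \<tau> \<inter> (\<gamma>2 \<tau> \<inter> \<gamma>3 \<tau>))" using \<gamma>1 \<gamma>2 by (intro gauge_Int)
    then obtain p where p: "p tagged_division_of cbox 0 h" "(\<lambda>\<tau>. \<gamma>1 \<tau> \<inter> (\<gamma>2 \<tau> \<inter> \<gamma>3 \<tau>)) fine p"
      using fine_division_exists by blast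
    have fine: "\<gamma>1 fine p" "\<gamma>2 fine p" "\<gamma>3 fine p" using p(2) by (auto simp: fine_def)
    have partial: "p tagged_partial_division_of cbox 0 h" using p(1) by (simp add: tagged_division_of_def)
    define g where "g = (\<lambda>s. W (t - s, y s))"
    have step: "g (Inf I) - g (Sup I) \<le>
        measure lborel I * (f \<tau> + e) + K * norm (measure lborel I *\<^sub>R v \<tau> - integral I v)" if I: "(\<tau>, I) \<in> p" for \<tau> I
    proof -
      obtain a b where ab: "I = {a..b}" using tagged_division_ofD(4)[OF p(1) I] by auto
      have \<tau>I: "a \<le> \<tau>" "\<tau> \<le> b" using tagged_division_ofD(2)[OF p(1) I] by (auto simp: ab)
      have sub_h: "0 \<le> a" "b \<le> h" using tagged_division_ofD(3)[OF p(1) I] \<tau>I by (auto simp: ab)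
      have \<tau>: "0 \<le> \<tau>" "\<tau> \<le> h" using \<tau>I sub_h by auto
      have "I \<subseteq> \<gamma>3 \<tau>" using fine(3) I by (auto simp: fine_def)
      then have "a \<in> \<gamma>3 \<tau>" "b \<in> \<gamma>3 \<tau>" using \<tau>I by (auto simp: ab)
      then have near: "\<bar>a - \<tau>\<bar> < \<delta> \<tau>" "\<bar>b - \<tau>\<bar> < \<delta> \<tau>"
        using \<tau> by (simp_all add: \<gamma>3_def dist_real_def abs_minus_commute)
      have seg: "norm (y a + s *\<^sub>R v \<tau> - y \<tau>) \<le> r \<tau>" if s: "0 \<le> s" "s \<le> b - a" for s
      proof -
        have "norm (s *\<^sub>R v \<tau>) \<le> 2 * \<delta> \<tau> * norm (v \<tau>)"
          using s near by (simp add: mult_right_mono)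
        also have "\<dots> \<le> r \<tau> / 2" by (rule \<delta>v[OF \<tau>])
        finally have "norm (s *\<^sub>R v \<tau>) \<le> r \<tau> / 2" .
        moreover have "norm (y a - y \<tau>) \<le> r \<tau> / 2"
          by (rule yr[OF \<tau>]) (use sub_h \<tau>I near in auto)
        ultimately show ?thesis
          using norm_triangle_ineq[of "y a - y \<tau>" "s *\<^sub>R v \<tau>"] by (simp add: algebra_simps)
      qed
      have "W (t - a, y a) \<le> (b - a) * (f \<tau> + e) + W (t - a - (b - a), y a + (b - a) *\<^sub>R v \<tau>)"
        by (rule subsolution_segment[OF lip sub _ _ r(1)[OF \<tau>] Lr[OF \<tau>] seg])
          (use sub_h \<tau>I h in auto)
      then have 1: "g a \<le> (b - a) * (f \<tau> + e) + W (t - b, y a + (b - a) *\<^sub>R v \<tau>)"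
        by (simp add: g_def)
      have "norm (y a + (b - a) *\<^sub>R v \<tau>) \<le> B + 1"
        using seg[of "b - a"] \<tau>I r(2)[OF \<tau>] B[OF \<tau>]
          norm_triangle_sub[of "y a + (b - a) *\<^sub>R v \<tau>" "y \<tau>"] by linarith
      then have "(t - b, y a + (b - a) *\<^sub>R v \<tau>) \<in> D" "(t - b, y b) \<in> D"
        using sub_h \<tau>I B[of b] by (auto simp: D_def)
      from lipschitz_onD[OF K(2) this]
      have "W (t - b, y a + (b - a) *\<^sub>R v \<tau>) \<le> g b + K * norm (y a + (b - a) *\<^sub>R v \<tau> - y b)"
        by (auto simp: g_def dist_norm)
      also have "y a + (b - a) *\<^sub>R v \<tau> - y b = measure lborel I *\<^sub>R v \<tau> - integral I v"
        using integral_unique[OF trajectory_has_integral[OF tr sub_h(1) _ sub_h(2)]] \<tau>I by (simp add: ab)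
      finally show ?thesis using 1 \<tau>I by (simp add: ab)
    qed
    have "g 0 - g h = (\<Sum>(\<tau>, I)\<in>p. g (Inf I) - g (Sup I))"
      using additive_tagged_division_1[OF h0, of p g] p(1)
      by (simp add: case_prod_unfold sum_subtractf)
    also have "\<dots> \<le> (\<Sum>(\<tau>, I)\<in>p. measure lborel I * (f \<tau> + e) + K * norm (measure lborel I *\<^sub>R v \<tau> - integral I v))"
      by (rule sum_mono) (use step in auto)
    also have "\<dots> = (\<Sum>(\<tau>, I)\<in>p. measure lborel I * f \<tau>) + (\<Sum>(\<tau>, I)\<in>p. measure lborel I) * e +
        K * (\<Sum>(\<tau>, I)\<in>p. norm (measure lborel I *\<^sub>R v \<tau> - integral I v))"
      by (simp add: case_prod_unfold sum.distrib sum_distrib_left sum_distrib_right distrib_left)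
    also have "(\<Sum>(\<tau>, I)\<in>p. measure lborel I) = h"
      using additive_content_tagged_division[OF p(1)] h0 by simp
    also have "(\<Sum>(\<tau>, I)\<in>p. measure lborel I * f \<tau>) \<le> c + e"
    proof -
      have "(\<Sum>(\<tau>, I)\<in>p. integral I f) = c"
        using has_integral_combine_tagged_division_topdown[OF f_int p(1)] l h0
        by (auto simp: f_def intro: has_integral_unique)
      then have "(\<Sum>(\<tau>, I)\<in>p. measure lborel I * f \<tau>) - c = (\<Sum>(\<tau>, I)\<in>p. measure lborel I *\<^sub>R f \<tau> - integral I f)"
        by (simp add: case_prod_unfold sum_subtractf)
      also have "\<dots> \<le> (\<Sum>(\<tau>, I)\<in>p. norm (measure lborel I *\<^sub>R f \<tau> - integral I f))"
        by (rule sum_mono) auto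
      also have "\<dots> < e" by (rule \<gamma>2(2)[OF partial fine(2)])
      finally show ?thesis by simp
    qed
    also have "K * (\<Sum>(\<tau>, I)\<in>p. norm (measure lborel I *\<^sub>R v \<tau> - integral I v)) \<le> K * e"
      using \<gamma>1(2)[OF partial fine(1)] K(1) by (intro mult_left_mono) auto
    finally have "g 0 - g h \<le> c + e + h * e + K * e" by simp
    then show ?thesis using y by (simp add: g_def algebra_simps)
  qed
  show ?thesis
  proof (rule field_le_epsilon)
    fix e :: real assume e: "0 < e"
    have "0 < 1 + h + K" using h0 K by simp
    then show "W (t, x) \<le> c + W (t - h, z) + e" using main[of "e / (1 + h + K)"] e by simp
  qed
qed

text \<open>Growth of slope \<open>R + 1\<close> beats the linear term of a subgradient of norm at
  most \<open>R\<close> by a full \<open>norm u\<close>; the resulting speed bound is uniform over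
  all such subgradients.\<close>

lemma supersolution_near_optimal_velocity:
  assumes super: "viscosity_supersolution L W" and t: "0 < t"
    and p: "(p, q) \<in> subdifferential W (t, x)" and norm: "norm (p, q) \<le> R" and \<eta>: "0 < \<eta>"
    and C: "\<And>x u. (R + 1) * norm u - C \<le> L x u"
  obtains u where "L x u + q \<bullet> u \<le> p + \<eta>" "norm u \<le> C + R + \<eta>"
proof -
  obtain u where u: "L x u + q \<bullet> u < p + \<eta>"
    using super p t \<eta> unfolding viscosity_supersolution_iff by blast
  have "p \<le> R" "norm q \<le> R"
    using norm norm_fst_le[of p q] norm_snd_le[of q p] by auto
  then have "norm q * norm u \<le> R * norm u" by (intro mult_right_mono) auto
  moreover have "- (q \<bullet> u) \<le> norm q * norm u"
    using norm_cauchy_schwarz[of "- q" u] by simp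
  moreover have "R * norm u + norm u - C \<le> L x u" using C[of u x] by (simp add: algebra_simps)
  ultimately have "norm u \<le> C + R + \<eta>" using u \<open>p \<le> R\<close> by linarith
  with u that show thesis by force
qed

text \<open>For a minimiser \<open>\<pi> z\<close> of the inf-convolution \<open>E\<close>, the
  vector \<open>(z - \<pi> z) / \<epsilon>\<close> is a subgradient of \<open>W\<close> at
  \<open>\<pi> z\<close> and also gives a quadratic upper bound for \<open>E\<close> around
  \<open>z\<close>. So the supersolution property, used at \<open>\<pi> z\<close>, makes
  \<open>E\<close> decrease along the step from \<open>z\<close> up to an error of order
  \<open>h * h\<close> for fixed \<epsilon>.\<close>

lemma supersolution_euler:
  assumes lip: "locally_lipschitz_on pos_times W" and super: "viscosity_supersolution L W"
    and nonneg_W: "\<And>z. z \<in> pos_times \<Longrightarrow> 0 \<le> W z"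
    and \<delta>: "0 < \<delta>" "\<delta> < t" and e: "0 < e"
  obtains z c where "reaches L (t - \<delta>) x z c" "c + W (\<delta>, z) \<le> W (t, x) + e"
proof -
  obtain C1 where C1: "0 \<le> C1" "\<And>x u. 1 * norm u - C1 \<le> L x u"
    using superlinearE by blast
  define e0 where "e0 = min e 1"
  have e0: "0 < e0" "e0 \<le> e" "e0 \<le> 1" using e by (auto simp: e0_def)
  \<comment> \<open>Since \<open>E\<close> is nonnegative, the accumulated cost never exceeds
    \<open>W (t, x) + 1\<close>, and growth of slope 1 confines the polygon to this radius.\<close>
  define \<rho> where "\<rho> = W (t, x) + 1 + C1 * t"
  define D where "D = {\<delta> / 2..t + 1} \<times> cball x (\<rho> + 1)"
  have D: "compact D" by (auto simp: D_def intro!: compact_Times)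
  have Dpos: "D \<subseteq> pos_times" using \<delta> by (auto simp: D_def pos_times_def)
  obtain K where K: "1 \<le> K" "K-lipschitz_on D W"
    using locally_lipschitz_on_compact[OF lip D Dpos] by blast
  obtain C where C: "0 \<le> C" "\<And>x u. (2 * K + 1) * norm u - C \<le> L x u"
    using superlinearE by blast
  \<comment> \<open>Per unit time \<eta> is lost three times: near-optimality of the velocity,
    variation of L, the quadratic term. The total is \<open>e0 / 2\<close>; the other half pays for
    passing from \<open>E\<close> back to \<open>W\<close> at the end.\<close>
  define \<eta> where "\<eta> = e0 / (6 * (t + 1))"
  have \<eta>: "0 < \<eta>" "\<eta> \<le> 1" "3 * \<eta> * t \<le> e0 / 2"
    using e0 \<delta> by (auto simp: \<eta>_def divide_simps)
  define R where "R = C + 2 * K + 1"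
  have R: "0 < R" using C K by (simp add: R_def)
  obtain r where r: "0 < r"
    "\<And>y \<xi> u. \<lbrakk>norm y \<le> norm x + \<rho> + 1; norm (\<xi> - y) \<le> r; norm u \<le> R\<rbrakk> \<Longrightarrow> \<bar>L \<xi> u - L y u\<bar> \<le> \<eta>"
    using uniform_continuity[OF \<eta>(1)] by blast
  define m where "m = min (min (\<delta> / 2) 1) (min r e0)"
  have m: "0 < m" "m \<le> \<delta> / 2" "m \<le> 1" "m \<le> r" "m \<le> e0"
  proof -
    show "0 < m" using \<delta> r e0 by (auto simp: m_def)
  qed (simp_all only: m_def min_le_iff_disj order_refl simp_thms)
  define \<epsilon> where "\<epsilon> = m / (4 * K * K)"
  have \<epsilon>: "0 < \<epsilon>" using m K by (simp add: \<epsilon>_def)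
  have \<epsilon>K: "2 * \<epsilon> * K \<le> m / 2" "K * (2 * \<epsilon> * K) = m / 2"
  proof -
    have "2 * \<epsilon> * K = m / 2 / K" using K by (simp add: \<epsilon>_def field_simps)
    also have "\<dots> \<le> m / 2 / 1" using K m by (intro divide_left_mono) auto
    finally show "2 * \<epsilon> * K \<le> m / 2" by simp
    show "K * (2 * \<epsilon> * K) = m / 2" using K by (simp add: \<epsilon>_def field_simps)
  qed
  define S where "S = 1 + R\<^sup>2"
  have S: "0 < S" by (simp add: S_def add_pos_nonneg)
  \<comment> \<open>The first bound keeps a step within \<open>r / 2\<close>, the second makes the
    quadratic error at most \<eta> per unit time; \<open>S\<close> bounds the squared norm of
    \<open>(- 1, u)\<close>.\<close>
  define h0 where "h0 = min (r / (2 * R)) (2 * \<epsilon> * \<eta> / S)"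
  have h0: "0 < h0" using r R \<epsilon> \<eta> S by (simp add: h0_def)
  obtain N :: nat where N: "(t - \<delta>) / h0 < real N" using reals_Archimedean2 by blast
  have N0: "0 < real N" using N h0 \<delta> by (smt (verit) divide_pos_pos)
  define h where "h = (t - \<delta>) / real N"
  have h: "0 < h" "h \<le> h0" "real N * h = t - \<delta>"
    using N N0 h0 \<delta> by (auto simp: h_def field_simps)
  have hR: "h * R \<le> r / 2"
  proof -
    have "h * R \<le> r / (2 * R) * R" using h R by (intro mult_right_mono) (auto simp: h0_def)
    then show ?thesis using R by simp
  qed
  have hS: "h * S / (2 * \<epsilon>) \<le> \<eta>"
  proof -
    have "h * S \<le> 2 * \<epsilon> * \<eta> / S * S" using h S by (intro mult_right_mono) (auto simp: h0_def)
    then have "h * S \<le> 2 * \<epsilon> * \<eta>" using S by simp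
    then show ?thesis using \<epsilon> by (simp add: pos_divide_le_eq mult.commute)
  qed
  define J where "J = (\<lambda>z z'. W z' + (norm (z - z'))\<^sup>2 / (2 * \<epsilon>))"
  have "(t, x) \<in> D"
  proof -
    have "0 \<le> \<rho>" using nonneg_W[of "(t, x)"] \<delta> C1 by (simp add: \<rho>_def pos_times_def)
    then show ?thesis using \<delta> by (simp add: D_def)
  qed
  have "\<exists>z'\<in>D. \<forall>z''\<in>D. J z z' \<le> J z z''" for z
  proof (rule continuous_attains_inf[OF D])
    show "continuous_on D (J z)"
      unfolding J_def using \<epsilon>
      by (intro continuous_intros lipschitz_on_continuous_on[OF K(2)]) auto
  qed (use \<open>(t, x) \<in> D\<close> in auto)
  \<comment> \<open>Defined for every \<open>z\<close>, because the next vertex of the polygon is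
    not yet known to lie in \<open>D\<close> when \<open>E\<close> is estimated there.\<close>
  then obtain \<pi> where \<pi>: "\<And>z. \<pi> z \<in> D" "\<And>z z'. z' \<in> D \<Longrightarrow> J z (\<pi> z) \<le> J z z'"
    by metis
  define E where "E = (\<lambda>z. J z (\<pi> z))"
  have E_nonneg: "0 \<le> E z" for z
    using nonneg_W[of "\<pi> z"] \<pi>(1)[of z] Dpos \<epsilon> by (auto simp: E_def J_def)
  have E_le: "E z \<le> W z" if "z \<in> D" for z
    using \<pi>(2)[OF that, of z] by (simp add: E_def J_def)
  have close: "norm (z - \<pi> z) \<le> 2 * \<epsilon> * K" if "z \<in> D" for z
  proof -
    define q where "q = norm (z - \<pi> z)"
    have "W (\<pi> z) + q\<^sup>2 / (2 * \<epsilon>) \<le> W z"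
      using \<pi>(2)[OF that, of z] by (simp add: J_def q_def)
    moreover have "W z \<le> W (\<pi> z) + K * q"
      using lipschitz_onD[OF K(2) that \<pi>(1)[of z]] by (auto simp: dist_norm q_def)
    ultimately have "q\<^sup>2 / (2 * \<epsilon>) \<le> K * q" by linarith
    then have "q * q \<le> (2 * \<epsilon> * K) * q"
      using \<epsilon> by (simp add: pos_divide_le_eq power2_eq_square algebra_simps)
    then show ?thesis
      using \<epsilon> K(1) by (cases "q = 0") (auto simp: q_def mult_le_cancel_right)
  qed
  have step: "\<exists>u c. reaches L h \<xi> (\<xi> + h *\<^sub>R u) c \<and> c + E (\<tau> - h, \<xi> + h *\<^sub>R u) \<le> E (\<tau>, \<xi>) + 3 * \<eta> * h"
    if \<tau>: "\<delta> \<le> \<tau>" "\<tau> \<le> t" and \<xi>: "norm (\<xi> - x) \<le> \<rho>" for \<tau> \<xi>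
  proof -
    define z where "z = (\<tau>, \<xi>)"
    define z' where "z' = \<pi> z"
    have z: "z \<in> D" using \<tau> \<xi> \<delta> by (auto simp: z_def D_def dist_norm norm_minus_commute)
    have zz': "norm (z - z') \<le> m / 2" using close[OF z] \<epsilon>K(1) by (simp add: z'_def)
    have z'D: "z' \<in> D" using \<pi>(1) by (simp add: z'_def)
    obtain \<tau>' \<xi>' where z'_eq: "z' = (\<tau>', \<xi>')" by (cases z')
    define p where "p = (z - z') /\<^sub>R \<epsilon>"
    have p_inner: "(z - z') \<bullet> v = \<epsilon> * (p \<bullet> v)" for v using \<epsilon> by (simp add: p_def)
    obtain pt px where p_eq: "p = (pt, px)" by (cases p)
    have p_norm: "norm p \<le> 2 * K"
    proof -
      have "norm p = norm (z - z') / \<epsilon>" using \<epsilon> by (simp add: p_def divide_inverse mult.commute)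
      also have "\<dots> \<le> 2 * \<epsilon> * K / \<epsilon>" using close[OF z] \<epsilon> by (intro divide_right_mono) (auto simp: z'_def)
      finally show ?thesis using \<epsilon> by simp
    qed
    have "p \<in> subdifferential W z'"
    proof (rule subdifferentialI_quadratic)
      fix y assume y: "dist y z' < m / 2"
      have "norm (y - z) \<le> norm (y - z') + norm (z' - z)"
        by (rule norm_diff_triangle_le[OF order_refl order_refl])
      then have n: "norm (y - z) \<le> m" using y zz' by (simp add: dist_norm norm_minus_commute)
      have "\<bar>fst y - \<tau>\<bar> \<le> m"
        using n norm_fst_le[of "fst (y - z)" "snd (y - z)"] by (cases y) (simp add: z_def)
      moreover have "norm (snd y - \<xi>) \<le> m"
        using n norm_snd_le[of "snd (y - z)" "fst (y - z)"] by (cases y) (simp add: z_def)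
      from norm_diff_triangle_le[OF this \<xi>] have "norm (snd y - x) \<le> \<rho> + 1" using m by linarith
      moreover have "\<delta> / 2 \<le> \<tau> - m" using \<tau> m by linarith
      ultimately have "y \<in> D"
        using \<tau> m by (cases y) (auto simp: D_def dist_norm norm_minus_commute abs_le_iff)
      from \<pi>(2)[OF this, of z]
      have "W z' + ((norm (z - z'))\<^sup>2 - (norm (z - y))\<^sup>2) / (2 * \<epsilon>) \<le> W y"
        by (simp add: J_def z'_def diff_divide_distrib)
      also have "(norm (z - y))\<^sup>2 = (norm (z - z'))\<^sup>2 - 2 * ((z - z') \<bullet> (y - z')) + (norm (y - z'))\<^sup>2"
      proof -
        have "(z - z') \<bullet> (z' - y) = - ((z - z') \<bullet> (y - z'))"
          by (metis inner_minus_right minus_diff_eq)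
        then show ?thesis
          using power2_norm_diff_add[of z "- (y - z')" z'] by (simp add: norm_minus_commute)
      qed
      also have "W z' + ((norm (z - z'))\<^sup>2 - ((norm (z - z'))\<^sup>2 - 2 * ((z - z') \<bullet> (y - z')) + (norm (y - z'))\<^sup>2)) / (2 * \<epsilon>)
          = W z' + p \<bullet> (y - z') - 1 / (2 * \<epsilon>) * (norm (y - z'))\<^sup>2"
        using \<epsilon> by (simp add: p_inner diff_divide_distrib)
      finally show "W z' + p \<bullet> (y - z') - 1 / (2 * \<epsilon>) * (norm (y - z'))\<^sup>2 \<le> W y" .
    qed (use m \<epsilon> in auto)
    then have p_sub: "(pt, px) \<in> subdifferential W (\<tau>', \<xi>')" by (simp add: p_eq z'_eq)
    have "0 < \<tau>'" using z'D Dpos by (auto simp: z'_eq pos_times_def)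
    from supersolution_near_optimal_velocity[OF super this p_sub p_norm[unfolded p_eq] \<eta>(1) C(2)]
    obtain u where u: "L \<xi>' u + px \<bullet> u \<le> pt + \<eta>" "norm u \<le> C + 2 * K + \<eta>" by blast
    have uR: "norm u \<le> R" using u(2) \<eta> by (simp add: R_def)
    have \<xi>': "norm (\<xi> - \<xi>') \<le> m / 2" "norm \<xi>' \<le> norm x + \<rho> + 1"
    proof -
      show "norm (\<xi> - \<xi>') \<le> m / 2"
        using zz' norm_snd_le[of "\<xi> - \<xi>'" "\<tau> - \<tau>'"] by (simp add: z_def z'_eq)
      have "norm (\<xi>' - x) \<le> \<rho> + 1" using z'D by (simp add: z'_eq D_def dist_norm norm_minus_commute)
      then show "norm \<xi>' \<le> norm x + \<rho> + 1" using norm_triangle_sub[of \<xi>' x] by linarith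
    qed
    have "L (\<xi> + s *\<^sub>R u) u \<le> L \<xi>' u + \<eta>" if s: "0 \<le> s" "s \<le> h" for s
    proof -
      have "norm (s *\<^sub>R u) \<le> h * R" using s uR h by (auto intro: mult_mono)
      moreover have "norm (\<xi> + s *\<^sub>R u - \<xi>') \<le> norm (\<xi> - \<xi>') + norm (s *\<^sub>R u)"
        using norm_triangle_ineq[of "\<xi> - \<xi>'" "s *\<^sub>R u"] by (simp add: algebra_simps)
      ultimately have "norm (\<xi> + s *\<^sub>R u - \<xi>') \<le> r" using \<xi>'(1) hR m by linarith
      from r(2)[OF \<xi>'(2) this uR] show ?thesis by linarith
    qed
    then obtain c where c: "c \<le> h * (L \<xi>' u + \<eta>)" "reaches L h \<xi> (\<xi> + h *\<^sub>R u) c"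
      using reaches_line[of h \<xi> u "L \<xi>' u + \<eta>"] h by auto
    \<comment> \<open>The old minimiser \<open>z'\<close> is kept as competitor for \<open>E\<close>
      at the new vertex, so only the square of the distance has to be expanded.\<close>
    define w :: "real \<times> 'a" where "w = (- 1, u)"
    have w_norm: "(norm w)\<^sup>2 \<le> S"
      using uR by (simp add: w_def S_def norm_Pair power_mono)
    have next_eq: "(\<tau> - h, \<xi> + h *\<^sub>R u) = z + h *\<^sub>R w" by (simp add: z_def w_def)
    have "E (z + h *\<^sub>R w) \<le> W z' + (norm (z + h *\<^sub>R w - z'))\<^sup>2 / (2 * \<epsilon>)"
      using \<pi>(2)[OF z'D, of "z + h *\<^sub>R w"] by (simp add: E_def J_def)
    also have "(norm (z + h *\<^sub>R w - z'))\<^sup>2 = (norm (z - z'))\<^sup>2 + 2 * ((z - z') \<bullet> (h *\<^sub>R w)) + (norm (h *\<^sub>R w))\<^sup>2"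
      by (rule power2_norm_diff_add)
    also have "W z' + ((norm (z - z'))\<^sup>2 + 2 * ((z - z') \<bullet> (h *\<^sub>R w)) + (norm (h *\<^sub>R w))\<^sup>2) / (2 * \<epsilon>)
        = E z + h * (p \<bullet> w) + h * (h * (norm w)\<^sup>2 / (2 * \<epsilon>))"
      using \<epsilon> by (simp add: p_inner E_def J_def z'_def[symmetric] add_divide_distrib power_mult_distrib
          power2_eq_square)
    also have "h * (h * (norm w)\<^sup>2 / (2 * \<epsilon>)) \<le> h * \<eta>"
    proof (rule mult_left_mono)
      have "h * (norm w)\<^sup>2 / (2 * \<epsilon>) \<le> h * S / (2 * \<epsilon>)"
        using w_norm h \<epsilon> by (intro divide_right_mono mult_left_mono) auto
      with hS show "h * (norm w)\<^sup>2 / (2 * \<epsilon>) \<le> \<eta>" by linarith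
    qed (use h in simp)
    also have "h * (p \<bullet> w) \<le> h * (\<eta> - L \<xi>' u)"
      using u(1) h by (intro mult_left_mono) (auto simp: p_eq w_def)
    finally have "E (z + h *\<^sub>R w) \<le> E z + h * (\<eta> - L \<xi>' u) + h * \<eta>" by simp
    then have "c + E (\<tau> - h, \<xi> + h *\<^sub>R u) \<le> E (\<tau>, \<xi>) + 3 * \<eta> * h"
      using c(1) unfolding next_eq z_def[symmetric] by (simp add: algebra_simps)
    with c(2) show ?thesis by blast
  qed
  have iter: "\<exists>\<xi> c. reaches L (real k * h) x \<xi> c \<and> c + E (t - real k * h, \<xi>) \<le> E (t, x) + 3 * \<eta> * (real k * h)"
    if "k \<le> N" for k
    using that
  proof (induction k)
    case 0
    then show ?case using reaches_refl[of L x] by (intro exI[of _ x] exI[of _ 0]) simp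
  next
    case (Suc k)
    then obtain \<xi> c where IH: "reaches L (real k * h) x \<xi> c"
      "c + E (t - real k * h, \<xi>) \<le> E (t, x) + 3 * \<eta> * (real k * h)" by auto
    have "real (Suc k) * h \<le> real N * h" using Suc.prems h by (intro mult_right_mono) auto
    then have kh: "0 \<le> real k * h" "real k * h + h \<le> t - \<delta>" using h by (auto simp: algebra_simps)
    \<comment> \<open>Confinement is derived afresh from the accumulated cost; \<open>D\<close> was
      fixed before the speed bound, so that bound cannot be used here.\<close>
    have "norm (\<xi> - x) \<le> \<rho>"
    proof -
      have "1 * norm (\<xi> - x) \<le> c + C1 * (real k * h)"
        by (rule displacement[OF IH(1) _ C1(2)]) simp
      moreover have "C1 * (real k * h) \<le> C1 * t" "3 * \<eta> * (real k * h) \<le> 3 * \<eta> * t"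
        using kh h \<delta> C1 \<eta> by (auto intro!: mult_left_mono)
      moreover have "E (t, x) \<le> W (t, x)" by (rule E_le) fact
      ultimately show ?thesis
        using IH(2) E_nonneg[of "(t - real k * h, \<xi>)"] \<eta>(3) e0 unfolding \<rho>_def by linarith
    qed
    then obtain u c' where *: "reaches L h \<xi> (\<xi> + h *\<^sub>R u) c'"
      "c' + E (t - real k * h - h, \<xi> + h *\<^sub>R u) \<le> E (t - real k * h, \<xi>) + 3 * \<eta> * h"
      using step[of "t - real k * h" \<xi>] kh h by auto
    have eq: "real (Suc k) * h = real k * h + h" by (simp add: algebra_simps)
    have "reaches L (real k * h + h) x (\<xi> + h *\<^sub>R u) (c + c')"
      by (rule reaches_append[OF IH(1) *(1)])
    moreover have "c + c' + E (t - (real k * h + h), \<xi> + h *\<^sub>R u) \<le> E (t, x) + 3 * \<eta> * (real k * h + h)"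
      using IH(2) *(2) by (simp add: algebra_simps)
    ultimately show ?case unfolding eq by blast
  qed
  obtain \<xi> c where \<xi>: "reaches L (t - \<delta>) x \<xi> c" "c + E (\<delta>, \<xi>) \<le> E (t, x) + 3 * \<eta> * (t - \<delta>)"
    using iter[of N] h(3) by auto
  have "3 * \<eta> * (t - \<delta>) \<le> 3 * \<eta> * t" using \<eta> \<delta> by (intro mult_left_mono) auto
  then have E_end: "c + E (\<delta>, \<xi>) \<le> W (t, x) + e0 / 2"
    using \<xi>(2) \<eta>(3) E_le[OF \<open>(t, x) \<in> D\<close>] by linarith
  have "(\<delta>, \<xi>) \<in> D"
  proof -
    have "1 * norm (\<xi> - x) \<le> c + C1 * (t - \<delta>)"
      by (rule displacement[OF \<xi>(1) _ C1(2)]) simp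
    moreover have "C1 * (t - \<delta>) \<le> C1 * t" using \<delta> C1 by (intro mult_left_mono) auto
    ultimately have "norm (\<xi> - x) \<le> \<rho>"
      using E_end E_nonneg[of "(\<delta>, \<xi>)"] e0 unfolding \<rho>_def by linarith
    then show ?thesis using \<delta> by (auto simp: D_def dist_norm norm_minus_commute)
  qed
  have "W (\<delta>, \<xi>) \<le> E (\<delta>, \<xi>) + m / 2"
  proof -
    have "W (\<delta>, \<xi>) \<le> W (\<pi> (\<delta>, \<xi>)) + K * norm ((\<delta>, \<xi>) - \<pi> (\<delta>, \<xi>))"
      using lipschitz_onD[OF K(2) \<open>(\<delta>, \<xi>) \<in> D\<close> \<pi>(1)[of "(\<delta>, \<xi>)"]] by (auto simp: dist_norm)
    also have "K * norm ((\<delta>, \<xi>) - \<pi> (\<delta>, \<xi>)) \<le> m / 2"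
      using mult_left_mono[OF close[OF \<open>(\<delta>, \<xi>) \<in> D\<close>], of K] K(1) \<epsilon>K(2) by linarith
    also have "W (\<pi> (\<delta>, \<xi>)) \<le> E (\<delta>, \<xi>)" using \<epsilon> by (simp add: E_def J_def)
    finally show ?thesis by simp
  qed
  then have "c + W (\<delta>, \<xi>) \<le> W (t, x) + e" using E_end m e0 by linarith
  with \<xi>(1) that show thesis by blast
qed

end

section \<open>Comparison down to time 0\<close>

context bolza
begin

text \<open>The initial condition yields only some \<open>(h, y)\<close> near \<open>(0, z)\<close>
  at which W is at most slightly larger than \<open>\<phi> z\<close>; a nearly optimal curve ending
  in \<open>z\<close> is redirected to reach \<open>y\<close> at time \<open>t - h\<close>.\<close>

lemma subsolution_le_V:
  assumes lip: "locally_lipschitz_on pos_times W" and sub: "viscosity_subsolution L W"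
    and init: "initial_condition \<phi> W" and t: "0 < t"
  shows "W (t, x) \<le> V t x"
proof (rule field_le_epsilon)
  fix e' :: real assume "0 < e'"
  \<comment> \<open>Three errors: optimality of the curve, the initial condition, the
    redirection.\<close>
  define e where "e = e' / 3"
  have e: "0 < e" using \<open>0 < e'\<close> by (simp add: e_def)
  obtain z c k where z: "reaches L t x z c" "\<phi> z = ennreal k" "0 \<le> k" "c + k < V t x + e"
    using V_less[OF t, of x "V t x + e"] e by auto
  obtain C d where C: "0 \<le> C" "0 < d"
    "\<And>s y z' c' t' z''. \<lbrakk>reaches L s y z' c'; t \<le> s; s \<le> t; norm y \<le> max (norm x) c; c' \<le> max (norm x) c;
        \<bar>t' - s\<bar> + norm (z'' - z') \<le> d\<rbrakk>
       \<Longrightarrow> \<exists>c''\<le>c' + C * (\<bar>t' - s\<bar> + norm (z'' - z')). reaches L t' y z'' c''"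
    using perturb_end[OF t, of t "max (norm x) c"] by blast
  define d' where "d' = min (min (d / 2) t) (e / (2 * (C + 1)))"
  have d': "0 < d'" "d' \<le> d / 2" "d' \<le> t" "d' \<le> e / (2 * (C + 1))"
  proof -
    show "0 < d'" using C t e unfolding d'_def by auto
  qed (simp_all only: d'_def min_le_iff_disj order_refl simp_thms)
  have "enn2ereal (\<phi> z) < ereal (k + e)" using z e by (simp add: enn2ereal_ennreal)
  then obtain h y where hy: "0 < h" "h < d'" "dist y z < d'" "W (h, y) < k + e"
    using init[unfolded initial_condition_iff] d' by blast
  define q where "q = \<bar>(t - h) - t\<bar> + norm (y - z)"
  have q: "0 \<le> q" "q \<le> 2 * d'" using hy by (auto simp: q_def dist_norm)
  obtain c' where c': "c' \<le> c + C * q" "reaches L (t - h) x y c'"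
    using C(3)[OF z(1), of "t - h" y] q d' unfolding q_def by auto
  have "W (t, x) \<le> c' + W (t - (t - h), y)"
    by (rule subsolution_trajectory[OF lip sub c'(2)]) (use hy in auto)
  moreover have "C * q \<le> e"
  proof -
    have "C * q \<le> (C + 1) * (2 * (e / (2 * (C + 1))))" using q d' C by (intro mult_mono) auto
    also have "\<dots> = e"
    proof -
      have "C + 1 \<noteq> 0" using C(1) by linarith
      then show ?thesis by (simp add: field_simps)
    qed
    finally show ?thesis .
  qed
  ultimately show "W (t, x) \<le> V t x + e'" using z c' hy by (simp add: e_def)
qed

text \<open>The polygons stop at times \<open>\<delta> n\<close> tending to 0, at end points in a
  compact ball. At a cluster point \<open>a\<close> the lower half of the initial condition bounds
  \<open>W (\<delta> n, z n)\<close> from below by nearly \<open>\<phi> a\<close>, and the polygon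
  is redirected to end in \<open>a\<close> itself.\<close>

lemma V_le_supersolution:
  assumes lip: "locally_lipschitz_on pos_times W" and super: "viscosity_supersolution L W"
    and nonneg_W: "\<And>z. z \<in> pos_times \<Longrightarrow> 0 \<le> W z"
    and init: "initial_condition \<phi> W" and t: "0 < t"
  shows "V t x \<le> W (t, x)"
proof (rule field_le_epsilon)
  fix e' :: real assume "0 < e'"
  define e where "e = e' / 3"
  have e: "0 < e" using \<open>0 < e'\<close> by (simp add: e_def)
  define M where "M = W (t, x) + e"
  \<comment> \<open>The shift by 2 keeps \<open>\<delta> n \<le> t / 2\<close>, so durations stay
    above \<open>t / 2\<close>, as \<open>perturb_end\<close> requires with one constant for all
    \<open>n\<close>.\<close>
  define \<delta> where "\<delta> = (\<lambda>n. t / real (n + 2))"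
  have \<delta>: "0 < \<delta> n" "\<delta> n < t" for n using t by (auto simp: \<delta>_def field_simps add_pos_nonneg)
  have "\<exists>z c. reaches L (t - \<delta> n) x z c \<and> c + W (\<delta> n, z) \<le> M" for n
    unfolding M_def by (rule supersolution_euler[OF lip super nonneg_W \<delta> e, of n x]) auto
  then obtain z c where z: "\<And>n. reaches L (t - \<delta> n) x (z n) (c n)" "\<And>n. c n + W (\<delta> n, z n) \<le> M"
    by metis
  have W0: "0 \<le> W (\<delta> n, z n)" for n by (rule nonneg_W) (use \<delta> in \<open>auto simp: pos_times_def\<close>)
  have c0: "0 \<le> c n" for n by (rule reaches_nonneg[OF z(1)])
  have cM: "c n \<le> M" for n using z(2)[of n] W0[of n] by linarith
  obtain C1 where C1: "0 \<le> C1" "\<And>x u. 1 * norm u - C1 \<le> L x u"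
    using superlinearE by blast
  have "z n \<in> cball x (M + C1 * t)" for n
  proof -
    have "1 * norm (z n - x) \<le> c n + C1 * (t - \<delta> n)"
      by (rule displacement[OF z(1) _ C1(2)]) simp
    moreover have "C1 * (t - \<delta> n) \<le> C1 * t" using \<delta>(1)[of n] C1 by (intro mult_left_mono) auto
    ultimately show ?thesis using cM[of n] by (simp add: dist_norm norm_minus_commute)
  qed
  then obtain a \<sigma> where \<sigma>: "strict_mono (\<sigma> :: nat \<Rightarrow> nat)" "(z \<circ> \<sigma>) \<longlonglongrightarrow> a"
    using seq_compactE[OF compact_imp_seq_compact[OF compact_cball]] by metis
  have "\<delta> \<longlonglongrightarrow> 0"
    unfolding \<delta>_def using LIMSEQ_ignore_initial_segment[OF lim_const_over_n[of t], of 2] by simp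
  then have \<delta>_lim: "(\<delta> \<circ> \<sigma>) \<longlonglongrightarrow> 0" by (rule LIMSEQ_subseq_LIMSEQ[OF _ \<sigma>(1)])
  have small: "\<exists>n. \<delta> n < d \<and> dist (z n) a < d" if "0 < d" for d
  proof -
    have "\<forall>\<^sub>F n in sequentially. dist ((\<delta> \<circ> \<sigma>) n) 0 < d \<and> dist ((z \<circ> \<sigma>) n) a < d"
      using tendstoD[OF \<delta>_lim that] tendstoD[OF \<sigma>(2) that] by (rule eventually_conj)
    then obtain n where "dist ((\<delta> \<circ> \<sigma>) n) 0 < d" "dist ((z \<circ> \<sigma>) n) a < d"
      by (auto simp: eventually_sequentially)
    then show ?thesis by (intro exI[of _ "\<sigma> n"]) auto
  qed
  have lower: "\<exists>d>0. \<forall>n. \<delta> n < d \<longrightarrow> dist (z n) a < d \<longrightarrow> m < W (\<delta> n, z n)"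
    if m: "ereal m < enn2ereal (\<phi> a)" for m
  proof -
    obtain d where "0 < d" "\<forall>h y. 0 < h \<longrightarrow> h < d \<longrightarrow> dist y a < d \<longrightarrow> m < W (h, y)"
      using init[unfolded initial_condition_iff, THEN spec, THEN spec, THEN conjunct1, THEN mp, OF m]
      by auto
    then show ?thesis using \<delta>(1) by auto
  qed
  \<comment> \<open>Otherwise W would exceed \<open>M\<close> at some
    \<open>(\<delta> n, z n)\<close>, although cost plus W is at most \<open>M\<close>.\<close>
  have "\<phi> a \<noteq> \<infinity>"
  proof
    assume "\<phi> a = \<infinity>"
    then obtain d where "0 < d" "\<forall>n. \<delta> n < d \<longrightarrow> dist (z n) a < d \<longrightarrow> M < W (\<delta> n, z n)"
      using lower[of M] by auto
    with small obtain n where "M < W (\<delta> n, z n)" by blast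
    with z(2)[of n] c0[of n] show False by linarith
  qed
  then obtain k where k: "\<phi> a = ennreal k" "0 \<le> k" by (cases "\<phi> a" rule: ennreal_cases) auto
  obtain d1 where d1: "0 < d1" "\<And>n. \<delta> n < d1 \<Longrightarrow> dist (z n) a < d1 \<Longrightarrow> k - e < W (\<delta> n, z n)"
    using lower[of "k - e"] k e by (auto simp: enn2ereal_ennreal)
  have t2: "0 < t / 2" using t by simp
  obtain C d where C: "0 \<le> C" "0 < d"
    "\<And>s y z' c' t' z''. \<lbrakk>reaches L s y z' c'; t / 2 \<le> s; s \<le> t; norm y \<le> max (norm x) M;
        c' \<le> max (norm x) M; \<bar>t' - s\<bar> + norm (z'' - z') \<le> d\<rbrakk>
       \<Longrightarrow> \<exists>c''\<le>c' + C * (\<bar>t' - s\<bar> + norm (z'' - z')). reaches L t' y z'' c''"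
    using perturb_end[OF t2, of t "max (norm x) M"] by blast
  define d' where "d' = min d1 (min (d / 2) (e / (2 * (C + 1))))"
  have "0 < d'" using C d1 e by (auto simp: d'_def)
  have d': "d' \<le> d1" "d' \<le> d / 2" "d' \<le> e / (2 * (C + 1))"
    by (simp_all only: d'_def min_le_iff_disj order_refl simp_thms)
  obtain n where n: "\<delta> n < d'" "dist (z n) a < d'" using small[OF \<open>0 < d'\<close>] by blast
  define q where "q = \<bar>t - (t - \<delta> n)\<bar> + norm (a - z n)"
  have q: "0 \<le> q" "q \<le> 2 * d'"
    using n \<delta>(1)[of n] by (auto simp: q_def dist_norm norm_minus_commute)
  have "t / 2 \<le> t - \<delta> n" using t by (simp add: \<delta>_def field_simps)
  then obtain c' where c': "c' \<le> c n + C * q" "reaches L t x a c'"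
    using C(3)[OF z(1)[of n], of t a] q d' \<delta>[of n] cM[of n] unfolding q_def
    by (auto simp: le_max_iff_disj)
  have "C * q \<le> e"
  proof -
    have "C * q \<le> (C + 1) * (2 * (e / (2 * (C + 1))))" using q d' C by (intro mult_mono) auto
    also have "\<dots> = e"
    proof -
      have "C + 1 \<noteq> 0" using C(1) by linarith
      then show ?thesis by (simp add: field_simps)
    qed
    finally show ?thesis .
  qed
  moreover have "V t x \<le> c' + k" by (rule V_le[OF t c'(2)]) (use k in auto)
  moreover have "k - e < W (\<delta> n, z n)" using d1(2)[of n] n d' by auto
  moreover have "c n + W (\<delta> n, z n) \<le> W (t, x) + e" using z(2)[of n] by (simp add: M_def)
  ultimately show "V t x \<le> W (t, x) + e'" using c'(1) by (simp add: e_def)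
qed

end

theorem theorem4p6:
  fixes L :: "real ^ 'n \<Rightarrow> real ^ 'n \<Rightarrow> real"
    and \<phi> :: "real ^ 'n \<Rightarrow> ennreal"
    and \<Theta> :: "real ^ 'n \<Rightarrow> real"
  defines "V \<equiv> (\<lambda>(t, x). enn2real (value_function L \<phi> t x))"
  assumes L_nonneg: "\<And>x u. 0 \<le> L x u"
    and L_lsc: "lsc (\<lambda>(x, u). ereal (L x u))"
    and L_convex: "\<And>x. convex_on UNIV (L x)"
    and \<Theta>_nonneg: "\<And>u. 0 \<le> \<Theta> u"
    and \<Theta>_convex: "convex_on UNIV \<Theta>"
    and \<Theta>_superlinear: "filterlim (\<lambda>u. \<Theta> u / norm u) at_top at_infinity"
    and L_ge_\<Theta>: "\<And>x u. \<Theta> u \<le> L x u"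
    and \<phi>_lsc: "lsc \<phi>"
    and \<phi>_proper: "\<exists>x. \<phi> x \<noteq> \<infinity>"
    and L_cont: "continuous_on UNIV (\<lambda>(x, u). L x u)"
  shows
    "((\<forall>(t, x)\<in>pos_times. value_function L \<phi> t x < \<infinity>) \<and>
      locally_lipschitz_on pos_times V \<and>
      viscosity_supersolution L V \<and>
      viscosity_subsolution L V)
     \<and>
     (\<forall>W. (\<forall>z\<in>pos_times. 0 \<le> W z) \<and> locally_lipschitz_on pos_times W \<and> initial_condition \<phi> W \<longrightarrow>
        (viscosity_supersolution L W \<longrightarrow> (\<forall>z\<in>pos_times. V z \<le> W z)) \<and>
        (viscosity_subsolution L W \<longrightarrow> (\<forall>z\<in>pos_times. W z \<le> V z)))
     \<and>
     (((\<forall>z\<in>pos_times. 0 \<le> V z) \<and> locally_lipschitz_on pos_times V \<and>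
       viscosity_supersolution L V \<and> viscosity_subsolution L V \<and> initial_condition \<phi> V) \<and>
      (\<forall>W. (\<forall>z\<in>pos_times. 0 \<le> W z) \<and> locally_lipschitz_on pos_times W \<and>
         viscosity_supersolution L W \<and> viscosity_subsolution L W \<and> initial_condition \<phi> W \<longrightarrow>
         (\<forall>z\<in>pos_times. W z = V z)))"
proof -
  \<comment> \<open>Beyond norm \<open>b\<close> the bound comes from \<Theta>; inside, the constant
    makes the left side nonpositive and nonnegativity of L suffices.\<close>
  have superlinear: "\<exists>C. \<forall>x u. K * norm u - C \<le> L x u" for K
  proof -
    obtain b where b: "\<And>u. b \<le> norm u \<Longrightarrow> K \<le> \<Theta> u / norm u"
      using \<Theta>_superlinear unfolding filterlim_at_top eventually_at_infinity by meson
    have "K * norm u - \<bar>K\<bar> * \<bar>b\<bar> \<le> L x u" for x u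
    \<comment> \<open>\<open>u = 0\<close> is set apart because \<open>b\<close> need not be
      positive and the quotient is then a division by 0.\<close>
    proof (cases "b \<le> norm u \<and> u \<noteq> 0")
      case True
      then have "K * norm u \<le> \<Theta> u" using b[of u] by (simp add: pos_le_divide_eq)
      moreover have "0 \<le> \<bar>K\<bar> * \<bar>b\<bar>" by simp
      ultimately show ?thesis using L_ge_\<Theta>[of u x] by linarith
    next
      case False
      then have "norm u \<le> \<bar>b\<bar>" by auto
      then have "K * norm u \<le> \<bar>K\<bar> * \<bar>b\<bar>" by (intro mult_mono) auto
      then show ?thesis using L_nonneg[of x u] by linarith
    qed
    then show ?thesis by blast
  qed
  interpret bolza L \<phi>
    by standard (use L_nonneg L_cont superlinear \<phi>_lsc \<phi>_proper in auto)
  have V_eq: "V = (\<lambda>(t, x). bolza.V L \<phi> t x)"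
    by (simp add: assms(1) V_def)
  have V_nonneg: "0 \<le> V z" for z by (simp add: V_eq case_prod_unfold)
  have finite: "\<forall>(t, x)\<in>pos_times. value_function L \<phi> t x < \<infinity>"
    using value_function_finite by (auto simp: pos_times_def)
  note V = V_locally_lipschitz[folded V_eq] V_supersolution[folded V_eq] V_subsolution[folded V_eq]
    V_initial_condition[folded V_eq]
  have ge: "V z \<le> W z" if "\<forall>z\<in>pos_times. 0 \<le> W z" "locally_lipschitz_on pos_times W"
    "initial_condition \<phi> W" "viscosity_supersolution L W" "z \<in> pos_times" for W z
    using V_le_supersolution[of W "fst z" "snd z"] that by (auto simp: V_eq pos_times_def)
  have le: "W z \<le> V z" if "locally_lipschitz_on pos_times W"
    "initial_condition \<phi> W" "viscosity_subsolution L W" "z \<in> pos_times" for W z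
    using subsolution_le_V[of W "fst z" "snd z"] that by (auto simp: V_eq pos_times_def)
  have eq: "W z = V z" if "\<forall>z\<in>pos_times. 0 \<le> W z" "locally_lipschitz_on pos_times W"
    "viscosity_supersolution L W" "viscosity_subsolution L W" "initial_condition \<phi> W" "z \<in> pos_times" for W z
    using ge[of W z] le[of W z] that by (intro antisym) auto
  show ?thesis using finite V V_nonneg ge le eq by blast
qed

end
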